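(* Let $\mathcal H$ be a vector sublattice of $L^\Phi(\mathfrak P)$ that contains $\mathbf 1_\Omega$ and generates $\mathcal F$, let $\mathcal C=\mathrm{cl}(\mathcal H)$ be its norm closure in $L^\Phi(\mathfrak P)$, and assume $L^\infty(\mathfrak P)\subset L^\Phi(\mathfrak P)$. The space $(\mathcal C,\preceq,\|\cdot\|_{L^\Phi(\mathfrak P)})$ is a Banach lattice and $\mathbf{ca}(\mathcal C)=\mathbf{ca}(\mathcal H)$. If $\mathcal H\subset L^\infty(\mathfrak P)$ and $\|\cdot\|_{L^\Phi(\mathfrak P)}$ is $\sigma$-order continuous on $\mathcal H$, then $$\mathcal C^*=\mathbf{ca}(\mathcal C)=\mathbf{ca}(\mathcal H)=\mathbf{ca}^\sigma(\mathcal H)\cap\mathcal C^*.$$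
   Context: $(\Omega,\mathcal F)$ is a measurable space, $\mathfrak P$ a nonempty set of probability measures on it. $L^0(\mathfrak P)$ is the space of equivalence classes $[f]$ of measurable $f\colon\Omega\to\mathbb R$ under $f\sim g\iff \mathbb P(f=g)=1$ for all $\mathbb P\in\mathfrak P$, with the order $X\preceq Y$ iff $\mathbb P(f\le g)=1$ for all $\mathbb P\in\mathfrak P$, $f\in X$, $g\in Y$; it is a vector lattice. $L^\infty(\mathfrak P)\subset L^0(\mathfrak P)$ is the space of classes of bounded random variables. An Orlicz function is a lower semicontinuous, nondecreasing, convex $\phi\colon[0,\infty)\to[0,\infty]$ with $\phi(0)=0$ such that there are $x_0,x_1>0$ with $\phi(x_0)<\infty$, $\phi(x_1)>0$. $\Phi=(\phi_{\mathbb P})_{\mathbb P\in\mathfrak P}$ is a family of Orlicz functions; for $X\in L^0(\mathfrak P)$, $\|X\|_{L^\Phi(\mathfrak P)}=\inf\{\lambda>0:\sup_{\mathbb P\in\mathfrak P}\mathbb E_{\mathbb P}[\phi_{\mathbb P}(\lambda^{-1}|X|)]\le1\}$, and $L^\Phi(\mathfrak P)=\{X: \|X\|_{L^\Phi(\mathfrak P)}<\infty\}$; this is a Banach lattice. Standing assumption: $L^\infty(\mathfrak P)\subset L^\Phi(\mathfrak P)$. $\mathcal H$ generates $\mathcal F$ if the $\sigma$-algebra generated by $\{f\colon\Omega\to\mathbb R\text{ measurable}: [f]\in\mathcal H\}$ equals $\mathcal F$. $\mathbf{ca}(\mathfrak P)$ is the set of signed measures $\mu$ on $(\Omega,\mathcal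 F)$ of finite total variation such that $|\mu|(N)=0$ for every $N\in\mathcal F$ with $\sup_{\mathbb P\in\mathfrak P}\mathbb P(N)=0$. For $\mathcal X\in\{\mathcal H,\mathcal C\}$, $\mathbf{ca}(\mathcal X)$ is the set of $\mu\in\mathbf{ca}(\mathfrak P)$ such that every $X\in\mathcal X$ is $|\mu|$-integrable and $X\mapsto\int X\,d|\mu|$ is norm continuous on $\mathcal X$. A possibly nonlinear functional $\ell\colon\mathcal X\to\mathbb R$ on a vector lattice is $\sigma$-order continuous if (i) $\{\ell(z): x\preceq z\preceq y\}$ is bounded for all $x,y\in\mathcal X$, and (ii) $\lim_n|\ell(x_n)|=0$ for all sequences $(x_n)\subset\mathcal X$ for which there is $(y_n)\subset\mathcal X_+$ with $|x_n|\preceq y_n$ for all $n$ and $y_n\downarrow0$ (i.e. $y_{n+1}\preceq y_n$ and $\inf_ny_n=0$ in $\mathcal X$). Every $\sigma$-order continuous linear functional on $\mathcal H$ is of the form $X\mapsto\int X\,d\mu$ for a unique $\mu\in\mathbf{ca}(\mathfrak P)$ for which all $X\in\mathcal H$ are $|\mu|$-integrable; $\mathbf{ca}^\sigma(\mathcal H)$ is the set of these measures. Stars denote norm duals (w.r.t. $\|\cdot\|_{L^\Phi(\mathfrak P)}$); $\mathcal C^*=\mathcal H^*$ by density, and measures are identified with the functionals $X\mapsto\int X\,d\mu$. *)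

theory Defs
  imports "HOL-Probability.Probability" "HOL-Algebra.Lattice" "HOL-Algebra.Group"
begin

section \<open>Normed vector lattices on carrier sets\<close>

record 'x nvl = "'x gorder" +
  vzero :: 'x
  vadd :: "'x \<Rightarrow> 'x \<Rightarrow> 'x"
  vscale :: "real \<Rightarrow> 'x \<Rightarrow> 'x"
  vnorm :: "'x \<Rightarrow> real"

locale vector_lattice = lattice L for L :: "('x, 'm) nvl_scheme" (structure) +
  assumes additive_group: "comm_group \<lparr>carrier = carrier L, mult = vadd L, one = vzero L\<rparr>"
    and scale_closed: "x \<in> carrier L \<Longrightarrow> vscale L a x \<in> carrier L"
    and scale_add_right: "\<lbrakk>x \<in> carrier L; y \<in> carrier L\<rbrakk> \<Longrightarrow>
          vscale L a (vadd L x y) = vadd L (vscale L a x) (vscale L a y)"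
    and scale_add_left: "x \<in> carrier L \<Longrightarrow>
          vscale L (a + b) x = vadd L (vscale L a x) (vscale L b x)"
    and scale_scale: "x \<in> carrier L \<Longrightarrow> vscale L a (vscale L b x) = vscale L (a * b) x"
    and scale_one: "x \<in> carrier L \<Longrightarrow> vscale L 1 x = x"
    and add_mono_le: "\<lbrakk>x \<in> carrier L; y \<in> carrier L; z \<in> carrier L; x \<sqsubseteq> y\<rbrakk> \<Longrightarrow>
          vadd L x z \<sqsubseteq> vadd L y z"
    and scale_mono_le: "\<lbrakk>x \<in> carrier L; y \<in> carrier L; 0 \<le> a; x \<sqsubseteq> y\<rbrakk> \<Longrightarrow>
          vscale L a x \<sqsubseteq> vscale L a y"

definition vabs :: "('x, 'm) nvl_scheme \<Rightarrow> 'x \<Rightarrow> 'x" where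
  "vabs L x = x \<squnion>\<^bsub>L\<^esub> vscale L (-1) x"

text \<open>The locale \<^locale>\<open>Metric_space\<close> demands symmetry and nonnegativity on the whole type,
  hence the value 0 outside of the carrier.\<close>

definition vdist :: "('x, 'm) nvl_scheme \<Rightarrow> 'x \<Rightarrow> 'x \<Rightarrow> real" where
  "vdist L x y = (if x \<in> carrier L \<and> y \<in> carrier L
                  then vnorm L (vadd L x (vscale L (-1) y)) else 0)"

definition norm_topology :: "('x, 'm) nvl_scheme \<Rightarrow> 'x topology" where
  "norm_topology L = Metric_space.mtopology (carrier L) (vdist L)"

locale banach_lattice = vector_lattice L for L :: "('x, 'm) nvl_scheme" (structure) +
  assumes norm_nonneg: "x \<in> carrier L \<Longrightarrow> 0 \<le> vnorm L x"
    and norm_eq_0: "x \<in> carrier L \<Longrightarrow> vnorm L x = 0 \<longleftrightarrow> x = vzero L"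
    and norm_scale: "x \<in> carrier L \<Longrightarrow> vnorm L (vscale L a x) = \<bar>a\<bar> * vnorm L x"
    and norm_triangle: "\<lbrakk>x \<in> carrier L; y \<in> carrier L\<rbrakk> \<Longrightarrow>
          vnorm L (vadd L x y) \<le> vnorm L x + vnorm L y"
    and norm_lattice: "\<lbrakk>x \<in> carrier L; y \<in> carrier L; vabs L x \<sqsubseteq> vabs L y\<rbrakk> \<Longrightarrow>
          vnorm L x \<le> vnorm L y"
    and complete: "Metric_space.mcomplete (carrier L) (vdist L)"

definition vector_sublattice :: "'x set \<Rightarrow> ('x, 'm) nvl_scheme \<Rightarrow> bool" where
  "vector_sublattice S L \<longleftrightarrow>
     S \<subseteq> carrier L \<and> vzero L \<in> S \<and>
     (\<forall>x\<in>S. \<forall>y\<in>S. vadd L x y \<in> S) \<and> (\<forall>a. \<forall>x\<in>S. vscale L a x \<in> S) \<and>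
     (\<forall>x\<in>S. \<forall>y\<in>S. x \<squnion>\<^bsub>L\<^esub> y \<in> S \<and> x \<sqinter>\<^bsub>L\<^esub> y \<in> S)"

text \<open>The infimum of \<open>y\<close> is taken in \<open>L\<close> itself and not in some larger lattice. It is expressed
  by \<^const>\<open>greatest\<close>, since the term \<open>\<Sqinter>\<^bsub>L\<^esub>range y\<close> is unspecified if there is no infimum.\<close>

definition sigma_order_continuous :: "('x, 'm) nvl_scheme \<Rightarrow> ('x \<Rightarrow> real) \<Rightarrow> bool" where
  "sigma_order_continuous L l \<longleftrightarrow>
     (\<forall>x\<in>carrier L. \<forall>y\<in>carrier L. bounded (l ` \<lbrace>x..y\<rbrace>\<^bsub>L\<^esub>)) \<and>
     (\<forall>x y :: nat \<Rightarrow> 'x.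
        (\<forall>n. x n \<in> carrier L) \<and> (\<forall>n. y n \<in> carrier L \<and> vzero L \<sqsubseteq>\<^bsub>L\<^esub> y n) \<and>
        (\<forall>n. vabs L (x n) \<sqsubseteq>\<^bsub>L\<^esub> y n) \<and>
        (\<forall>n. y (Suc n) \<sqsubseteq>\<^bsub>L\<^esub> y n) \<and> greatest L (vzero L) (Lower L (range y))
        \<longrightarrow> (\<lambda>n. \<bar>l (x n)\<bar>) \<longlonglongrightarrow> 0)"

text \<open>Functionals are taken to be \<^const>\<open>undefined\<close> outside of the carrier, so that they are
  determined by their values on the carrier.\<close>

definition norm_dual :: "('x, 'm) nvl_scheme \<Rightarrow> ('x \<Rightarrow> real) set" where
  "norm_dual L = {l \<in> extensional (carrier L).
     (\<forall>x\<in>carrier L. \<forall>y\<in>carrier L. l (vadd L x y) = l x + l y) \<and>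
     (\<forall>a. \<forall>x\<in>carrier L. l (vscale L a x) = a * l x) \<and>
     continuous_map (norm_topology L) euclideanreal l}"


section \<open>Robust Orlicz spaces\<close>

text \<open>The measurable space is given by \<^term>\<open>M :: 'a measure\<close>, of which only \<^term>\<open>space M\<close> and
  \<^term>\<open>sets M\<close> matter; \<open>PP\<close> is a set of probability measures on it. Elements of
  \<open>L\<^sup>0\<close> are equivalence classes, i.e. sets of measurable functions.\<close>

definition qs_class :: "'a measure \<Rightarrow> 'a measure set \<Rightarrow> ('a \<Rightarrow> real) \<Rightarrow> ('a \<Rightarrow> real) set" where
  "qs_class M PP f = {g \<in> borel_measurable M. \<forall>P\<in>PP. AE \<omega> in P. f \<omega> = g \<omega>}"

definition L0 :: "'a measure \<Rightarrow> 'a measure set \<Rightarrow> ('a \<Rightarrow> real) set set" where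
  "L0 M PP = qs_class M PP ` borel_measurable M"

definition rep :: "('a \<Rightarrow> real) set \<Rightarrow> 'a \<Rightarrow> real" where
  "rep X = (SOME f. f \<in> X)"

definition qs_le :: "'a measure set \<Rightarrow> ('a \<Rightarrow> real) set \<Rightarrow> ('a \<Rightarrow> real) set \<Rightarrow> bool" where
  "qs_le PP X Y \<longleftrightarrow> (\<forall>P\<in>PP. \<forall>f\<in>X. \<forall>g\<in>Y. AE \<omega> in P. f \<omega> \<le> g \<omega>)"

definition Linf :: "'a measure \<Rightarrow> 'a measure set \<Rightarrow> ('a \<Rightarrow> real) set set" where
  "Linf M PP = qs_class M PP ` {f \<in> borel_measurable M. \<exists>c. \<forall>\<omega>\<in>space M. \<bar>f \<omega>\<bar> \<le> c}"

text \<open>An Orlicz function \<open>[0, \<infinity>) \<rightarrow> [0, \<infinity>]\<close>; its values at negative arguments are irrelevant.\<close>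

definition orlicz_function :: "(real \<Rightarrow> ennreal) \<Rightarrow> bool" where
  "orlicz_function \<phi> \<longleftrightarrow>
     (\<forall>x\<ge>0. \<phi> x \<le> Liminf (at x within {0..}) \<phi>) \<and>
     mono_on {0..} \<phi> \<and>
     (\<forall>x\<ge>0. \<forall>y\<ge>0. \<forall>t\<in>{0..1}.
        \<phi> ((1 - t) * x + t * y) \<le> ennreal (1 - t) * \<phi> x + ennreal t * \<phi> y) \<and>
     \<phi> 0 = 0 \<and> (\<exists>x0>0. \<phi> x0 < \<infinity>) \<and> (\<exists>x1>0. \<phi> x1 > 0)"

definition orlicz_norm ::
    "'a measure set \<Rightarrow> ('a measure \<Rightarrow> real \<Rightarrow> ennreal) \<Rightarrow> ('a \<Rightarrow> real) set \<Rightarrow> ennreal" where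
  "orlicz_norm PP \<Phi> X =
     Inf {ennreal c | c. c > 0 \<and> (SUP P\<in>PP. \<integral>\<^sup>+ \<omega>. \<Phi> P (inverse c * \<bar>rep X \<omega>\<bar>) \<partial>P) \<le> 1}"

definition LPhi ::
    "'a measure \<Rightarrow> 'a measure set \<Rightarrow> ('a measure \<Rightarrow> real \<Rightarrow> ennreal) \<Rightarrow> ('a \<Rightarrow> real) set set" where
  "LPhi M PP \<Phi> = {X \<in> L0 M PP. orlicz_norm PP \<Phi> X < \<infinity>}"

text \<open>The set \<open>S\<close> of classes with the order and the operations of \<open>L\<^sup>0\<close> and the norm of
  \<open>L\<^sup>\<Phi>\<close>.\<close>

definition space_on :: "'a measure \<Rightarrow> 'a measure set \<Rightarrow> ('a measure \<Rightarrow> real \<Rightarrow> ennreal) \<Rightarrow>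
    ('a \<Rightarrow> real) set set \<Rightarrow> ('a \<Rightarrow> real) set nvl" where
  "space_on M PP \<Phi> S =
     \<lparr>carrier = S, eq = (=), le = qs_le PP,
      vzero = qs_class M PP (\<lambda>_. 0),
      vadd = (\<lambda>X Y. qs_class M PP (\<lambda>\<omega>. rep X \<omega> + rep Y \<omega>)),
      vscale = (\<lambda>a X. qs_class M PP (\<lambda>\<omega>. a * rep X \<omega>)),
      vnorm = (\<lambda>X. enn2real (orlicz_norm PP \<Phi> X))\<rparr>"

definition generates :: "'a measure \<Rightarrow> 'a measure set \<Rightarrow> ('a \<Rightarrow> real) set set \<Rightarrow> bool" where
  "generates M PP H \<longleftrightarrow>
     sigma_sets (space M)
       {f -` B \<inter> space M | f B. f \<in> borel_measurable M \<and> qs_class M PP f \<in> H \<and> B \<in> sets borel}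
     = sets M"


section \<open>Signed measures\<close>

text \<open>Signed measures of finite total variation are real-valued. The value 0 outside of the
  \<open>\<sigma>\<close>-algebra makes equality of signed measures equality of functions.\<close>

definition signed_measure :: "'a measure \<Rightarrow> ('a set \<Rightarrow> real) \<Rightarrow> bool" where
  "signed_measure M \<mu> \<longleftrightarrow>
     (\<forall>A. A \<notin> sets M \<longrightarrow> \<mu> A = 0) \<and> \<mu> {} = 0 \<and>
     (\<forall>A :: nat \<Rightarrow> 'a set. range A \<subseteq> sets M \<longrightarrow> disjoint_family A \<longrightarrow>
        (\<lambda>i. \<mu> (A i)) sums \<mu> (\<Union>i. A i))"

text \<open>The Jordan decomposition: \<open>\<mu>\<^sup>+ A = sup {\<mu> B | B \<subseteq> A}\<close>, \<open>\<mu>\<^sup>- = (-\<mu>)\<^sup>+\<close> and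
  \<open>|\<mu>| = \<mu>\<^sup>+ + \<mu>\<^sup>-\<close>. Negative values are harmless in the supremum, as \<^const>\<open>ennreal\<close> maps
  them to \<open>0 = \<mu> {}\<close>.\<close>

definition pos_var :: "'a measure \<Rightarrow> ('a set \<Rightarrow> real) \<Rightarrow> 'a measure" where
  "pos_var M \<mu> = measure_of (space M) (sets M) (\<lambda>A. SUP B\<in>{B \<in> sets M. B \<subseteq> A}. ennreal (\<mu> B))"

definition neg_var :: "'a measure \<Rightarrow> ('a set \<Rightarrow> real) \<Rightarrow> 'a measure" where
  "neg_var M \<mu> = pos_var M (\<lambda>A. - \<mu> A)"

definition abs_var :: "'a measure \<Rightarrow> ('a set \<Rightarrow> real) \<Rightarrow> 'a measure" where
  "abs_var M \<mu> =
     measure_of (space M) (sets M) (\<lambda>A. emeasure (pos_var M \<mu>) A + emeasure (neg_var M \<mu>) A)"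

definition ca :: "'a measure \<Rightarrow> 'a measure set \<Rightarrow> ('a set \<Rightarrow> real) set" where
  "ca M PP = {\<mu>. signed_measure M \<mu> \<and> emeasure (abs_var M \<mu>) (space M) < \<infinity> \<and>
     (\<forall>N\<in>sets M. (SUP P\<in>PP. emeasure P N) = 0 \<longrightarrow> emeasure (abs_var M \<mu>) N = 0)}"

definition all_integrable :: "'a measure \<Rightarrow> ('a set \<Rightarrow> real) \<Rightarrow> ('a \<Rightarrow> real) set set \<Rightarrow> bool" where
  "all_integrable M \<mu> S \<longleftrightarrow> (\<forall>X\<in>S. \<forall>f\<in>X. integrable (abs_var M \<mu>) f)"

definition signed_integral :: "'a measure \<Rightarrow> ('a set \<Rightarrow> real) \<Rightarrow> ('a \<Rightarrow> real) set \<Rightarrow> real" where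
  "signed_integral M \<mu> X =
     (\<integral>\<omega>. rep X \<omega> \<partial>pos_var M \<mu>) - (\<integral>\<omega>. rep X \<omega> \<partial>neg_var M \<mu>)"

definition ca_on :: "'a measure \<Rightarrow> 'a measure set \<Rightarrow> ('a measure \<Rightarrow> real \<Rightarrow> ennreal) \<Rightarrow>
    ('a \<Rightarrow> real) set set \<Rightarrow> ('a set \<Rightarrow> real) set" where
  "ca_on M PP \<Phi> S = {\<mu> \<in> ca M PP. all_integrable M \<mu> S \<and>
     continuous_map (norm_topology (space_on M PP \<Phi> S)) euclideanreal
       (\<lambda>X. \<integral>\<omega>. rep X \<omega> \<partial>abs_var M \<mu>)}"

text \<open>The norm component of \<^const>\<open>space_on\<close> plays no role in \<^const>\<open>sigma_order_continuous\<close>.\<close>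

definition ca_sigma :: "'a measure \<Rightarrow> 'a measure set \<Rightarrow> ('a measure \<Rightarrow> real \<Rightarrow> ennreal) \<Rightarrow>
    ('a \<Rightarrow> real) set set \<Rightarrow> ('a set \<Rightarrow> real) set" where
  "ca_sigma M PP \<Phi> H = {\<mu> \<in> ca M PP. all_integrable M \<mu> H \<and>
     sigma_order_continuous (space_on M PP \<Phi> H) (signed_integral M \<mu>)}"

text \<open>The functional on \<open>S\<close> with which a measure is identified.\<close>

definition functional_on ::
    "'a measure \<Rightarrow> ('a \<Rightarrow> real) set set \<Rightarrow> ('a set \<Rightarrow> real) \<Rightarrow> ('a \<Rightarrow> real) set \<Rightarrow> real" where
  "functional_on M S \<mu> = restrict (signed_integral M \<mu>) S"

end

theory Submission
  imports Defs
begin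

text \<open>A sequence whose increments have summable norms converges quasi-surely, by Fatou's lemma
  and the unboundedness of Orlicz functions. This gives completeness, and it extends the
  \<open>|\<mu>|\<close>-integrability and the bound \<open>\<integral> |X| d|\<mu>| \<le> K \<parallel>X\<parallel>\<close> from \<open>H\<close> to its closure \<open>C\<close>, because
  quasi-sure limits are \<open>|\<mu>|\<close>-almost sure limits.

  For the dual space, the restriction of a bounded functional on \<open>C\<close> to the function lattice of
  \<open>H\<close> is a difference of two positive functionals bounded by multiples of the norm (F. Riesz). If
  functions in this lattice decrease to \<open>0\<close> pointwise, their classes have infimum \<open>0\<close> in \<open>H\<close>, so
  \<open>\<sigma>\<close>-order continuity of the norm is exactly what turns both parts into Daniell integrals. The
  difference of the two Daniell-Stone measures represents the functional. It is unique since the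
  sets \<open>{f > 0}\<close> with \<open>f\<close> in the lattice form an intersection stable generator of the
  \<open>\<sigma>\<close>-algebra.\<close>

text \<open>The spaces consist of classes, while Daniell's construction needs functions. The proof
  therefore works with \<open>funs S\<close>, the set of all measurable representatives of members
  of \<open>S\<close>: the operations become pointwise, and every measurable function that vanishes
  quasi-surely is available as a test function of norm 0. A functional bounded by the norm vanishes
  on the indicators of common null sets; this is why the Daniell measures charge none of them and
  their difference belongs to \<open>ca M PP\<close>.

  The two Daniell measures need not be mutually singular and hence need not be the Jordan parts of
  their difference. The Jordan parts are dominated by them, which is enough for integrability and
  norm bounds. For equality of integrals and for uniqueness, negative parts are moved to the other
  side, so that only sums of positive finite measures are compared.\<close>

section \<open>Sums of measures\<close>

text \<open>This serves two purposes: \<open>abs_var M \<mu>\<close> is such a sum, and an identity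
  between differences of finite measures turns into one between sums of positive measures.\<close>

definition plus_measure :: "'a measure \<Rightarrow> 'a measure \<Rightarrow> 'a measure" where
  "plus_measure M N = measure_of (space M) (sets M) (\<lambda>A. emeasure M A + emeasure N A)"

lemma space_plus_measure [simp]: "space (plus_measure M N) = space M"
  and sets_plus_measure [simp, measurable_cong]: "sets (plus_measure M N) = sets M"
  unfolding plus_measure_def by simp_all

lemma emeasure_plus_measure:
  assumes [measurable_cong]: "sets N = sets M"
  shows "emeasure (plus_measure M N) A = emeasure M A + emeasure N A"
proof (cases "A \<in> sets M")
  case True
  show ?thesis unfolding plus_measure_def
  proof (rule emeasure_measure_of_sigma)
    show "sigma_algebra (space M) (sets M)" ..
    show "positive (sets M) (\<lambda>A. emeasure M A + emeasure N A)" by (simp add: positive_def)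
    show "countably_additive (sets M) (\<lambda>A. emeasure M A + emeasure N A)"
    proof (rule countably_additiveI)
      fix A :: "nat \<Rightarrow> _" assume "range A \<subseteq> sets M" "disjoint_family A" "(\<Union>i. A i) \<in> sets M"
      then show "(\<Sum>i. emeasure M (A i) + emeasure N (A i)) = emeasure M (\<Union>i. A i) + emeasure N (\<Union>i. A i)"
        by (subst suminf_add[symmetric]) (auto simp: suminf_emeasure assms)
    qed
  qed fact
next
  case False
  then show ?thesis by (simp add: emeasure_notin_sets assms)
qed

lemma nn_integral_plus_measure:
  assumes [measurable_cong]: "sets N = sets M" and f: "f \<in> borel_measurable M"
  shows "(\<integral>\<^sup>+x. f x \<partial>plus_measure M N) = (\<integral>\<^sup>+x. f x \<partial>M) + (\<integral>\<^sup>+x. f x \<partial>N)"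
  using f
proof induction
  case (cong f g)
  moreover have "space N = space M" using assms(1) by (rule sets_eq_imp_space_eq)
  ultimately show ?case
    by (metis (no_types, lifting) nn_integral_cong space_plus_measure)
next
  case (set A)
  then show ?case by (simp add: emeasure_plus_measure assms)
next
  case (mult u c)
  have [measurable]: "u \<in> borel_measurable N" using mult by simp
  from mult show ?case by (simp add: nn_integral_cmult distrib_left)
next
  case (add u v)
  have [measurable]: "u \<in> borel_measurable N" "v \<in> borel_measurable N" using add by simp_all
  from add show ?case by (simp add: nn_integral_add ac_simps)
next
  case (seq U)
  have [measurable]: "U i \<in> borel_measurable N" "U i \<in> borel_measurable M" for i using seq by simp_all
  have *: "(SUP i. U i) = (\<lambda>x. SUP i. U i x)" by (auto simp: fun_eq_iff image_comp)
  have mono: "incseq (\<lambda>i. integral\<^sup>N K (U i))" for K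
    using \<open>incseq U\<close> by (auto simp: incseq_def le_fun_def intro!: nn_integral_mono)
  have "(\<integral>\<^sup>+x. (SUP i. U i) x \<partial>plus_measure M N) = (SUP i. \<integral>\<^sup>+x. U i x \<partial>plus_measure M N)"
    unfolding * using \<open>incseq U\<close> by (intro nn_integral_monotone_convergence_SUP) auto
  also have "\<dots> = (SUP i. (\<integral>\<^sup>+x. U i x \<partial>M) + (\<integral>\<^sup>+x. U i x \<partial>N))" using seq by simp
  also have "\<dots> = (SUP i. \<integral>\<^sup>+x. U i x \<partial>M) + (SUP i. \<integral>\<^sup>+x. U i x \<partial>N)"
    by (intro ennreal_SUP_add mono)
  also have "\<dots> = (\<integral>\<^sup>+x. (SUP i. U i) x \<partial>M) + (\<integral>\<^sup>+x. (SUP i. U i) x \<partial>N)"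
    unfolding * using \<open>incseq U\<close>
    by (subst (1 2) nn_integral_monotone_convergence_SUP) auto
  finally show ?case .
qed

lemma integrable_plus_measure:
  fixes f :: "'a \<Rightarrow> real"
  assumes "sets N = sets M"
  shows "integrable (plus_measure M N) f \<longleftrightarrow> integrable M f \<and> integrable N f"
proof -
  have [measurable_cong]: "sets N = sets M" by fact
  show ?thesis
    by (auto simp: integrable_iff_bounded nn_integral_plus_measure assms)
qed

lemma integral_plus_measure:
  fixes f :: "'a \<Rightarrow> real"
  assumes "sets N = sets M" and f: "integrable M f" "integrable N f"
  shows "(\<integral>x. f x \<partial>plus_measure M N) = (\<integral>x. f x \<partial>M) + (\<integral>x. f x \<partial>N)"
proof -
  have [measurable_cong]: "sets N = sets M" by fact
  have [measurable]: "f \<in> borel_measurable M" using f by auto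
  have fin: "(\<integral>\<^sup>+x. ennreal (f x) \<partial>K) < \<infinity>" "(\<integral>\<^sup>+x. ennreal (- f x) \<partial>K) < \<infinity>" if "integrable K f" for K
    using that unfolding real_integrable_def by (auto simp: less_top)
  show ?thesis
    using f fin[of M] fin[of N]
    by (simp add: real_lebesgue_integral_def integrable_plus_measure assms nn_integral_plus_measure enn2real_plus)
qed

section \<open>Jordan decomposition\<close>

text \<open>On reals \<open>ennreal\<close> is the positive part, which is subadditive; equality
  fails if \<open>a\<close> and \<open>b\<close> have strictly opposite signs.\<close>

lemma ennreal_add_le: "ennreal (a + b) \<le> ennreal a + ennreal b"
  by (cases "a \<ge> 0"; cases "b \<ge> 0")
    (auto simp: ennreal_neg ennreal_plus[symmetric] simp del: ennreal_plus intro: ennreal_leI)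

text \<open>The terms may change sign, so the right-hand side adds up positive parts, whose partial
  sums dominate those on the left.\<close>

lemma ennreal_sums_le_suminf:
  assumes "x sums s" shows "ennreal s \<le> (\<Sum>i. ennreal (x i))"
proof (rule LIMSEQ_le_const2)
  show "(\<lambda>n. ennreal (\<Sum>i<n. x i)) \<longlonglongrightarrow> ennreal s"
    using assms by (simp add: sums_def)
  have "ennreal (\<Sum>i<n. x i) \<le> (\<Sum>i<n. ennreal (x i))" for n
    by (induction n) (auto intro: order_trans[OF ennreal_add_le] add_mono)
  then show "\<exists>N. \<forall>n\<ge>N. ennreal (\<Sum>i<n. x i) \<le> (\<Sum>i. ennreal (x i))"
    by (meson order_trans sum_le_suminf summableI finite_lessThan zero_le)
qed

context
  fixes M :: "'a measure" and \<mu> :: "'a set \<Rightarrow> real"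
  assumes sm: "signed_measure M \<mu>"
begin

lemma signed_measure_Un:
  assumes "A \<in> sets M" "B \<in> sets M" "A \<inter> B = {}"
  shows "\<mu> (A \<union> B) = \<mu> A + \<mu> B"
proof -
  have "range (binaryset A B) \<subseteq> sets M" "disjoint_family (binaryset A B)"
    using assms by (auto simp: range_binaryset_eq disjoint_family_on_def binaryset_def)
  then have "(\<lambda>i. \<mu> (binaryset A B i)) sums \<mu> (\<Union>i. binaryset A B i)"
    using sm by (simp add: signed_measure_def)
  moreover have "(\<lambda>i. \<mu> (binaryset A B i)) sums (\<mu> A + \<mu> B)"
    using sm by (intro binaryset_sums) (simp add: signed_measure_def)
  ultimately show ?thesis by (simp add: UN_binaryset_eq sums_unique2)
qed

text \<open>The supremum is shown to be a measure without a Hahn decomposition: subsets of disjoint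
  sets can be united, which gives superadditivity, and a subset of a countable union can be cut
  along the pieces, which gives subadditivity. Only then does \<open>measure_of\<close> in
  \<open>pos_var\<close> keep the values of its set function.\<close>

lemma emeasure_pos_var:
  assumes "A \<in> sets M"
  shows "emeasure (pos_var M \<mu>) A = (SUP B\<in>{B \<in> sets M. B \<subseteq> A}. ennreal (\<mu> B))"
proof -
  define pv where "pv A = (SUP B\<in>{B \<in> sets M. B \<subseteq> A}. ennreal (\<mu> B))" for A
  have pv_upper: "ennreal (\<mu> B) \<le> pv A" if "B \<in> sets M" "B \<subseteq> A" for A B
    unfolding pv_def using that by (intro SUP_upper) auto
  have pv_mono: "pv A \<le> pv B" if "A \<subseteq> B" for A B
    unfolding pv_def using that by (intro SUP_subset_mono) auto
  have ne: "{B \<in> sets M. B \<subseteq> A} \<noteq> {}" for A by auto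
  have pv_empty: "pv {} = 0"
  proof -
    have "{B \<in> sets M. B \<subseteq> {}} = {{}}" by auto
    then show ?thesis using sm by (simp add: pv_def signed_measure_def)
  qed
  have super: "pv A + pv B \<le> pv (A \<union> B)" if AB: "A \<inter> B = {}" for A B
  proof -
    have "ennreal (\<mu> X) + ennreal (\<mu> Y) \<le> pv (A \<union> B)"
      if X: "X \<in> sets M" "X \<subseteq> A" and Y: "Y \<in> sets M" "Y \<subseteq> B" for X Y
    proof -
      \<comment> \<open>Truncation at 0 makes \<open>ennreal\<close> additive only for nonnegative
        values; if one of the two values is not positive, the other set alone is a good enough
        competitor.\<close>
      consider "\<mu> X \<le> 0" | "\<mu> Y \<le> 0" | "\<mu> X \<ge> 0" "\<mu> Y \<ge> 0" by linarith
      then show ?thesis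
      proof cases
        case 1 then show ?thesis using Y pv_upper[of Y "A \<union> B"] by (auto simp: ennreal_neg)
      next
        case 2 then show ?thesis using X pv_upper[of X "A \<union> B"] by (auto simp: ennreal_neg)
      next
        case 3
        then have "ennreal (\<mu> X) + ennreal (\<mu> Y) = ennreal (\<mu> (X \<union> Y))"
          using X Y AB by (subst signed_measure_Un) auto
        also have "\<dots> \<le> pv (A \<union> B)" using X Y by (intro pv_upper) auto
        finally show ?thesis .
      qed
    qed
    then have "(SUP Y\<in>{Y \<in> sets M. Y \<subseteq> B}. ennreal (\<mu> X) + ennreal (\<mu> Y)) \<le> pv (A \<union> B)"
      if "X \<in> sets M" "X \<subseteq> A" for X using that by (intro SUP_least) auto
    then have "ennreal (\<mu> X) + pv B \<le> pv (A \<union> B)" if "X \<in> sets M" "X \<subseteq> A" for X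
      using that unfolding pv_def[of B] by (subst (asm) ennreal_SUP_add_right[OF ne, symmetric]) auto
    then have "(SUP X\<in>{X \<in> sets M. X \<subseteq> A}. ennreal (\<mu> X) + pv B) \<le> pv (A \<union> B)"
      by (intro SUP_least) auto
    then show ?thesis unfolding pv_def[of A] by (subst (asm) ennreal_SUP_add_left[OF ne]) auto
  qed
  have "emeasure (pos_var M \<mu>) A = pv A"
    unfolding pos_var_def pv_def[symmetric]
  proof (rule emeasure_measure_of_sigma)
    show "sigma_algebra (space M) (sets M)" ..
    show "positive (sets M) pv" by (simp add: positive_def pv_empty)
    show "countably_additive (sets M) pv"
    proof (rule countably_additiveI)
      fix A :: "nat \<Rightarrow> _" assume A: "range A \<subseteq> sets M" "disjoint_family A" "(\<Union>i. A i) \<in> sets M"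
      show "(\<Sum>i. pv (A i)) = pv (\<Union>i. A i)"
      proof (rule antisym)
        have "(\<Sum>i<n. pv (A i)) \<le> pv (\<Union>i<n. A i)" for n
        proof (induction n)
          case (Suc n)
          have "(\<Sum>i<Suc n. pv (A i)) \<le> pv (\<Union>i<n. A i) + pv (A n)" using Suc by (simp add: add_mono)
          also have "\<dots> \<le> pv ((\<Union>i<n. A i) \<union> A n)"
            using A(2) by (intro super) (auto simp: disjoint_family_on_def, metis IntI emptyE less_irrefl)
          also have "(\<Union>i<n. A i) \<union> A n = (\<Union>i<Suc n. A i)" by (auto simp: less_Suc_eq)
          finally show ?case .
        qed (simp add: pv_empty)
        then have "(\<Sum>i<n. pv (A i)) \<le> pv (\<Union>i. A i)" for n
          by (rule order_trans) (auto intro!: pv_mono)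
        then show "(\<Sum>i. pv (A i)) \<le> pv (\<Union>i. A i)"
          by (intro suminf_le_const) auto
        have "ennreal (\<mu> B) \<le> (\<Sum>i. pv (A i))" if B: "B \<in> sets M" "B \<subseteq> (\<Union>i. A i)" for B
        proof -
          have "(\<lambda>i. \<mu> (B \<inter> A i)) sums \<mu> (\<Union>i. B \<inter> A i)"
            using sm A B unfolding signed_measure_def
            by (elim conjE allE[of _ "\<lambda>i. B \<inter> A i"] impE) (auto simp: disjoint_family_on_def)
          moreover have "(\<Union>i. B \<inter> A i) = B" using B by auto
          ultimately have "ennreal (\<mu> B) \<le> (\<Sum>i. ennreal (\<mu> (B \<inter> A i)))"
            using ennreal_sums_le_suminf by metis
          also have "\<dots> \<le> (\<Sum>i. pv (A i))"
            using A B by (intro suminf_le pv_upper) auto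
          finally show ?thesis .
        qed
        then show "pv (\<Union>i. A i) \<le> (\<Sum>i. pv (A i))"
          unfolding pv_def[of "\<Union>i. A i"] by (intro SUP_least) auto
      qed
    qed
  qed fact
  then show ?thesis by (simp add: pv_def)
qed

end

lemma space_pos_var [simp]: "space (pos_var M \<mu>) = space M"
  and sets_pos_var [simp, measurable_cong]: "sets (pos_var M \<mu>) = sets M"
  unfolding pos_var_def by simp_all

lemma space_neg_var [simp]: "space (neg_var M \<mu>) = space M"
  and sets_neg_var [simp, measurable_cong]: "sets (neg_var M \<mu>) = sets M"
  by (simp_all add: neg_var_def)

lemma abs_var_eq: "abs_var M \<mu> = plus_measure (pos_var M \<mu>) (neg_var M \<mu>)"
  by (simp add: abs_var_def plus_measure_def)

lemma space_abs_var [simp]: "space (abs_var M \<mu>) = space M"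
  and sets_abs_var [simp, measurable_cong]: "sets (abs_var M \<mu>) = sets M"
  by (simp_all add: abs_var_eq)

lemma emeasure_abs_var:
  "emeasure (abs_var M \<mu>) A = emeasure (pos_var M \<mu>) A + emeasure (neg_var M \<mu>) A"
  by (simp add: abs_var_eq emeasure_plus_measure)

lemma signed_measure_uminus: "signed_measure M \<mu> \<Longrightarrow> signed_measure M (\<lambda>A. - \<mu> A)"
  unfolding signed_measure_def by (auto intro: sums_minus)

text \<open>For \<open>B \<subseteq> A\<close>, the value
  \<open>\<mu> B = \<mu> A - \<mu> (A - B)\<close> is at most \<open>\<mu> A\<close> plus the
  negative variation of \<open>A\<close>. The supremum over \<open>B\<close> gives one inequality,
  the same argument for \<open>- \<mu>\<close> the other; finiteness permits the
  subtraction.\<close>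

lemma jordan_decomposition:
  assumes sm: "signed_measure M \<mu>" and fin: "emeasure (abs_var M \<mu>) (space M) < \<infinity>"
    and A: "A \<in> sets M"
  shows "\<mu> A = measure (pos_var M \<mu>) A - measure (neg_var M \<mu>) A"
proof -
  have le: "emeasure (pos_var M \<nu>) A \<le> ennreal (\<nu> A + measure (neg_var M \<nu>) A)"
    if sm: "signed_measure M \<nu>" and fin: "emeasure (neg_var M \<nu>) A < \<infinity>" for \<nu>
  proof -
    have "ennreal (\<nu> B) \<le> ennreal (\<nu> A + measure (neg_var M \<nu>) A)" if B: "B \<in> sets M" "B \<subseteq> A" for B
    proof -
      have "\<nu> (B \<union> (A - B)) = \<nu> B + \<nu> (A - B)"
        using sm A B by (intro signed_measure_Un) auto
      moreover have "B \<union> (A - B) = A" using B by auto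
      moreover have "ennreal (- \<nu> (A - B)) \<le> emeasure (neg_var M \<nu>) A"
        unfolding neg_var_def using A B
        by (subst emeasure_pos_var[OF signed_measure_uminus[OF sm]]) (auto intro!: SUP_upper)
      then have "- \<nu> (A - B) \<le> measure (neg_var M \<nu>) A"
        using fin by (subst (asm) emeasure_eq_ennreal_measure) (auto simp: ennreal_le_iff2 measure_nonneg order_trans[OF _ measure_nonneg])
      ultimately show ?thesis by (intro ennreal_leI) simp
    qed
    then show ?thesis using A by (subst emeasure_pos_var[OF sm]) (auto intro!: SUP_least)
  qed
  have "emeasure (abs_var M \<mu>) A < \<infinity>"
    using fin A by (metis emeasure_mono le_less_trans sets.sets_into_space sets.top sets_abs_var)
  then have fin: "emeasure (pos_var M \<mu>) A < \<infinity>" "emeasure (neg_var M \<mu>) A < \<infinity>"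
    by (auto simp: emeasure_abs_var)
  have neg: "pos_var M (\<lambda>A. - \<mu> A) = neg_var M \<mu>" "neg_var M (\<lambda>A. - \<mu> A) = pos_var M \<mu>"
    by (simp_all add: neg_var_def)
  \<comment> \<open>A negative right-hand side in \<open>le\<close> would be truncated to 0 by
    \<open>ennreal\<close>; its nonnegativity allows the bound to be read in the reals.\<close>
  have pos: "0 \<le> \<nu> A + measure (neg_var M \<nu>) A" 
    if sm: "signed_measure M \<nu>" and fin: "emeasure (neg_var M \<nu>) A < \<infinity>" for \<nu>
  proof -
    have "ennreal (- \<nu> A) \<le> emeasure (neg_var M \<nu>) A"
        unfolding neg_var_def using A
        by (subst emeasure_pos_var[OF signed_measure_uminus[OF sm]]) (auto intro!: SUP_upper)
    then have "- \<nu> A \<le> measure (neg_var M \<nu>) A"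
        using fin by (subst (asm) emeasure_eq_ennreal_measure) (auto simp: ennreal_le_iff2 measure_nonneg order_trans[OF _ measure_nonneg])
    then show ?thesis by simp
  qed
  from fin have "measure (pos_var M \<mu>) A \<le> \<mu> A + measure (neg_var M \<mu>) A"
    using le[OF sm] pos[OF sm] unfolding measure_def[of "pos_var M \<mu>"] by (intro enn2real_leI) auto
  moreover from fin have "measure (neg_var M \<mu>) A \<le> - \<mu> A + measure (pos_var M \<mu>) A"
    using le[OF signed_measure_uminus[OF sm]] pos[OF signed_measure_uminus[OF sm]]
    unfolding neg measure_def[of "neg_var M \<mu>"] by (intro enn2real_leI) auto
  ultimately show ?thesis by simp
qed

text \<open>\<open>K\<close> and \<open>N\<close> may overlap, so they only dominate the Jordan
  parts: for \<open>B \<subseteq> A\<close> the value \<open>\<mu> B\<close> is at most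
  \<open>measure K B \<le> measure K A\<close>.\<close>

lemma signed_measure_diff:
  assumes "sets K = sets M" "sets N = sets M" "finite_measure K" "finite_measure N"
  defines "\<mu> \<equiv> \<lambda>A. measure K A - measure N A"
  shows "signed_measure M \<mu>"
    and "emeasure (pos_var M \<mu>) A \<le> emeasure K A"
    and "emeasure (neg_var M \<mu>) A \<le> emeasure N A"
proof -
  interpret K: finite_measure K by fact
  interpret N: finite_measure N by fact
  have sm: "signed_measure M (\<lambda>A. measure K A - measure N A)"
    if "sets K = sets M" "sets N = sets M" "finite_measure K" "finite_measure N" for K N
  proof -
    interpret K: finite_measure K by fact
    interpret N: finite_measure N by fact
    show ?thesis
      unfolding signed_measure_def
      using that by (auto intro!: sums_diff K.finite_measure_UNION N.finite_measure_UNION simp: measure_notin_sets)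
  qed
  have le: "emeasure (pos_var M (\<lambda>A. measure K A - measure N A)) A \<le> emeasure K A"
    if "sets K = sets M" "sets N = sets M" "finite_measure K" "finite_measure N" for K N
  proof (cases "A \<in> sets M")
    case True
    interpret K: finite_measure K by fact
    show ?thesis
      apply (subst emeasure_pos_var[OF sm[OF that] True])
      using that True by (auto intro!: SUP_least ennreal_leI simp: K.emeasure_eq_measure)
        (smt (verit) K.finite_measure_mono measure_nonneg)
  qed (simp add: emeasure_notin_sets)
  show "signed_measure M \<mu>" "emeasure (pos_var M \<mu>) A \<le> emeasure K A"
    unfolding \<mu>_def using sm[of K N] le[of K N] assms by auto
  show "emeasure (neg_var M \<mu>) A \<le> emeasure N A"
    unfolding \<mu>_def neg_var_def using le[of N K] assms by auto
qed

section \<open>Vector lattices of functions\<close>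

text \<open>The members are functions on the whole type; \<open>\<Omega>\<close> is where their
  values count. Since 1 is in \<open>L\<close>, truncations \<open>min f 1\<close> stay in
  \<open>L\<close>, which is Stone's condition.\<close>

locale function_lattice =
  fixes \<Omega> :: "'a set" and L :: "('a \<Rightarrow> real) set"
  assumes add [intro!]: "f \<in> L \<Longrightarrow> g \<in> L \<Longrightarrow> (\<lambda>x. f x + g x) \<in> L"
    and scale [intro!]: "f \<in> L \<Longrightarrow> (\<lambda>x. c * f x) \<in> L"
    and max [intro!]: "f \<in> L \<Longrightarrow> g \<in> L \<Longrightarrow> (\<lambda>x. max (f x) (g x)) \<in> L"
    and one: "(\<lambda>_. 1) \<in> L"
begin

lemma const [intro!, simp]: "(\<lambda>_. c) \<in> L"
  using scale[OF one, of c] by simp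

lemma uminus [intro!]: "f \<in> L \<Longrightarrow> (\<lambda>x. - f x) \<in> L"
  using scale[of f "-1"] by simp

lemma diff [intro!]: "f \<in> L \<Longrightarrow> g \<in> L \<Longrightarrow> (\<lambda>x. f x - g x) \<in> L"
  using add[of f "\<lambda>x. - g x"] by auto

lemma min [intro!]: "f \<in> L \<Longrightarrow> g \<in> L \<Longrightarrow> (\<lambda>x. min (f x) (g x)) \<in> L"
  using uminus[OF max[OF uminus[of f] uminus[of g]]] by (simp add: minus_max_eq_min)

lemma sum [intro!]: "(\<And>i. i \<in> S \<Longrightarrow> f i \<in> L) \<Longrightarrow> (\<lambda>x. \<Sum>i\<in>S. f i x) \<in> L"
  by (induction S rule: infinite_finite_induct) auto

text \<open>Strict inequality matters: the indicator of \<open>{f > 0}\<close> is the increasing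
  pointwise limit of \<open>min 1 (k * max 0 f)\<close>, and these functions lie in
  \<open>L\<close>.\<close>

definition pos_sets :: "'a set set" where
  "pos_sets = {{x \<in> \<Omega>. 0 < f x} | f. f \<in> L}"

lemma pos_sets_subset: "pos_sets \<subseteq> Pow \<Omega>"
  by (auto simp: pos_sets_def)

lemma greater_mem_pos_sets: "f \<in> L \<Longrightarrow> {x \<in> \<Omega>. c < f x} \<in> pos_sets"
  unfolding pos_sets_def by (rule CollectI, rule exI[of _ "\<lambda>x. f x - c"]) auto

lemma space_mem_pos_sets: "\<Omega> \<in> pos_sets"
  using greater_mem_pos_sets[OF one, of 0] by simp

lemma Int_stable_pos_sets: "Int_stable pos_sets"
proof (rule Int_stableI)
  fix A B assume "A \<in> pos_sets" "B \<in> pos_sets"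
  then obtain f g where fg: "f \<in> L" "g \<in> L" "A = {x \<in> \<Omega>. 0 < f x}" "B = {x \<in> \<Omega>. 0 < g x}"
    by (auto simp: pos_sets_def)
  then have "A \<inter> B = {x \<in> \<Omega>. 0 < min (f x) (g x)}" by auto
  then show "A \<inter> B \<in> pos_sets" using greater_mem_pos_sets[OF min[OF fg(1,2)]] by metis
qed

lemma borel_measurable_pos_sets:
  assumes "sets N = sigma_sets \<Omega> pos_sets" "f \<in> L"
  shows "f \<in> borel_measurable N"
proof -
  have "space N = \<Omega>"
    using assms(1) pos_sets_subset by (metis sets_measure_of space_measure_of sets_eq_imp_space_eq)
  then show ?thesis
    using assms greater_mem_pos_sets by (auto simp: borel_measurable_iff_greater intro: sigma_sets.Basic)
qed

text \<open>On the generator the measures are limits of integrals of members of \<open>L\<close>, by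
  dominated convergence with the constant 1; the generator is intersection stable and contains
  \<open>\<Omega>\<close>, whose measure is finite.\<close>

lemma measure_eq_if_integral_eq:
  assumes sets: "sets K = sigma_sets \<Omega> pos_sets" "sets N = sigma_sets \<Omega> pos_sets"
    and fin: "finite_measure K" "finite_measure N"
    and eq: "\<And>f. f \<in> L \<Longrightarrow> (\<integral>x. f x \<partial>K) = (\<integral>x. f x \<partial>N)"
  shows "K = N"
proof -
  have lim: "(\<lambda>k. \<integral>x. min 1 (real k * max 0 (f x)) \<partial>K) \<longlonglongrightarrow> measure K {x \<in> \<Omega>. 0 < f x}"
    if f: "f \<in> L" and sets: "sets K = sigma_sets \<Omega> pos_sets" and fin: "finite_measure K" for K f
  proof -
    interpret finite_measure K by fact
    have sp: "space K = \<Omega>"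
      using sets pos_sets_subset by (metis sets_measure_of space_measure_of sets_eq_imp_space_eq)
    have [measurable]: "f \<in> borel_measurable K" using sets f by (rule borel_measurable_pos_sets)
    have "(\<lambda>k. \<integral>x. min 1 (real k * max 0 (f x)) \<partial>K) \<longlonglongrightarrow> (\<integral>x. indicator {x \<in> \<Omega>. 0 < f x} x \<partial>K)"
    proof (rule integral_dominated_convergence[where w = "\<lambda>_. 1"])
      show "AE x in K. (\<lambda>k. min 1 (real k * max 0 (f x))) \<longlonglongrightarrow> indicator {x \<in> \<Omega>. 0 < f x} x"
      proof (rule AE_I2)
        fix x assume x: "x \<in> space K"
        show "(\<lambda>k. min 1 (real k * max 0 (f x))) \<longlonglongrightarrow> indicator {x \<in> \<Omega>. 0 < f x} x"
        proof (cases "0 < f x")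
          case True
          obtain k0 where "1 < real k0 * f x" using reals_Archimedean3[OF True] by blast
          then have "min 1 (real k * max 0 (f x)) = 1" if "k \<ge> k0" for k
          proof -
            have "real k0 * f x \<le> real k * f x" using that True by (intro mult_right_mono) auto
            then have "1 \<le> real k * f x" using \<open>1 < real k0 * f x\<close> by linarith
            then show ?thesis using True by (simp add: min_def)
          qed
          then show ?thesis using True x sp
            by (intro tendsto_eventually eventually_sequentiallyI[of k0]) auto
        qed simp
      qed
    qed (use sp in \<open>auto simp: sp[symmetric]\<close>)
    moreover have "{x \<in> \<Omega>. 0 < f x} \<inter> space K = {x \<in> \<Omega>. 0 < f x}" using sp by auto
    ultimately show ?thesis by simp
  qed
  show ?thesis
  proof (rule measure_eqI_generator_eq[OF Int_stable_pos_sets pos_sets_subset, where A = "\<lambda>_. \<Omega>"])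
    interpret K: finite_measure K by fact
    interpret N: finite_measure N by fact
    fix X assume "X \<in> pos_sets"
    then obtain f where f: "f \<in> L" "X = {x \<in> \<Omega>. 0 < f x}" by (auto simp: pos_sets_def)
    have "(\<integral>x. min 1 (real k * max 0 (f x)) \<partial>K) = (\<integral>x. min 1 (real k * max 0 (f x)) \<partial>N)" for k
      using f by (intro eq) auto
    then have "measure K X = measure N X"
      using lim[OF f(1) sets(1) fin(1)] lim[OF f(1) sets(2) fin(2)] f(2)
      by (simp add: LIMSEQ_unique)
    then show "emeasure K X = emeasure N X" by (simp add: K.emeasure_eq_measure N.emeasure_eq_measure)
  next
    show "emeasure K \<Omega> \<noteq> \<infinity>" by (simp add: finite_measure.emeasure_finite[OF fin(1)])
  qed (use sets space_mem_pos_sets in auto)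
qed

text \<open>On nonnegative \<open>f\<close> the functional is \<open>I f = sup {J g | 0 \<le> g \<le> f}\<close>; the Riesz
  decomposition property makes it additive.\<close>

lemma order_bounded_le_positive:
  assumes J_add: "\<And>f g. f \<in> L \<Longrightarrow> g \<in> L \<Longrightarrow> J (\<lambda>x. f x + g x) = J f + J g"
    and J_scale: "\<And>f c. f \<in> L \<Longrightarrow> J (\<lambda>x. c * f x) = c * J f"
    and bound: "\<And>f g. f \<in> L \<Longrightarrow> g \<in> L \<Longrightarrow> (\<And>x. x \<in> \<Omega> \<Longrightarrow> 0 \<le> g x \<and> g x \<le> f x) \<Longrightarrow> J g \<le> B f"
  obtains I where
    "\<And>f g. f \<in> L \<Longrightarrow> g \<in> L \<Longrightarrow> I (\<lambda>x. f x + g x) = I f + I g"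
    "\<And>f c. f \<in> L \<Longrightarrow> I (\<lambda>x. c * f x) = c * I f"
    "\<And>f. f \<in> L \<Longrightarrow> (\<And>x. x \<in> \<Omega> \<Longrightarrow> 0 \<le> f x) \<Longrightarrow> 0 \<le> I f"
    "\<And>f. f \<in> L \<Longrightarrow> (\<And>x. x \<in> \<Omega> \<Longrightarrow> 0 \<le> f x) \<Longrightarrow> J f \<le> I f"
    "\<And>f. f \<in> L \<Longrightarrow> (\<And>x. x \<in> \<Omega> \<Longrightarrow> 0 \<le> f x) \<Longrightarrow> I f \<le> B f"
proof -
  define S where "S f = {g \<in> L. \<forall>x\<in>\<Omega>. 0 \<le> g x \<and> g x \<le> f x}" for f
  define P where "P f = (SUP g\<in>S f. J g)" for f
  define Lp where "Lp = {f \<in> L. \<forall>x\<in>\<Omega>. 0 \<le> f x}"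
  have ne: "S f \<noteq> {}" if "f \<in> Lp" for f
    using that const[of 0] unfolding S_def Lp_def by blast
  have P_le: "P f \<le> c" if "f \<in> Lp" "\<And>g. g \<in> S f \<Longrightarrow> J g \<le> c" for f c
    unfolding P_def using ne[OF that(1)] that(2) by (rule cSUP_least)
  have bdd: "bdd_above (J ` S f)" if "f \<in> Lp" for f
    using that bound[of f] by (intro bdd_aboveI2[of _ _ "B f"]) (auto simp: S_def Lp_def)
  have le_P: "J g \<le> P f" if "f \<in> Lp" "g \<in> S f" for f g
    unfolding P_def using that by (intro cSUP_upper bdd)
  have J_zero: "J (\<lambda>_. 0) = 0" using J_scale[of "\<lambda>_. 0" 0] by simp
  have P_nonneg: "0 \<le> P f" if "f \<in> Lp" for f
    using le_P[OF that, of "\<lambda>_. 0"] that J_zero by (auto simp: S_def Lp_def)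
  have Lp_add: "(\<lambda>x. f x + g x) \<in> Lp" if "f \<in> Lp" "g \<in> Lp" for f g
    using that by (auto simp: Lp_def)
  have P_add: "P (\<lambda>x. f x + g x) = P f + P g" if fg: "f \<in> Lp" "g \<in> Lp" for f g
  proof (rule antisym)
    show "P (\<lambda>x. f x + g x) \<le> P f + P g"
    proof (rule P_le[OF Lp_add[OF fg]])
      fix h assume h: "h \<in> S (\<lambda>x. f x + g x)"
      \<comment> \<open>Riesz decomposition of \<open>h \<le> f + g\<close>: the part
        \<open>min h f\<close> lies below \<open>f\<close>, and the rest, which is
        \<open>max 0 (h - f)\<close>, lies below \<open>g\<close>.\<close>
      let ?h1 = "\<lambda>x. min (h x) (f x)"
      have L: "h \<in> L" "f \<in> L" using h fg by (auto simp: S_def Lp_def)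
      have 1: "?h1 \<in> S f" using h fg L by (auto simp: S_def Lp_def)
      have 2: "(\<lambda>x. h x - ?h1 x) \<in> S g"
        using h fg L diff[OF L(1) min[OF L]] by (auto simp: S_def Lp_def min_def not_le le_diff_eq add.commute less_imp_le)
      have "J h = J ?h1 + J (\<lambda>x. h x - ?h1 x)"
        using 1 2 by (subst J_add[symmetric]) (auto simp: S_def)
      then show "J h \<le> P f + P g" using le_P[OF fg(1) 1] le_P[OF fg(2) 2] by linarith
    qed
    have "J h1 \<le> P (\<lambda>x. f x + g x) - J h2" if h: "h1 \<in> S f" "h2 \<in> S g" for h1 h2
    proof -
      have "(\<lambda>x. h1 x + h2 x) \<in> S (\<lambda>x. f x + g x)"
        using h by (auto simp: S_def intro!: add_mono)
      from le_P[OF Lp_add[OF fg] this] show ?thesis using h by (subst (asm) J_add) (auto simp: S_def)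
    qed
    then have "P f \<le> P (\<lambda>x. f x + g x) - J h2" if "h2 \<in> S g" for h2
      using fg that by (intro P_le) auto
    then have "P g \<le> P (\<lambda>x. f x + g x) - P f"
      using fg by (intro P_le) (auto simp: algebra_simps)
    then show "P f + P g \<le> P (\<lambda>x. f x + g x)" by simp
  qed
  have P_zero: "P (\<lambda>_. 0) = 0"
    using P_add[of "\<lambda>_. 0" "\<lambda>_. 0"] by (simp add: Lp_def)
  \<comment> \<open>One inequality suffices: applied to \<open>c * f\<close> and
    \<open>inverse c\<close> it gives the other.\<close>
  have P_scale_le: "P (\<lambda>x. c * f x) \<le> c * P f" if f: "f \<in> Lp" and c: "c > 0" for f c
  proof (rule P_le)
    show "(\<lambda>x. c * f x) \<in> Lp" using f c by (auto simp: Lp_def)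
    fix g assume g: "g \<in> S (\<lambda>x. c * f x)"
    have "(\<lambda>x. inverse c * g x) \<in> S f"
      using g c scale[of g "inverse c"] by (auto simp: S_def field_simps)
    from le_P[OF f this] show "J g \<le> c * P f"
      using g c by (subst (asm) J_scale) (auto simp: S_def field_simps)
  qed
  have P_scale: "P (\<lambda>x. c * f x) = c * P f" if f: "f \<in> Lp" and c: "c \<ge> 0" for f c
  proof (cases "c = 0")
    case True then show ?thesis by (simp add: P_zero)
  next
    case False
    with c have c: "c > 0" by simp
    have "(\<lambda>x. c * f x) \<in> Lp" using f c by (auto simp: Lp_def)
    from P_scale_le[OF this, of "inverse c"] c have "P f \<le> inverse c * P (\<lambda>x. c * f x)"
      by (simp add: mult.assoc[symmetric])
    then show ?thesis using P_scale_le[OF f c] c by (simp add: field_simps)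
  qed
  have P_cong: "P f = P g" if "\<And>x. x \<in> \<Omega> \<Longrightarrow> f x = g x" for f g
  proof -
    have "S f = S g" using that by (auto simp: S_def)
    then show ?thesis by (simp add: P_def)
  qed
  define p n where "p f = (\<lambda>x. max (f x) 0)" and "n f = (\<lambda>x. max (- f x) 0)" for f :: "'a \<Rightarrow> real"
  have pn: "p f \<in> Lp" "n f \<in> Lp" if "f \<in> L" for f
    using that by (auto simp: p_def n_def Lp_def)
  define I where "I f = P (p f) - P (n f)" for f
  have I_eq: "I f = P f" if "f \<in> L" "\<And>x. x \<in> \<Omega> \<Longrightarrow> 0 \<le> f x" for f
  proof -
    have "P (p f) = P f" "P (n f) = P (\<lambda>_. 0)"
      using that by (auto intro!: P_cong simp: p_def n_def)
    then show ?thesis by (simp add: I_def P_zero)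
  qed
  show thesis
  proof
    fix f g assume fg: "f \<in> L" "g \<in> L"
    then have fg': "(\<lambda>x. f x + g x) \<in> L" by auto
    \<comment> \<open>The identity \<open>(f + g)^+ + f^- + g^- = (f + g)^- + f^+ + g^+\<close>
      contains no differences, so the additivity of \<open>P\<close> on nonnegative functions
      applies to both sides.\<close>
    have "P (\<lambda>x. (p (\<lambda>x. f x + g x) x + n f x) + n g x) = P (\<lambda>x. (n (\<lambda>x. f x + g x) x + p f x) + p g x)"
      by (rule P_cong) (auto simp: p_def n_def max_def)
    then show "I (\<lambda>x. f x + g x) = I f + I g"
      using pn[OF fg(1)] pn[OF fg(2)] pn[OF fg'] by (simp add: P_add Lp_add I_def)
  next
    fix f c assume f: "f \<in> L"
    show "I (\<lambda>x. c * f x) = c * I f"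
    proof (cases "c \<ge> 0")
      case True
      have "P (p (\<lambda>x. c * f x)) = P (\<lambda>x. c * p f x)" "P (n (\<lambda>x. c * f x)) = P (\<lambda>x. c * n f x)"
        using True by (auto intro!: P_cong simp: p_def n_def max_mult_distrib_left)
      then show ?thesis using True pn[OF f] by (simp add: I_def P_scale right_diff_distrib)
    next
      case False
      have "P (p (\<lambda>x. c * f x)) = P (\<lambda>x. (-c) * n f x)" "P (n (\<lambda>x. c * f x)) = P (\<lambda>x. (-c) * p f x)"
        using False by (auto intro!: P_cong simp: p_def n_def max_mult_distrib_left)
      then show ?thesis using False pn[OF f] P_scale[of _ "-c"] by (simp add: I_def right_diff_distrib)
    qed
  next
    fix f assume f: "f \<in> L" "\<And>x. x \<in> \<Omega> \<Longrightarrow> 0 \<le> f x"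
    then have Lp: "f \<in> Lp" by (auto simp: Lp_def)
    show "0 \<le> I f" using I_eq[OF f] P_nonneg[OF Lp] by simp
    show "J f \<le> I f" using I_eq[OF f] le_P[OF Lp, of f] f by (auto simp: S_def)
    show "I f \<le> B f" using I_eq[OF f] P_le[OF Lp, of "B f"] bound[of f] f by (auto simp: S_def)
  qed
qed

end

section \<open>The Daniell-Stone theorem\<close>

locale daniell = function_lattice +
  fixes I :: "('a \<Rightarrow> real) \<Rightarrow> real"
  assumes I_add: "f \<in> L \<Longrightarrow> g \<in> L \<Longrightarrow> I (\<lambda>x. f x + g x) = I f + I g"
    and I_scale: "f \<in> L \<Longrightarrow> I (\<lambda>x. c * f x) = c * I f"
    and I_nonneg: "f \<in> L \<Longrightarrow> (\<And>x. x \<in> \<Omega> \<Longrightarrow> 0 \<le> f x) \<Longrightarrow> 0 \<le> I f"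
    and I_continuous: "(\<And>n. F n \<in> L) \<Longrightarrow> (\<And>x n. x \<in> \<Omega> \<Longrightarrow> F (Suc n) x \<le> F n x) \<Longrightarrow>
      (\<And>x. x \<in> \<Omega> \<Longrightarrow> (\<lambda>n. F n x) \<longlonglongrightarrow> 0) \<Longrightarrow> (\<lambda>n. I (F n)) \<longlonglongrightarrow> 0"
begin

lemma I_zero: "I (\<lambda>_. 0) = 0"
  using I_scale[of "\<lambda>_. 0" 0] by simp

lemma I_diff: "f \<in> L \<Longrightarrow> g \<in> L \<Longrightarrow> I (\<lambda>x. f x - g x) = I f - I g"
  using I_add[of f "\<lambda>x. -1 * g x"] I_scale[of g "-1"] scale[of g "-1"] by simp

lemma I_mono:
  assumes "f \<in> L" "g \<in> L" "\<And>x. x \<in> \<Omega> \<Longrightarrow> f x \<le> g x" shows "I f \<le> I g"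
proof -
  have "0 \<le> I (\<lambda>x. g x - f x)" using assms by (intro I_nonneg) auto
  then show ?thesis using assms by (simp add: I_diff)
qed

lemma I_cong: "f \<in> L \<Longrightarrow> g \<in> L \<Longrightarrow> (\<And>x. x \<in> \<Omega> \<Longrightarrow> f x = g x) \<Longrightarrow> I f = I g"
  by (intro antisym I_mono) auto

lemma I_sum: "(\<And>i. i \<in> S \<Longrightarrow> f i \<in> L) \<Longrightarrow> I (\<lambda>x. \<Sum>i\<in>S. f i x) = (\<Sum>i\<in>S. I (f i))"
  by (induction S rule: infinite_finite_induct) (auto simp: I_zero I_add sum)

text \<open>Asking for \<open>1 \<le> G n x\<close> at a finite stage, and not only for \<open>1 \<le> sup\<^sub>n G n x\<close>, gives the same
  outer measure (multiply \<open>G\<close> by \<open>1 + \<epsilon>\<close>) and saves the \<open>\<epsilon>\<close> in the estimates below.\<close>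

definition covers :: "'a set \<Rightarrow> (nat \<Rightarrow> 'a \<Rightarrow> real) \<Rightarrow> bool" where
  "covers A G \<longleftrightarrow> (\<forall>n. G n \<in> L) \<and> (\<forall>x\<in>\<Omega>. \<forall>n. 0 \<le> G n x \<and> G n x \<le> G (Suc n) x) \<and>
     (\<forall>x\<in>A. \<exists>n. 1 \<le> G n x)"

definition outer :: "'a set \<Rightarrow> ennreal" where
  "outer A = Inf {ennreal c | c G. covers A G \<and> (\<forall>n. I (G n) \<le> c)}"

lemma covers_mono: "covers A G \<Longrightarrow> x \<in> \<Omega> \<Longrightarrow> m \<le> n \<Longrightarrow> G m x \<le> G n x"
  by (rule lift_Suc_mono_le[of "\<lambda>n. G n x"]) (auto simp: covers_def)

lemma outer_le: "covers A G \<Longrightarrow> (\<And>n. I (G n) \<le> c) \<Longrightarrow> outer A \<le> ennreal c"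
  unfolding outer_def by (intro Inf_lower) auto

lemma outer_ge: "(\<And>c G. covers A G \<Longrightarrow> (\<And>n. I (G n) \<le> c) \<Longrightarrow> b \<le> ennreal c) \<Longrightarrow> b \<le> outer A"
  unfolding outer_def by (intro Inf_greatest) auto

lemma outer_le_I:
  assumes "q \<in> L" "\<And>x. x \<in> \<Omega> \<Longrightarrow> 0 \<le> q x" "\<And>x. x \<in> A \<Longrightarrow> 1 \<le> q x"
  shows "outer A \<le> ennreal (I q)"
  using assms by (intro outer_le[of _ "\<lambda>_. q"]) (auto simp: covers_def)

lemma outer_finite: "outer A < \<infinity>"
  using outer_le_I[of "\<lambda>_. 1" A] by (auto simp: one top.extremum_strict intro: le_less_trans)

lemma outer_less:
  assumes "outer A < b"
  obtains c G where "covers A G" "\<And>n. I (G n) \<le> c" "ennreal c < b"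
  using assms unfolding outer_def Inf_less_iff by blast

text \<open>The lower bound that keeps the outer measure from being too small. At every point
  \<open>min q (G n)\<close> reaches \<open>q\<close> after finitely many steps, as
  \<open>G n\<close> passes 1 on \<open>E\<close> and \<open>q\<close> vanishes off
  \<open>E\<close>; Daniell continuity turns this into convergence of the values of
  \<open>I\<close>.\<close>

lemma I_le_outer:
  assumes q: "q \<in> L" "\<And>x. x \<in> \<Omega> \<Longrightarrow> 0 \<le> q x" "\<And>x. x \<in> \<Omega> \<Longrightarrow> q x \<le> 1"
    and E: "\<And>x. x \<in> \<Omega> \<Longrightarrow> x \<notin> E \<Longrightarrow> q x = 0"
  shows "ennreal (I q) \<le> outer E"
proof (rule outer_ge, rule ennreal_leI)
  fix c G assume G: "covers E G" "\<And>n. I (G n) \<le> c"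
  then have [intro]: "G n \<in> L" for n by (auto simp: covers_def)
  have "(\<lambda>n. I (\<lambda>x. q x - min (q x) (G n x))) \<longlonglongrightarrow> 0"
  proof (rule I_continuous)
    fix x n assume x: "x \<in> \<Omega>"
    then show "q x - min (q x) (G (Suc n) x) \<le> q x - min (q x) (G n x)"
      using covers_mono[OF G(1) x, of n "Suc n"] by auto
  next
    fix x assume x: "x \<in> \<Omega>"
    show "(\<lambda>n. q x - min (q x) (G n x)) \<longlonglongrightarrow> 0"
    proof (cases "x \<in> E")
      case True
      then obtain n where n: "1 \<le> G n x" using G by (auto simp: covers_def)
      have "q x - min (q x) (G m x) = 0" if "m \<ge> n" for m
        using n covers_mono[OF G(1) x that] q(3)[OF x] by auto
      then show ?thesis by (intro tendsto_eventually eventually_sequentiallyI)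
    next
      case False
      then have "q x - min (q x) (G m x) = 0" for m
        using x E G(1) by (auto simp: covers_def)
      then show ?thesis by simp
    qed
  qed (use q in auto)
  then have "(\<lambda>n. I q - I (\<lambda>x. q x - min (q x) (G n x))) \<longlonglongrightarrow> I q - 0"
    by (intro tendsto_intros)
  moreover have "I q - I (\<lambda>x. q x - min (q x) (G n x)) \<le> c" for n
  proof -
    have "I q - I (\<lambda>x. q x - min (q x) (G n x)) = I (\<lambda>x. min (q x) (G n x))"
      using q by (subst I_diff) auto
    also have "\<dots> \<le> I (G n)" using q by (intro I_mono) auto
    finally show ?thesis using G(2)[of n] by simp
  qed
  ultimately show "I q \<le> c" by (intro LIMSEQ_le_const2) auto
qed

lemma outer_measure_space_outer: "outer_measure_space (Pow \<Omega>) outer"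
  unfolding outer_measure_space_def
proof (intro conjI)
  have "outer {} \<le> ennreal (I (\<lambda>_. 0))" by (rule outer_le_I) auto
  then show "positive (Pow \<Omega>) outer" by (simp add: positive_def I_zero)
  show "increasing (Pow \<Omega>) outer"
    unfolding increasing_def
  proof (intro ballI impI outer_ge outer_le)
    fix A B c G assume "A \<subseteq> B" "covers B G" then show "covers A G" by (auto simp: covers_def)
  qed
  show "countably_subadditive (Pow \<Omega>) outer"
  proof (simp add: countably_subadditive_def, safe)
    fix A :: "nat \<Rightarrow> _" assume A: "range A \<subseteq> Pow \<Omega>" "(\<Union>i. A i) \<subseteq> \<Omega>"
    show "outer (\<Union>i. A i) \<le> (\<Sum>i. outer (A i))"
    proof (rule ennreal_le_epsilon)
      fix e :: real assume e: "0 < e" and fin: "(\<Sum>i. outer (A i)) < top_class.top"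
      have "outer (A i) < outer (A i) + ennreal (e * (1/2)^Suc i)" for i
        using outer_finite[of "A i"] e by (auto simp: less_top)
      then have "\<exists>c G. covers (A i) G \<and> (\<forall>n. I (G n) \<le> c) \<and> ennreal c < outer (A i) + ennreal (e * (1/2)^Suc i)" for i
        by (metis outer_less)
      then obtain c G where cG: "covers (A i) (G i)" "I (G i n) \<le> c i"
        "ennreal (c i) < outer (A i) + ennreal (e * (1/2)^Suc i)" for i n
        by metis
      from cG(1) have G: "G i n \<in> L" "x \<in> \<Omega> \<Longrightarrow> 0 \<le> G i n x" for i n x by (auto simp: covers_def)
      have c_nonneg: "0 \<le> c i" for i
        using I_nonneg[OF G(1)[of i 0] G(2)] cG(2)[of i 0] by auto
      \<comment> \<open>The number of summands and the stage grow together, so \<open>H n\<close> is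
        a finite sum in \<open>L\<close>, increases with \<open>n\<close>, and has
        \<open>I (H n)\<close> bounded by the sum of the \<open>c i\<close>.\<close>
      define H where "H n = (\<lambda>x. \<Sum>i\<le>n. G i n x)" for n
      have cov: "covers (\<Union>i. A i) H"
        unfolding covers_def
      proof (intro conjI allI ballI)
        fix n x assume x: "x \<in> \<Omega>"
        show "0 \<le> H n x" using G x by (auto simp: H_def intro: sum_nonneg)
        have "H n x \<le> (\<Sum>i\<le>n. G i (Suc n) x)"
          unfolding H_def using x by (intro sum_mono covers_mono[OF cG(1)]) auto
        also have "\<dots> \<le> H (Suc n) x" using G x by (auto simp: H_def)
        finally show "H n x \<le> H (Suc n) x" .
      next
        fix x assume "x \<in> (\<Union>i. A i)"
        then obtain i where i: "x \<in> A i" by auto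
        then have x: "x \<in> \<Omega>" using A by auto
        obtain n where "1 \<le> G i n x" using cG(1)[of i] i by (auto simp: covers_def)
        also have "G i n x \<le> G i (max i n) x" using x by (intro covers_mono[OF cG(1)]) auto
        also have "\<dots> \<le> H (max i n) x"
          unfolding H_def using G x by (intro member_le_sum) auto
        finally show "\<exists>n. 1 \<le> H n x" by blast
      qed (use G in \<open>auto simp: H_def\<close>)
      have Hle: "ennreal (I (H n)) \<le> (\<Sum>i. ennreal (c i))" for n
      proof -
        have "I (H n) = (\<Sum>i\<le>n. I (G i n))" unfolding H_def using G by (intro I_sum)
        also have "ennreal \<dots> \<le> ennreal (\<Sum>i\<le>n. c i)" using cG by (intro ennreal_leI sum_mono)
        also have "\<dots> = (\<Sum>i\<le>n. ennreal (c i))" using c_nonneg by simp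
        also have "\<dots> \<le> (\<Sum>i. ennreal (c i))" by (intro sum_le_suminf) auto
        finally show ?thesis .
      qed
      have "(\<Sum>i. ennreal (c i)) \<le> (\<Sum>i. outer (A i) + e * (1/2) ^ Suc i)"
        using cG(3) by (intro suminf_le) (auto intro: less_imp_le)
      also have "\<dots> = (\<Sum>i. outer (A i)) + (\<Sum>i. ennreal e * ennreal ((1/2) ^ Suc i))"
        using \<open>0 < e\<close> by (subst suminf_add[symmetric])
                         (auto simp del: ennreal_suminf_cmult simp add: ennreal_mult[symmetric])
      also have "\<dots> = (\<Sum>i. outer (A i)) + e"
        unfolding ennreal_suminf_cmult
        by (subst suminf_ennreal_eq[OF zero_le_power power_half_series]) auto
      finally have le: "(\<Sum>i. ennreal (c i)) \<le> (\<Sum>i. outer (A i)) + e" .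
      also have "\<dots> < \<infinity>" using fin by simp
      finally have "(\<Sum>i. ennreal (c i)) < \<infinity>" .
      then obtain t where t: "0 \<le> t" "(\<Sum>i. ennreal (c i)) = ennreal t"
        by (auto simp: less_top elim: ennreal_cases)
      have "I (H n) \<le> t" for n using Hle[of n] t by (simp add: ennreal_le_iff)
      then have "outer (\<Union>i. A i) \<le> ennreal t" by (rule outer_le[OF cov])
      then show "outer (\<Union>i. A i) \<le> (\<Sum>i. outer (A i)) + ennreal e" using le t by simp
    qed
  qed
qed

text \<open>Let \<open>h k\<close> increase to the indicator of \<open>E\<close>. A cover
  \<open>G\<close> of \<open>A\<close> yields the cover \<open>min (G k) (h k)\<close> of
  \<open>E \<inter> A\<close> and, for each fixed \<open>k\<close>, the cover
  \<open>G n - min (G n) (h k)\<close> of the rest of \<open>A\<close>, as \<open>h k\<close>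
  vanishes off \<open>E\<close>. The bounds on their integrals add up to that of \<open>G\<close>,
  which is Caratheodory's condition.\<close>

lemma pos_sets_lambda_system: "pos_sets \<subseteq> lambda_system \<Omega> (Pow \<Omega>) outer"
proof
  fix E assume "E \<in> pos_sets"
  then obtain f where f: "f \<in> L" and E: "E = {x \<in> \<Omega>. 0 < f x}" by (auto simp: pos_sets_def)
  define h where "h k x = min 1 (real k * max 0 (f x))" for k :: nat and x
  have h [intro]: "h k \<in> L" for k unfolding h_def using f by auto
  have h_mono: "h k x \<le> h l x" if "k \<le> l" for k l x
    unfolding h_def using that by (intro min.mono mult_right_mono) auto
  have h_nonneg: "0 \<le> h k x" for k x by (auto simp: h_def)
  interpret sigma_algebra \<Omega> "Pow \<Omega>" by (rule sigma_algebra_Pow)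
  have "outer (E \<inter> A) + outer ((\<Omega> - E) \<inter> A) = outer A" if A: "A \<subseteq> \<Omega>" for A
  proof (rule antisym)
    have "subadditive (Pow \<Omega>) outer"
      using outer_measure_space_outer unfolding outer_measure_space_def
      by (intro countably_subadditive_subadditive) auto
    then have "outer ((E \<inter> A) \<union> ((\<Omega> - E) \<inter> A)) \<le> outer (E \<inter> A) + outer ((\<Omega> - E) \<inter> A)"
      using A by (intro subadditiveD) auto
    moreover have "(E \<inter> A) \<union> ((\<Omega> - E) \<inter> A) = A" using A by auto
    ultimately show "outer A \<le> outer (E \<inter> A) + outer ((\<Omega> - E) \<inter> A)" by simp
  next
    show "outer (E \<inter> A) + outer ((\<Omega> - E) \<inter> A) \<le> outer A"
    proof (rule outer_ge)
      fix c G assume G: "covers A G" "\<And>n. I (G n) \<le> c"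
      then have GL [intro]: "G n \<in> L" for n by (auto simp: covers_def)
      obtain r where r: "0 \<le> r" "outer ((\<Omega> - E) \<inter> A) = ennreal r"
        using outer_finite[of "(\<Omega> - E) \<inter> A"] by (auto simp: less_top elim: ennreal_cases)
      define a where "a k = I (\<lambda>x. min (G k x) (h k x))" for k
      have diff: "outer ((\<Omega> - E) \<inter> A) \<le> ennreal (c - a k)" for k
      proof (rule outer_le)
        show "covers ((\<Omega> - E) \<inter> A) (\<lambda>n x. G n x - min (G n x) (h k x))"
          unfolding covers_def
        proof (intro conjI ballI allI)
          fix x n assume x: "x \<in> \<Omega>"
          show "0 \<le> G n x - min (G n x) (h k x)" by simp
          show "G n x - min (G n x) (h k x) \<le> G (Suc n) x - min (G (Suc n) x) (h k x)"
            using covers_mono[OF G(1) x, of n "Suc n"] by auto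
        next
          fix x assume x: "x \<in> (\<Omega> - E) \<inter> A"
          then have "h k x = 0" by (auto simp: h_def E)
          moreover obtain n where "1 \<le> G n x" using x G(1) by (auto simp: covers_def)
          ultimately have "1 \<le> G n x - min (G n x) (h k x)" by auto
          then show "\<exists>n. 1 \<le> G n x - min (G n x) (h k x)" by blast
        qed auto
        fix n
        \<comment> \<open>\<open>a k\<close> is taken at stage \<open>k\<close> of \<open>G\<close>,
          so stage \<open>n\<close> is first raised to at least \<open>k\<close>; the remainders
          increase with the stage.\<close>
        let ?m = "max n k"
        have "I (\<lambda>x. G n x - min (G n x) (h k x)) \<le> I (\<lambda>x. G ?m x - min (G ?m x) (h k x))"
        proof (rule I_mono)
          fix x assume "x \<in> \<Omega>"
          then have "G n x \<le> G ?m x" by (intro covers_mono[OF G(1)]) auto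
          then show "G n x - min (G n x) (h k x) \<le> G ?m x - min (G ?m x) (h k x)" by auto
        qed auto
        also have "\<dots> = I (G ?m) - I (\<lambda>x. min (G ?m x) (h k x))" by (intro I_diff) auto
        also have "\<dots> \<le> c - a k"
          unfolding a_def
        proof (intro diff_mono G I_mono)
          fix x assume "x \<in> \<Omega>"
          then have "G k x \<le> G ?m x" by (intro covers_mono[OF G(1)]) auto
          then show "min (G k x) (h k x) \<le> min (G ?m x) (h k x)" by auto
        qed auto
        finally show "I (\<lambda>x. G n x - min (G n x) (h k x)) \<le> c - a k" .
      qed
      have "0 \<le> c" using I_nonneg[OF GL, of 0] G(2)[of 0] G(1) by (auto simp: covers_def)
      have a_nonneg: "0 \<le> a k" for k
        unfolding a_def using G(1) h_nonneg by (intro I_nonneg) (auto simp: covers_def)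
      \<comment> \<open>Since \<open>ennreal\<close> truncates, \<open>c - a k\<close> must be known
        to be nonnegative before \<open>diff\<close> can be solved for \<open>a k\<close>.\<close>
      have "a k \<le> c" for k
        unfolding a_def by (rule order_trans[OF I_mono G(2)[of k]]) auto
      then have "a k \<le> c - r" for k
        using diff[of k] r by (auto simp: ennreal_le_iff field_simps)
      moreover have "covers (E \<inter> A) (\<lambda>k x. min (G k x) (h k x))"
        unfolding covers_def
      proof (intro conjI ballI allI)
        fix x n assume x: "x \<in> \<Omega>"
        show "0 \<le> min (G n x) (h n x)" using x G(1) h_nonneg by (auto simp: covers_def)
        show "min (G n x) (h n x) \<le> min (G (Suc n) x) (h (Suc n) x)"
          using covers_mono[OF G(1) x, of n "Suc n"] h_mono[of n "Suc n" x] by (intro min.mono) auto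
      next
        fix x assume x: "x \<in> E \<inter> A"
        then have "0 < f x" "x \<in> \<Omega>" by (auto simp: E)
        then obtain k0 where k0: "1 < real k0 * f x" using reals_Archimedean3 by blast
        obtain n where n: "1 \<le> G n x" using x G(1) by (auto simp: covers_def)
        have "1 \<le> G (max k0 n) x" using n covers_mono[OF G(1) \<open>x \<in> \<Omega>\<close>, of n "max k0 n"] by simp
        moreover have "h k0 x = 1" using k0 \<open>0 < f x\<close> by (auto simp: h_def)
        then have "1 \<le> h (max k0 n) x" using h_mono[of k0 "max k0 n" x] by simp
        ultimately show "\<exists>n. 1 \<le> min (G n x) (h n x)" by (intro exI[of _ "max k0 n"]) auto
      qed auto
      ultimately have "outer (E \<inter> A) \<le> ennreal (c - r)" by (intro outer_le) (auto simp: a_def)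
      moreover have "0 \<le> c - r" using a_nonneg[of 0] \<open>\<And>k. a k \<le> c - r\<close>[of 0] by linarith
      ultimately show "outer (E \<inter> A) + outer ((\<Omega> - E) \<inter> A) \<le> ennreal c"
        using r add_right_mono[of "outer (E \<inter> A)" "ennreal (c - r)" "ennreal r"]
        by (simp add: ennreal_plus[symmetric] del: ennreal_plus)
    qed
  qed
  then show "E \<in> lambda_system \<Omega> (Pow \<Omega>) outer" by (auto simp: lambda_system_def E)
qed

section \<open>The Daniell measure and its integrals\<close>

definition daniell_measure :: "'a measure" where
  "daniell_measure = measure_of \<Omega> pos_sets outer"

lemma space_daniell_measure [simp]: "space daniell_measure = \<Omega>"
  and sets_daniell_measure [simp]: "sets daniell_measure = sigma_sets \<Omega> pos_sets"
  using pos_sets_subset by (auto simp: daniell_measure_def)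

lemma emeasure_daniell_measure:
  assumes "A \<in> sigma_sets \<Omega> pos_sets" shows "emeasure daniell_measure A = outer A"
proof -
  interpret sigma_algebra \<Omega> "Pow \<Omega>" by (rule sigma_algebra_Pow)
  have ms: "measure_space \<Omega> (lambda_system \<Omega> (Pow \<Omega>) outer) outer"
    by (rule caratheodory_lemma[OF outer_measure_space_outer])
  then have "sigma_sets \<Omega> pos_sets \<subseteq> lambda_system \<Omega> (Pow \<Omega>) outer"
    by (intro sigma_algebra.sigma_sets_subset pos_sets_lambda_system) (auto simp: measure_space_def)
  then have "measure_space \<Omega> (sigma_sets \<Omega> pos_sets) outer"
    using ms pos_sets_subset by (intro measure_down[OF ms] sigma_algebra_sigma_sets)
  then show ?thesis
    unfolding daniell_measure_def using assms pos_sets_subset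
    by (intro emeasure_measure_of[where M = "measure_of \<Omega> pos_sets outer" and \<Omega> = \<Omega> and A = pos_sets])
       (auto simp: measure_space_def)
qed

lemma finite_measure_daniell: "finite_measure daniell_measure"
proof
  have "\<Omega> \<in> sigma_sets \<Omega> pos_sets" by (rule sigma_sets_top)
  then show "emeasure daniell_measure (space daniell_measure) \<noteq> \<infinity>"
    using outer_finite[of \<Omega>] by (simp add: emeasure_daniell_measure)
qed

lemma measurable_daniell: "f \<in> L \<Longrightarrow> f \<in> borel_measurable daniell_measure"
  by (rule borel_measurable_pos_sets) auto

lemma measure_space_daniell: "measure daniell_measure \<Omega> = I (\<lambda>_. 1)"
proof -
  have "outer \<Omega> = ennreal (I (\<lambda>_. 1))"
    by (intro antisym outer_le_I I_le_outer) auto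
  then show ?thesis
    using I_nonneg[OF one] by (simp add: measure_def emeasure_daniell_measure sigma_sets_top)
qed

text \<open>Slicing \<open>f\<close> horizontally at the heights \<open>j / n\<close> bounds \<open>I f\<close> by a Riemann sum of the layer
  cake integral.\<close>

lemma I_le_integral:
  assumes f: "f \<in> L" "\<And>x. x \<in> \<Omega> \<Longrightarrow> 0 \<le> f x" "\<And>x. x \<in> \<Omega> \<Longrightarrow> f x \<le> 1"
  shows "I f \<le> (\<integral>x. f x \<partial>daniell_measure)"
proof (rule field_le_epsilon)
  interpret finite_measure daniell_measure by (rule finite_measure_daniell)
  let ?D = daniell_measure
  have [measurable]: "f \<in> borel_measurable ?D" using f by (intro measurable_daniell)
  have int_f: "integrable ?D f"
    using f by (intro integrable_const_bound[of _ 1] AE_I2) auto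
  fix e :: real assume e: "0 < e"
  \<comment> \<open>The Riemann sum will exceed the integral by at most \<open>inverse n\<close>
    times the total mass, which this choice brings below \<open>e\<close>.\<close>
  obtain n :: nat where n: "I (\<lambda>_. 1) / e < n" using reals_Archimedean2 by blast
  have "0 \<le> I (\<lambda>_. 1)" by (rule I_nonneg) auto
  then have "0 \<le> I (\<lambda>_. 1) / e" using e by simp
  with n have n0: "n > 0" by (intro gr0I) auto
  \<comment> \<open>\<open>q j\<close> is the slice of \<open>f\<close> between the heights
    \<open>j / n\<close> and \<open>(j + 1) / n\<close>, stretched by \<open>n\<close>: its values
    lie in the unit interval and it vanishes off \<open>E j\<close>, as \<open>I_le_outer\<close>
    requires.\<close>
  define q where "q j x = n * (min (f x) (real (Suc j) / n) - min (f x) (real j / n))" for j :: nat and x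
  define E where "E j = {x \<in> \<Omega>. real j / n < f x}" for j :: nat
  have E [measurable]: "E j \<in> sets ?D" for j
    unfolding E_def sets_daniell_measure by (rule sigma_sets.Basic[OF greater_mem_pos_sets[OF f(1)]])
  have q: "q j \<in> L" for j unfolding q_def using f by auto
  have le: "I (q j) \<le> measure ?D (E j)" for j
  proof -
    have "ennreal (I (q j)) \<le> outer (E j)"
    proof (rule I_le_outer[OF q])
      fix x assume x: "x \<in> \<Omega>"
      have *: "real j / n \<le> real (Suc j) / n" by (simp add: divide_right_mono)
      then show "0 \<le> q j x" unfolding q_def by (intro mult_nonneg_nonneg) auto
      have "min (f x) (real (Suc j) / n) - min (f x) (real j / n) \<le> real (Suc j) / n - real j / n"
        using * by auto
      also have "\<dots> = 1 / n" by (simp add: diff_divide_distrib[symmetric])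
      finally show "q j x \<le> 1" unfolding q_def using n0 by (simp add: field_simps)
      assume "x \<notin> E j" then show "q j x = 0" using x * by (auto simp: E_def q_def)
    qed
    then show ?thesis using E[of j]
      by (simp add: emeasure_daniell_measure[symmetric] emeasure_eq_measure)
  qed
  have tele: "f x = (\<Sum>j<n. inverse n * q j x)" if x: "x \<in> \<Omega>" for x
  proof -
    have "(\<Sum>j<n. inverse n * q j x) = (\<Sum>j<n. min (f x) (real (Suc j) / n) - min (f x) (real j / n))"
      using n0 by (intro sum.cong) (auto simp: q_def)
    also have "\<dots> = min (f x) (real n / n) - min (f x) (real 0 / n)"
      by (rule sum_lessThan_telescope)
    also have "\<dots> = f x" using f x n0 by auto
    finally show ?thesis by simp
  qed
  have "I f = I (\<lambda>x. \<Sum>j<n. inverse n * q j x)" using f q tele by (intro I_cong) auto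
  also have "\<dots> = (\<Sum>j<n. inverse n * I (q j))" using q by (simp add: I_sum I_scale scale)
  also have "\<dots> \<le> (\<Sum>j<n. inverse n * measure ?D (E j))" using le by (intro sum_mono mult_left_mono) auto
  also have "\<dots> = (\<integral>x. (\<Sum>j<n. inverse n * indicator (E j) x) \<partial>?D)"
    using sets.Int_space_eq2[OF E] E
    by (subst Bochner_Integration.integral_sum) (auto intro!: integrable_real_indicator simp: emeasure_eq_measure)
  also have "\<dots> \<le> (\<integral>x. f x + inverse n \<partial>?D)"
  proof (rule integral_mono)
    fix x assume x: "x \<in> space ?D"
    \<comment> \<open>At most \<open>n * f x + 1\<close> of the levels \<open>j / n\<close> lie
      below \<open>f x\<close>; after division by \<open>n\<close> the surplus 1 is the error term
      \<open>inverse n\<close>.\<close>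
    let ?J = "{j. j < n \<and> real j / n < f x}"
    have "?J \<subseteq> {..<nat \<lceil>n * f x\<rceil>}"
    proof
      fix j assume "j \<in> ?J"
      then have "real j < n * f x" using n0 by (simp add: field_simps)
      then show "j \<in> {..<nat \<lceil>n * f x\<rceil>}" by (simp add: less_ceiling_iff zless_nat_eq_int_zless)
    qed
    from card_mono[OF _ this] have "card ?J \<le> nat \<lceil>n * f x\<rceil>" by simp
    moreover have "0 \<le> n * f x" using x f(2)[of x] by simp
    then have "real (nat \<lceil>n * f x\<rceil>) \<le> n * f x + 1" by linarith
    ultimately have card: "real (card ?J) \<le> n * f x + 1" by linarith
    have "(\<Sum>j<n. inverse n * indicator (E j) x) = inverse n * real (card ?J)"
      using x by (simp add: sum_distrib_left[symmetric] E_def indicator_def sum.If_cases Int_def)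
    also have "\<dots> \<le> inverse n * (n * f x + 1)"
      using card by (intro mult_left_mono) auto
    also have "\<dots> = f x + inverse n" using n0 by (simp add: field_simps)
    finally show "(\<Sum>j<n. inverse n * indicator (E j) x) \<le> f x + inverse n" .
  next
    show "integrable ?D (\<lambda>x. \<Sum>j<n. inverse n * indicator (E j) x)"
      by (intro Bochner_Integration.integrable_sum integrable_mult_right integrable_real_indicator E)
        (simp add: emeasure_eq_measure)
  qed (use int_f in auto)
  also have "\<dots> = (\<integral>x. f x \<partial>?D) + inverse n * I (\<lambda>_. 1)"
    using int_f by (simp add: measure_space_daniell)
  also have "inverse n * I (\<lambda>_. 1) \<le> e" using n n0 e by (simp add: field_simps)
  finally show "I f \<le> (\<integral>x. f x \<partial>?D) + e" by simp
qed

text \<open>The missing inequality is the known one for \<open>1 - f\<close>, because the total mass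
  is the value of \<open>I\<close> at the constant 1.\<close>

lemma I_eq_integral_unit:
  assumes f: "f \<in> L" "\<And>x. x \<in> \<Omega> \<Longrightarrow> 0 \<le> f x" "\<And>x. x \<in> \<Omega> \<Longrightarrow> f x \<le> 1"
  shows "(\<integral>x. f x \<partial>daniell_measure) = I f"
proof (rule antisym)
  interpret finite_measure daniell_measure by (rule finite_measure_daniell)
  have [measurable]: "f \<in> borel_measurable daniell_measure" using f by (intro measurable_daniell)
  have int_f: "integrable daniell_measure f"
    using f by (intro integrable_const_bound[of _ 1] AE_I2) auto
  have "I (\<lambda>x. 1 - f x) \<le> (\<integral>x. 1 - f x \<partial>daniell_measure)"
    using f by (intro I_le_integral) auto
  then show "(\<integral>x. f x \<partial>daniell_measure) \<le> I f"
    using int_f f(1) by (simp add: I_diff measure_space_daniell)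
qed (rule I_le_integral[OF f])

text \<open>A nonnegative \<open>f\<close> is truncated and scaled into the unit interval. Daniell
  continuity takes the limit on the side of \<open>I\<close>; monotone convergence takes it on the
  side of the integral and yields integrability of \<open>f\<close> as well. A general
  \<open>f\<close> is the difference of its positive and negative parts.\<close>

theorem daniell_stone:
  assumes f: "f \<in> L"
  shows "integrable daniell_measure f" "(\<integral>x. f x \<partial>daniell_measure) = I f"
proof -
  interpret finite_measure daniell_measure by (rule finite_measure_daniell)
  let ?D = daniell_measure
  have pos: "integrable ?D f \<and> (\<integral>x. f x \<partial>?D) = I f"
    if f: "f \<in> L" "\<And>x. x \<in> \<Omega> \<Longrightarrow> 0 \<le> f x" for f
  proof -
    have [measurable]: "f \<in> borel_measurable ?D" using f by (intro measurable_daniell)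
    \<comment> \<open>\<open>Suc n\<close> keeps the height of truncation positive, so that dividing
      by it makes sense also for \<open>n = 0\<close>.\<close>
    define g where "g n x = min (f x) (real (Suc n))" for n x
    have g: "g n \<in> L" for n unfolding g_def using f by auto
    have int_g: "integrable ?D (g n)" for n
      using f measurable_daniell[OF g]
      by (intro integrable_const_bound[of _ "real (Suc n)"] AE_I2) (auto simp: g_def)
    have unit: "(\<integral>x. inverse (real (Suc n)) * g n x \<partial>?D) = I (\<lambda>x. inverse (real (Suc n)) * g n x)" for n
    proof (rule I_eq_integral_unit)
      fix x assume "x \<in> \<Omega>"
      show "inverse (real (Suc n)) * g n x \<le> 1"
        unfolding g_def by (auto simp: field_simps min_def simp del: of_nat_Suc)
    qed (use f g in \<open>auto simp: g_def\<close>)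
    have eq: "(\<integral>x. g n x \<partial>?D) = I (g n)" for n
    proof -
      have "inverse (real (Suc n)) * (\<integral>x. g n x \<partial>?D) = inverse (real (Suc n)) * I (g n)"
        using unit[of n] I_scale[OF g[of n], of "inverse (real (Suc n))"] by (simp del: of_nat_Suc)
      then show ?thesis by (simp del: of_nat_Suc)
    qed
    have g_lim: "(\<lambda>n. g n x) \<longlonglongrightarrow> f x" for x
    proof -
      obtain k where "f x < real k" using reals_Archimedean2 by blast
      then have "g n x = f x" if "n \<ge> k" for n using that by (auto simp: g_def)
      then show ?thesis by (intro tendsto_eventually eventually_sequentiallyI)
    qed
    have "(\<lambda>n. I (\<lambda>x. f x - g n x)) \<longlonglongrightarrow> 0"
    proof (rule I_continuous)
      fix x show "(\<lambda>n. f x - g n x) \<longlonglongrightarrow> 0" using tendsto_diff[OF tendsto_const[of "f x"] g_lim[of x]] by simp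
    qed (use f g in \<open>auto simp: g_def\<close>)
    then have "(\<lambda>n. I f - I (\<lambda>x. f x - g n x)) \<longlonglongrightarrow> I f - 0" by (intro tendsto_intros)
    then have lim: "(\<lambda>n. \<integral>x. g n x \<partial>?D) \<longlonglongrightarrow> I f" using f g by (simp add: I_diff eq)
    have mono: "AE x in ?D. mono (\<lambda>n. g n x)" by (auto simp: g_def mono_def)
    have AE_lim: "AE x in ?D. (\<lambda>n. g n x) \<longlonglongrightarrow> f x" using g_lim by simp
    have f_meas: "f \<in> borel_measurable ?D" by measurable
    show ?thesis
      using integrable_monotone_convergence[OF int_g mono AE_lim lim f_meas]
        integral_monotone_convergence[OF int_g mono AE_lim lim f_meas] by (intro conjI)
  qed
  let ?p = "\<lambda>x. max (f x) 0" and ?n = "\<lambda>x. max (- f x) 0"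
  have p: "integrable ?D ?p \<and> (\<integral>x. ?p x \<partial>?D) = I ?p" and n: "integrable ?D ?n \<and> (\<integral>x. ?n x \<partial>?D) = I ?n"
    using f by (auto intro!: pos)
  have eq: "f = (\<lambda>x. ?p x - ?n x)" by (auto simp: max_def)
  have "I (\<lambda>x. ?p x - ?n x) = I ?p - I ?n" using f by (intro I_diff) auto
  then have "I f = I ?p - I ?n" unfolding eq[symmetric] .
  moreover have "integrable ?D (\<lambda>x. ?p x - ?n x)" "(\<integral>x. ?p x - ?n x \<partial>?D) = I ?p - I ?n"
    using p n by simp_all
  ultimately show "integrable ?D f" "(\<integral>x. f x \<partial>?D) = I f"
    unfolding eq[symmetric] by simp_all
qed

end

section \<open>Orlicz functions\<close>

text \<open>Such a set is empty, everything or a ray. Superlevel sets of nondecreasing functions are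
  of this form, whence the measurability of Orlicz functions.\<close>

lemma up_set_borel:
  fixes U :: "real set"
  assumes "\<And>x y. x \<in> U \<Longrightarrow> x \<le> y \<Longrightarrow> y \<in> U"
  shows "U \<in> sets borel"
proof -
  consider "U = {}" | "U = UNIV" | "U \<noteq> {}" "bdd_below U"
    using assms unfolding bdd_below_def by (metis UNIV_eq_I linear)
  then show ?thesis
  proof cases
    case 3
    have ge: "Inf U \<le> x" if "x \<in> U" for x using 3 that by (auto intro: cInf_lower)
    have gt: "x \<in> U" if "Inf U < x" for x using 3 that assms by (auto simp: cInf_less_iff)
    have "U = (if Inf U \<in> U then {Inf U..} else {Inf U<..})"
      using ge gt by (auto simp: le_less; metis)
    then show ?thesis by (metis atLeast_borel greaterThan_borel)
  qed auto
qed

lemma orlicz_mono: "orlicz_function \<phi> \<Longrightarrow> 0 \<le> x \<Longrightarrow> x \<le> y \<Longrightarrow> \<phi> x \<le> \<phi> y"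
  unfolding orlicz_function_def mono_on_def by auto

lemma orlicz_zero: "orlicz_function \<phi> \<Longrightarrow> \<phi> 0 = 0"
  by (simp add: orlicz_function_def)

lemma orlicz_convex:
  "orlicz_function \<phi> \<Longrightarrow> 0 \<le> x \<Longrightarrow> 0 \<le> y \<Longrightarrow> 0 \<le> t \<Longrightarrow> t \<le> 1 \<Longrightarrow>
    \<phi> ((1 - t) * x + t * y) \<le> ennreal (1 - t) * \<phi> x + ennreal t * \<phi> y"
  by (simp add: orlicz_function_def)

lemma orlicz_measurable:
  fixes f :: "'a \<Rightarrow> real"
  assumes \<phi>: "orlicz_function \<phi>" and f [measurable]: "f \<in> borel_measurable M" and "\<And>\<omega>. 0 \<le> f \<omega>"
  shows "(\<lambda>\<omega>. \<phi> (f \<omega>)) \<in> borel_measurable M"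
proof -
  \<comment> \<open>\<open>\<phi>\<close> is unconstrained at negative arguments, so monotonicity is
    available only after truncation at 0.\<close>
  have "(\<lambda>x. \<phi> (max 0 x)) \<in> borel_measurable borel"
  proof (rule borel_measurableI_greater)
    fix y
    show "{x \<in> space borel. y < \<phi> (max 0 x)} \<in> sets borel"
      by (rule up_set_borel) (auto elim!: less_le_trans intro!: orlicz_mono[OF \<phi>])
  qed
  then have "(\<lambda>\<omega>. \<phi> (max 0 (f \<omega>))) \<in> borel_measurable M" by measurable
  then show ?thesis using assms(3) by (simp add: max_absorb2)
qed

text \<open>Convexity together with \<open>\<phi> 0 = 0\<close> forces linear growth,
  \<open>n * \<phi> x1 \<le> \<phi> (n * x1)\<close>, from a point \<open>x1\<close> where
  \<open>\<phi>\<close> is positive.\<close>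

lemma orlicz_unbounded:
  assumes \<phi>: "orlicz_function \<phi>" and B: "B < \<infinity>"
  obtains x0 where "0 < x0" "\<And>x. x0 \<le> x \<Longrightarrow> B \<le> \<phi> x"
proof -
  obtain x1 where x1: "0 < x1" "0 < \<phi> x1" using \<phi> by (auto simp: orlicz_function_def)
  have "B / \<phi> x1 < \<infinity>" using x1 B by (auto simp: ennreal_divide_eq_top_iff less_top[symmetric])
  then obtain m :: nat where m: "B / \<phi> x1 \<le> of_nat m"
    using ennreal_Ex_less_of_nat by (metis less_imp_le infinity_ennreal_def)
  \<comment> \<open>\<open>Suc\<close> makes \<open>n\<close> positive, as the weight
    \<open>1 / n\<close> in the convexity inequality requires.\<close>
  define n where "n = Suc m"
  have n: "0 < n" "B / \<phi> x1 \<le> of_nat n" using m by (auto simp: n_def intro: order_trans)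
  have "\<phi> x1 \<le> ennreal (1 / n) * \<phi> (n * x1)"
    using orlicz_convex[OF \<phi>, of 0 "n * x1" "1 / n"] x1 n by (simp add: orlicz_zero[OF \<phi>])
  then have "of_nat n * \<phi> x1 \<le> of_nat n * (ennreal (1 / n) * \<phi> (n * x1))" by (intro mult_left_mono) auto
  also have "\<dots> = \<phi> (n * x1)"
    using n by (simp add: mult.assoc[symmetric] ennreal_of_nat_eq_real_of_nat ennreal_mult[symmetric])
  finally have le: "of_nat n * \<phi> x1 \<le> \<phi> (n * x1)" .
  have "B \<le> of_nat n * \<phi> x1"
  proof (cases "\<phi> x1 = \<infinity>")
    \<comment> \<open>Here \<open>B / \<phi> x1\<close> is 0 and carries no information, but a
      positive multiple of \<infinity> dominates \<open>B\<close> anyway.\<close>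
    case True then show ?thesis using n by (simp add: ennreal_mult_top)
  next
    case False
    then have "B * \<phi> x1 / \<phi> x1 = B" using x1 by (intro mult_divide_eq_ennreal) auto
    then have "B = B / \<phi> x1 * \<phi> x1" by (simp add: ennreal_divide_times ennreal_times_divide)
    also have "\<dots> \<le> of_nat n * \<phi> x1" using n by (intro mult_right_mono) auto
    finally show ?thesis .
  qed
  with le have "B \<le> \<phi> x" if "n * x1 \<le> x" for x
    using that x1 orlicz_mono[OF \<phi>, of "n * x1" x] by auto
  then show thesis using that[of "n * x1"] x1 n by auto
qed

lemma liminf_orlicz_eq_top:
  assumes \<phi>: "orlicz_function \<phi>" and x: "filterlim x at_top sequentially"
  shows "liminf (\<lambda>n. \<phi> (x n)) = \<infinity>"
proof -
  have "of_nat m \<le> liminf (\<lambda>n. \<phi> (x n))" for m :: nat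
  proof -
    have "of_nat m < (\<infinity> :: ennreal)" by (simp add: of_nat_less_top)
    then obtain x0 where x0: "\<And>y. x0 \<le> y \<Longrightarrow> of_nat m \<le> \<phi> y" using orlicz_unbounded[OF \<phi>] by metis
    have "eventually (\<lambda>n. x0 \<le> x n) sequentially" using x by (simp add: filterlim_at_top)
    then show ?thesis by (intro Liminf_bounded) (auto elim: eventually_mono intro: x0)
  qed
  then show ?thesis using ennreal_Ex_less_of_nat by (metis infinity_ennreal_def not_le top.not_eq_extremum)
qed

section \<open>The robust Luxemburg norm of a function\<close>

text \<open>\<open>orlicz_norm\<close> evaluates this expression at the representative chosen by
  \<open>rep\<close>. The value depends on the class only, so all estimates can be made for
  functions.\<close>

definition lux_norm ::
    "'a measure set \<Rightarrow> ('a measure \<Rightarrow> real \<Rightarrow> ennreal) \<Rightarrow> ('a \<Rightarrow> real) \<Rightarrow> ennreal" where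
  "lux_norm PP \<Phi> f =
     Inf {ennreal c | c. c > 0 \<and> (SUP P\<in>PP. \<integral>\<^sup>+ \<omega>. \<Phi> P (inverse c * \<bar>f \<omega>\<bar>) \<partial>P) \<le> 1}"

locale robust_orlicz =
  fixes M :: "'a measure" and PP :: "'a measure set" and \<Phi> :: "'a measure \<Rightarrow> real \<Rightarrow> ennreal"
  assumes PP_nonempty: "PP \<noteq> {}"
    and PP_prob: "P \<in> PP \<Longrightarrow> prob_space P"
    and PP_sets: "P \<in> PP \<Longrightarrow> sets P = sets M"
    and \<Phi>_orlicz: "P \<in> PP \<Longrightarrow> orlicz_function (\<Phi> P)"
begin

abbreviation N :: "('a \<Rightarrow> real) \<Rightarrow> ennreal" where "N \<equiv> lux_norm PP \<Phi>"

lemma PP_measurable: "P \<in> PP \<Longrightarrow> f \<in> borel_measurable M \<Longrightarrow> f \<in> borel_measurable P"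
  by (simp add: measurable_cong_sets[OF PP_sets])

lemma PP_measurable_\<Phi>:
  assumes P: "P \<in> PP" and f: "f \<in> borel_measurable M" and "0 \<le> c"
  shows "(\<lambda>\<omega>. \<Phi> P (c * \<bar>f \<omega>\<bar>)) \<in> borel_measurable P"
proof -
  have [measurable]: "f \<in> borel_measurable P" using P f by (rule PP_measurable)
  show ?thesis using \<open>0 \<le> c\<close> by (intro orlicz_measurable[OF \<Phi>_orlicz[OF P]]) auto
qed

text \<open>A strict bound provides an admissible constant below \<open>c\<close>, and the modular
  decreases as the constant grows.\<close>

lemma lux_norm_less:
  assumes "N f < ennreal c" "P \<in> PP"
  shows "(\<integral>\<^sup>+ \<omega>. \<Phi> P (inverse c * \<bar>f \<omega>\<bar>) \<partial>P) \<le> 1"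
proof -
  obtain a where a: "0 < a" "(SUP P\<in>PP. \<integral>\<^sup>+ \<omega>. \<Phi> P (inverse a * \<bar>f \<omega>\<bar>) \<partial>P) \<le> 1" "a < c"
    using assms(1) unfolding lux_norm_def Inf_less_iff by (auto simp: ennreal_less_iff)
  have "(\<integral>\<^sup>+ \<omega>. \<Phi> P (inverse c * \<bar>f \<omega>\<bar>) \<partial>P) \<le> (\<integral>\<^sup>+ \<omega>. \<Phi> P (inverse a * \<bar>f \<omega>\<bar>) \<partial>P)"
    using a by (intro nn_integral_mono orlicz_mono[OF \<Phi>_orlicz[OF assms(2)]] mult_right_mono) auto
  also have "\<dots> \<le> 1" using a(2) assms(2) by (simp add: SUP_le_iff)
  finally show ?thesis .
qed

lemma lux_norm_le:
  assumes "0 < c" "\<And>P. P \<in> PP \<Longrightarrow> (\<integral>\<^sup>+ \<omega>. \<Phi> P (inverse c * \<bar>f \<omega>\<bar>) \<partial>P) \<le> 1"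
  shows "N f \<le> ennreal c"
  unfolding lux_norm_def using assms by (intro Inf_lower) (auto simp: SUP_le_iff)

lemma lux_norm_mono:
  assumes "\<And>P. P \<in> PP \<Longrightarrow> AE \<omega> in P. \<bar>f \<omega>\<bar> \<le> \<bar>g \<omega>\<bar>"
  shows "N f \<le> N g"
  unfolding lux_norm_def[of PP \<Phi> g]
proof (safe intro!: Inf_greatest lux_norm_le)
  fix c P assume c: "0 < c" "(SUP P\<in>PP. \<integral>\<^sup>+ \<omega>. \<Phi> P (inverse c * \<bar>g \<omega>\<bar>) \<partial>P) \<le> 1" and P: "P \<in> PP"
  have "(\<integral>\<^sup>+ \<omega>. \<Phi> P (inverse c * \<bar>f \<omega>\<bar>) \<partial>P) \<le> (\<integral>\<^sup>+ \<omega>. \<Phi> P (inverse c * \<bar>g \<omega>\<bar>) \<partial>P)"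
    using assms[OF P] c(1)
    by (intro nn_integral_mono_AE) (auto elim!: eventually_mono intro!: orlicz_mono[OF \<Phi>_orlicz[OF P]] mult_left_mono)
  also have "\<dots> \<le> 1" using c(2) P by (simp add: SUP_le_iff)
  finally show "(\<integral>\<^sup>+ \<omega>. \<Phi> P (inverse c * \<bar>f \<omega>\<bar>) \<partial>P) \<le> 1" .
qed

lemma lux_norm_cong:
  assumes "\<And>P. P \<in> PP \<Longrightarrow> AE \<omega> in P. f \<omega> = g \<omega>" shows "N f = N g"
proof -
  have "AE \<omega> in P. \<bar>f \<omega>\<bar> \<le> \<bar>g \<omega>\<bar>" "AE \<omega> in P. \<bar>g \<omega>\<bar> \<le> \<bar>f \<omega>\<bar>" if "P \<in> PP" for P
    using assms[OF that] by (eventually_elim, simp)+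
  then show ?thesis by (intro antisym lux_norm_mono)
qed

lemma lux_norm_abs [simp]: "N (\<lambda>\<omega>. \<bar>f \<omega>\<bar>) = N f"
  by (intro antisym lux_norm_mono) auto

lemma lux_norm_zero: "N (\<lambda>_. 0) = 0"
proof -
  have "N (\<lambda>_. 0) \<le> 0 + ennreal e" if "0 < e" for e
    using that by (auto intro!: lux_norm_le simp: orlicz_zero[OF \<Phi>_orlicz])
  then have "N (\<lambda>_. 0) \<le> 0" by (rule ennreal_le_epsilon)
  then show ?thesis by simp
qed

lemma lux_norm_triangle:
  assumes f: "f \<in> borel_measurable M" and g: "g \<in> borel_measurable M"
  shows "N (\<lambda>\<omega>. f \<omega> + g \<omega>) \<le> N f + N g"
proof (rule ennreal_le_epsilon)
  fix e :: real assume e: "0 < e" and fin: "N f + N g < top_class.top"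
  obtain r s where rs: "0 \<le> r" "N f = ennreal r" "0 \<le> s" "N g = ennreal s"
    using fin by (cases "N f"; cases "N g") auto
  define a b where "a = r + e / 2" and "b = s + e / 2"
  have ab: "0 < a" "0 < b" "N f < ennreal a" "N g < ennreal b"
    using rs e by (auto simp: a_def b_def ennreal_less_iff)
  have "N (\<lambda>\<omega>. f \<omega> + g \<omega>) \<le> ennreal (a + b)"
  proof (rule lux_norm_le)
    fix P assume P: "P \<in> PP"
    \<comment> \<open>\<open>(f + g) / (a + b)\<close> is the convex combination of
      \<open>f / a\<close> and \<open>g / b\<close> with the weights
      \<open>1 - t = a / (a + b)\<close> and \<open>t\<close>.\<close>
    define t where "t = b / (a + b)"
    have t: "0 \<le> t" "t \<le> 1" "1 - t = a / (a + b)" using ab by (auto simp: t_def field_simps)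
    have "\<Phi> P (inverse (a + b) * \<bar>f \<omega> + g \<omega>\<bar>) \<le>
        ennreal (1 - t) * \<Phi> P (inverse a * \<bar>f \<omega>\<bar>) + ennreal t * \<Phi> P (inverse b * \<bar>g \<omega>\<bar>)" for \<omega>
    proof -
      have "inverse (a + b) * \<bar>f \<omega> + g \<omega>\<bar> \<le> inverse (a + b) * (\<bar>f \<omega>\<bar> + \<bar>g \<omega>\<bar>)"
        using ab by (intro mult_left_mono) auto
      also have "\<dots> = (1 - t) * (inverse a * \<bar>f \<omega>\<bar>) + t * (inverse b * \<bar>g \<omega>\<bar>)"
        unfolding t(3) using ab by (simp add: t_def divide_simps)
      finally have "\<Phi> P (inverse (a + b) * \<bar>f \<omega> + g \<omega>\<bar>) \<le>
          \<Phi> P ((1 - t) * (inverse a * \<bar>f \<omega>\<bar>) + t * (inverse b * \<bar>g \<omega>\<bar>))"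
        using ab by (intro orlicz_mono[OF \<Phi>_orlicz[OF P]]) auto
      also have "\<dots> \<le> ennreal (1 - t) * \<Phi> P (inverse a * \<bar>f \<omega>\<bar>) + ennreal t * \<Phi> P (inverse b * \<bar>g \<omega>\<bar>)"
        using ab t by (intro orlicz_convex[OF \<Phi>_orlicz[OF P]]) auto
      finally show ?thesis .
    qed
    then have "(\<integral>\<^sup>+ \<omega>. \<Phi> P (inverse (a + b) * \<bar>f \<omega> + g \<omega>\<bar>) \<partial>P) \<le>
        (\<integral>\<^sup>+ \<omega>. ennreal (1 - t) * \<Phi> P (inverse a * \<bar>f \<omega>\<bar>) + ennreal t * \<Phi> P (inverse b * \<bar>g \<omega>\<bar>) \<partial>P)"
      by (intro nn_integral_mono)
    also have "\<dots> = ennreal (1 - t) * (\<integral>\<^sup>+ \<omega>. \<Phi> P (inverse a * \<bar>f \<omega>\<bar>) \<partial>P) +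
        ennreal t * (\<integral>\<^sup>+ \<omega>. \<Phi> P (inverse b * \<bar>g \<omega>\<bar>) \<partial>P)"
      using PP_measurable_\<Phi>[OF P f, of "inverse a"] PP_measurable_\<Phi>[OF P g, of "inverse b"] ab
      by (simp add: nn_integral_add nn_integral_cmult)
    also have "\<dots> \<le> ennreal (1 - t) * 1 + ennreal t * 1"
      using ab P by (intro add_mono mult_left_mono lux_norm_less) auto
    also have "\<dots> = 1" using t by (simp add: ennreal_plus[symmetric] del: ennreal_plus)
    finally show "(\<integral>\<^sup>+ \<omega>. \<Phi> P (inverse (a + b) * \<bar>f \<omega> + g \<omega>\<bar>) \<partial>P) \<le> 1" .
  qed (use ab in simp)
  also have "ennreal (a + b) = N f + N g + ennreal e"
    using rs e by (simp add: a_def b_def ennreal_plus[symmetric] del: ennreal_plus)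
  finally show "N (\<lambda>\<omega>. f \<omega> + g \<omega>) \<le> N f + N g + ennreal e" .
qed

lemma lux_norm_scale: "N (\<lambda>\<omega>. c * f \<omega>) = ennreal \<bar>c\<bar> * N f"
proof (cases "c = 0")
  case True then show ?thesis by (simp add: lux_norm_zero)
next
  case False
  \<comment> \<open>Proved for all nonzero \<open>c\<close> and all \<open>f\<close>, because the
    reverse inequality is the instance with \<open>inverse c\<close> and
    \<open>c * f\<close>.\<close>
  have le: "N (\<lambda>\<omega>. c * f \<omega>) \<le> ennreal \<bar>c\<bar> * N f" if c: "c \<noteq> 0" for c f
  proof (rule ennreal_le_epsilon)
    fix e :: real assume e: "0 < e" and "ennreal \<bar>c\<bar> * N f < top_class.top"
    then obtain r where r: "0 \<le> r" "N f = ennreal r"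
      using c by (cases "N f") (auto simp: ennreal_mult_top)
    define a where "a = r + e / \<bar>c\<bar>"
    have a: "0 < a" "N f < ennreal a"
      using e r c by (auto simp: a_def ennreal_less_iff add_nonneg_pos)
    have "N (\<lambda>\<omega>. c * f \<omega>) \<le> ennreal (\<bar>c\<bar> * a)"
    proof (rule lux_norm_le)
      fix P assume P: "P \<in> PP"
      have "inverse (\<bar>c\<bar> * a) * \<bar>c * f \<omega>\<bar> = inverse a * \<bar>f \<omega>\<bar>" for \<omega>
        using c a by (simp add: abs_mult)
      then show "(\<integral>\<^sup>+ \<omega>. \<Phi> P (inverse (\<bar>c\<bar> * a) * \<bar>c * f \<omega>\<bar>) \<partial>P) \<le> 1"
        using lux_norm_less[OF a(2) P] by (simp only:)
    qed (use c a in simp)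
    also have "\<bar>c\<bar> * a = \<bar>c\<bar> * r + e" using c by (simp add: a_def field_simps)
    also have "ennreal \<dots> = ennreal \<bar>c\<bar> * N f + ennreal e" using r e by (simp add: ennreal_mult)
    finally show "N (\<lambda>\<omega>. c * f \<omega>) \<le> ennreal \<bar>c\<bar> * N f + ennreal e" .
  qed
  have "ennreal \<bar>c\<bar> * N f \<le> ennreal \<bar>c\<bar> * (ennreal \<bar>inverse c\<bar> * N (\<lambda>\<omega>. c * f \<omega>))"
    using le[of "inverse c" "\<lambda>\<omega>. c * f \<omega>"] False by (intro mult_left_mono) (auto simp: mult.assoc[symmetric])
  also have "\<dots> = N (\<lambda>\<omega>. c * f \<omega>)"
    using False by (simp add: mult.assoc[symmetric] ennreal_mult[symmetric] abs_mult[symmetric])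
  finally show ?thesis using le[OF False] by (intro antisym)
qed

lemma lux_norm_diff_commute: "N (\<lambda>\<omega>. f \<omega> - g \<omega>) = N (\<lambda>\<omega>. g \<omega> - f \<omega>)"
  by (intro antisym lux_norm_mono) auto

text \<open>By Fatou's lemma the lower limit has integral at most 1. Together with
  \<open>liminf_orlicz_eq_top\<close> this excludes that the arguments
  \<open>c n * \<bar>F n \<omega>\<bar>\<close> tend to infinity on a set of positive
  probability.\<close>

lemma AE_liminf_less_top:
  assumes P: "P \<in> PP" and F: "\<And>n. F n \<in> borel_measurable M" and c: "\<And>n. 0 \<le> c n"
    and le: "\<And>n. (\<integral>\<^sup>+ \<omega>. \<Phi> P (c n * \<bar>F n \<omega>\<bar>) \<partial>P) \<le> 1"
  shows "AE \<omega> in P. liminf (\<lambda>n. \<Phi> P (c n * \<bar>F n \<omega>\<bar>)) \<noteq> \<infinity>"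
proof (rule nn_integral_PInf_AE)
  have [measurable]: "(\<lambda>\<omega>. \<Phi> P (c n * \<bar>F n \<omega>\<bar>)) \<in> borel_measurable P" for n
    using PP_measurable_\<Phi>[OF P F c] .
  show "(\<lambda>\<omega>. liminf (\<lambda>n. \<Phi> P (c n * \<bar>F n \<omega>\<bar>))) \<in> borel_measurable P" by measurable
  have "(\<integral>\<^sup>+ \<omega>. liminf (\<lambda>n. \<Phi> P (c n * \<bar>F n \<omega>\<bar>)) \<partial>P) \<le> liminf (\<lambda>n. \<integral>\<^sup>+ \<omega>. \<Phi> P (c n * \<bar>F n \<omega>\<bar>) \<partial>P)"
    by (intro nn_integral_liminf) auto
  also have "\<dots> \<le> liminf (\<lambda>n. 1)" using le by (intro Liminf_mono) auto
  also have "\<dots> = 1" by (simp add: Liminf_const)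
  finally show "(\<integral>\<^sup>+ \<omega>. liminf (\<lambda>n. \<Phi> P (c n * \<bar>F n \<omega>\<bar>)) \<partial>P) \<noteq> \<infinity>" by (auto simp: top_unique)
qed

text \<open>Norm 0 bounds the modular of every multiple \<open>n * f\<close> by 1, while
  \<open>n * \<bar>f \<omega>\<bar>\<close> tends to infinity wherever
  \<open>f \<omega> \<noteq> 0\<close>.\<close>

lemma lux_norm_eq_0:
  assumes f: "f \<in> borel_measurable M" and 0: "N f = 0" and P: "P \<in> PP"
  shows "AE \<omega> in P. f \<omega> = 0"
proof -
  have "(\<integral>\<^sup>+ \<omega>. \<Phi> P (real n * \<bar>f \<omega>\<bar>) \<partial>P) \<le> 1" for n
  proof (cases "n = 0")
    case True then show ?thesis by (simp add: orlicz_zero[OF \<Phi>_orlicz[OF P]])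
  next
    case False
    then show ?thesis using lux_norm_less[of f "inverse (real n)" P] 0 P by simp
  qed
  then have "AE \<omega> in P. liminf (\<lambda>n. \<Phi> P (real n * \<bar>f \<omega>\<bar>)) \<noteq> \<infinity>"
    using P f by (intro AE_liminf_less_top) auto
  then show ?thesis
  proof (rule eventually_mono)
    fix \<omega> assume *: "liminf (\<lambda>n. \<Phi> P (real n * \<bar>f \<omega>\<bar>)) \<noteq> \<infinity>"
    show "f \<omega> = 0"
    proof (rule ccontr)
      assume "f \<omega> \<noteq> 0"
      then have "filterlim (\<lambda>n. real n * \<bar>f \<omega>\<bar>) at_top sequentially"
        by (intro filterlim_at_top_mult_tendsto_pos[OF tendsto_const] filterlim_real_sequentially
            filterlim_tendsto_pos_mult_at_top) auto
      then show False using liminf_orlicz_eq_top[OF \<Phi>_orlicz[OF P]] * by blast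
    qed
  qed
qed

text \<open>The gap between the two scaling constants replaces the lower semicontinuity of \<open>\<Phi> P\<close>.\<close>

lemma lux_norm_fatou:
  assumes F: "\<And>n. F n \<in> borel_measurable M"
    and lim: "\<And>P. P \<in> PP \<Longrightarrow> AE \<omega> in P. (\<lambda>n. F n \<omega>) \<longlonglongrightarrow> f \<omega>"
    and le: "\<And>n. N (F n) \<le> b"
  shows "N f \<le> b"
proof (rule dense_ge)
  fix z assume "b < z"
  then obtain z1 where z1: "b < z1" "z1 < z" using dense by blast
  obtain z2 where z2: "b < z2" "z2 < z1" using dense[OF z1(1)] by blast
  obtain c1 c2 where c: "0 \<le> c1" "z1 = ennreal c1" "0 \<le> c2" "z2 = ennreal c2"
    using z1 z2 by (cases z1; cases z2) (auto simp: top_unique)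
  then have c12: "0 < c2" "c2 < c1" using z2 by (auto simp: ennreal_less_iff intro: le_less_trans[of 0] not_le_imp_less)
  have "N f \<le> ennreal c1"
  proof (rule lux_norm_le)
    fix P assume P: "P \<in> PP"
    have "AE \<omega> in P. \<Phi> P (inverse c1 * \<bar>f \<omega>\<bar>) \<le> liminf (\<lambda>n. \<Phi> P (inverse c2 * \<bar>F n \<omega>\<bar>))"
      using lim[OF P]
    proof (rule eventually_mono)
      fix \<omega> assume lim: "(\<lambda>n. F n \<omega>) \<longlonglongrightarrow> f \<omega>"
      show "\<Phi> P (inverse c1 * \<bar>f \<omega>\<bar>) \<le> liminf (\<lambda>n. \<Phi> P (inverse c2 * \<bar>F n \<omega>\<bar>))"
      proof (cases "f \<omega> = 0")
        case True then show ?thesis by (simp add: orlicz_zero[OF \<Phi>_orlicz[OF P]])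
      next
        case False
        have "(\<lambda>n. inverse c2 * \<bar>F n \<omega>\<bar>) \<longlonglongrightarrow> inverse c2 * \<bar>f \<omega>\<bar>" by (intro tendsto_intros lim)
        moreover have "inverse c1 * \<bar>f \<omega>\<bar> < inverse c2 * \<bar>f \<omega>\<bar>"
          using c12 False by (intro mult_strict_right_mono) auto
        ultimately have "eventually (\<lambda>n. inverse c1 * \<bar>f \<omega>\<bar> < inverse c2 * \<bar>F n \<omega>\<bar>) sequentially"
          by (rule order_tendstoD)
        then show ?thesis
          by (intro Liminf_bounded)
             (auto elim!: eventually_mono intro!: orlicz_mono[OF \<Phi>_orlicz[OF P]] simp: c)
      qed
    qed
    then have "(\<integral>\<^sup>+ \<omega>. \<Phi> P (inverse c1 * \<bar>f \<omega>\<bar>) \<partial>P) \<le> (\<integral>\<^sup>+ \<omega>. liminf (\<lambda>n. \<Phi> P (inverse c2 * \<bar>F n \<omega>\<bar>)) \<partial>P)"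
      by (rule nn_integral_mono_AE)
    also have "\<dots> \<le> liminf (\<lambda>n. \<integral>\<^sup>+ \<omega>. \<Phi> P (inverse c2 * \<bar>F n \<omega>\<bar>) \<partial>P)"
      using P F c by (intro nn_integral_liminf PP_measurable_\<Phi>) auto
    also have "\<dots> \<le> liminf (\<lambda>n. 1)"
      using le_less_trans[OF le z2(1)] P by (intro Liminf_mono always_eventually allI lux_norm_less) (auto simp: c)
    also have "\<dots> = 1" by (simp add: Liminf_const)
    finally show "(\<integral>\<^sup>+ \<omega>. \<Phi> P (inverse c1 * \<bar>f \<omega>\<bar>) \<partial>P) \<le> 1" .
  qed (use c12 in simp)
  then show "N f \<le> z" using z1 c by simp
qed

text \<open>The exact partial sum of the geometric series is kept as the bound, since the induction
  would not close with its limit \<open>2 * (1/2)^n\<close>.\<close>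

lemma lux_norm_sum_geometric:
  assumes [measurable]: "\<And>n. F n \<in> borel_measurable M" and "\<And>n. N (F n) \<le> ennreal ((1/2)^n)"
  shows "N (\<lambda>\<omega>. \<Sum>k<m. F (n + k) \<omega>) \<le> ennreal (2 * (1/2)^n * (1 - (1/2)^m))"
proof (induction m)
  case 0 then show ?case by (simp add: lux_norm_zero)
next
  case (Suc m)
  have "N (\<lambda>\<omega>. \<Sum>k<Suc m. F (n + k) \<omega>) \<le> N (\<lambda>\<omega>. \<Sum>k<m. F (n + k) \<omega>) + N (F (n + m))"
    unfolding sum.lessThan_Suc by (intro lux_norm_triangle) auto
  also have "\<dots> \<le> ennreal (2 * (1/2)^n * (1 - (1/2)^m)) + ennreal ((1/2)^(n + m))"
    using Suc assms(2) by (intro add_mono)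
  also have "\<dots> = ennreal (2 * (1/2)^n * (1 - (1/2)^m) + (1/2)^(n + m))"
    by (subst ennreal_plus) (auto simp: power_le_one)
  also have "2 * (1/2)^n * (1 - (1/2)^m) + (1/2)^(n + m) = 2 * (1/2::real)^n * (1 - (1/2)^(Suc m))"
    by (simp add: power_add algebra_simps)
  finally show ?case .
qed

text \<open>Along a sequence that is Cauchy with a geometric rate, the series of increments has a bounded
  modular; as \<open>\<Phi> P\<close> is unbounded, Fatou's lemma makes it absolutely convergent \<open>P\<close>-almost surely.\<close>

lemma lux_norm_complete:
  assumes F [measurable]: "\<And>n. F n \<in> borel_measurable M"
    and inc: "\<And>n. N (\<lambda>\<omega>. F (Suc n) \<omega> - F n \<omega>) \<le> ennreal ((1/2)^n)"
  obtains f where "f \<in> borel_measurable M"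
    "\<And>P. P \<in> PP \<Longrightarrow> AE \<omega> in P. (\<lambda>n. F n \<omega>) \<longlonglongrightarrow> f \<omega>"
    "\<And>n. N (\<lambda>\<omega>. f \<omega> - F n \<omega>) \<le> ennreal (2 * (1/2)^n)"
proof
  \<comment> \<open>Where the sequence diverges, \<open>lim\<close> takes an unspecified value;
    quasi-surely this does not happen.\<close>
  let ?f = "\<lambda>\<omega>. lim (\<lambda>n. F n \<omega>)"
  show "?f \<in> borel_measurable M" by (rule borel_measurable_lim_metric) simp
  define D where "D k \<omega> = \<bar>F (Suc k) \<omega> - F k \<omega>\<bar>" for k \<omega>
  have D [measurable]: "D k \<in> borel_measurable M" for k unfolding D_def by measurable
  define S where "S n \<omega> = (\<Sum>k<n. D (0 + k) \<omega>)" for n \<omega>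
  have S [measurable]: "S n \<in> borel_measurable M" for n unfolding S_def by measurable
  have S_nonneg: "0 \<le> S n \<omega>" for n \<omega> by (auto simp: S_def D_def intro: sum_nonneg)
  have S_mono: "S m \<omega> \<le> S n \<omega>" if "m \<le> n" for m n \<omega>
    using that unfolding S_def by (intro sum_mono2) (auto simp: D_def)
  have ND: "N (D k) \<le> ennreal ((1/2)^k)" for k
    unfolding D_def using inc by simp
  show lim: "AE \<omega> in P. (\<lambda>n. F n \<omega>) \<longlonglongrightarrow> ?f \<omega>" if P: "P \<in> PP" for P
  proof -
    \<comment> \<open>The geometric bounds add up to at most 2; the constant 3 leaves room for the
      strict inequality that \<open>lux_norm_less\<close> asks for.\<close>
    have "N (S n) < ennreal 3" for n
    proof -
      have "N (S n) \<le> ennreal (2 * (1/2)^0 * (1 - (1/2)^n))"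
        unfolding S_def using D ND by (rule lux_norm_sum_geometric)
      also have "\<dots> < ennreal 3"
      proof -
        define x :: real where "x = (1/2)^n"
        have "0 < x" by (simp add: x_def)
        then show "ennreal (2 * (1/2)^0 * (1 - (1/2)^n)) < ennreal 3"
          unfolding power_0 x_def[symmetric] by (intro ennreal_lessI) auto
      qed
      finally show ?thesis .
    qed
    from lux_norm_less[OF this P] P have "AE \<omega> in P. liminf (\<lambda>n. \<Phi> P (inverse 3 * \<bar>S n \<omega>\<bar>)) \<noteq> \<infinity>"
      by (intro AE_liminf_less_top) auto
    then show ?thesis
    proof (rule eventually_mono)
      fix \<omega> assume *: "liminf (\<lambda>n. \<Phi> P (inverse 3 * \<bar>S n \<omega>\<bar>)) \<noteq> \<infinity>"
      have "\<exists>B. \<forall>n. S n \<omega> \<le> B"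
      proof (rule ccontr)
        assume unb: "\<nexists>B. \<forall>n. S n \<omega> \<le> B"
        have "filterlim (\<lambda>n. inverse 3 * \<bar>S n \<omega>\<bar>) at_top sequentially"
          unfolding filterlim_at_top
        proof
          fix Z :: real
          obtain n0 where n0: "3 * Z < S n0 \<omega>" using unb by (meson not_le)
          have "Z \<le> inverse 3 * \<bar>S n \<omega>\<bar>" if "n \<ge> n0" for n
            using n0 S_mono[OF that, of \<omega>] S_nonneg[of n \<omega>] by auto
          then show "\<forall>\<^sub>F n in sequentially. Z \<le> inverse 3 * \<bar>S n \<omega>\<bar>"
            by (rule eventually_sequentiallyI)
        qed
        then show False using liminf_orlicz_eq_top[OF \<Phi>_orlicz[OF P]] * by blast
      qed
      then obtain B where B: "S n \<omega> \<le> B" for n by blast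
      have "summable (\<lambda>k. \<bar>F (Suc k) \<omega> - F k \<omega>\<bar>)"
        by (rule bounded_imp_summable[of _ B])
           (use B[of "Suc _"] in \<open>auto simp: S_def D_def lessThan_Suc_atMost\<close>)
      then have "summable (\<lambda>k. F (Suc k) \<omega> - F k \<omega>)" by (rule summable_rabs_cancel)
      then have "convergent (\<lambda>n. \<Sum>k<n. F (Suc k) \<omega> - F k \<omega>)" by (simp add: summable_iff_convergent)
      then have "convergent (\<lambda>n. F n \<omega> - F 0 \<omega>)"
        unfolding sum_lessThan_telescope[of "\<lambda>k. F k \<omega>"] .
      then have "convergent (\<lambda>n. F n \<omega>)" by (simp add: convergent_diff_const_right_iff)
      then show "(\<lambda>n. F n \<omega>) \<longlonglongrightarrow> ?f \<omega>" by (simp add: convergent_LIMSEQ_iff)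
    qed
  qed
  show "N (\<lambda>\<omega>. ?f \<omega> - F n \<omega>) \<le> ennreal (2 * (1/2)^n)" for n
  \<comment> \<open>The bound on \<open>F (m + n) - F n\<close> is uniform in \<open>m\<close> and
    survives the limit in \<open>m\<close> by the Fatou property of the norm.\<close>
  proof (rule lux_norm_fatou)
    fix m
    have "(\<lambda>\<omega>. F (m + n) \<omega> - F n \<omega>) = (\<lambda>\<omega>. \<Sum>k<m. F (Suc (n + k)) \<omega> - F (n + k) \<omega>)"
      using sum_lessThan_telescope[of "\<lambda>k. F (n + k) _" m] by (auto simp: add.commute)
    then have "N (\<lambda>\<omega>. F (m + n) \<omega> - F n \<omega>) \<le> ennreal (2 * (1/2)^n * (1 - (1/2)^m))"
      using lux_norm_sum_geometric[of "\<lambda>k \<omega>. F (Suc k) \<omega> - F k \<omega>" n m] inc by simp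
    also have "\<dots> \<le> ennreal (2 * (1/2)^n)" by (intro ennreal_leI) (auto simp: mult_le_cancel_left1)
    finally show "N (\<lambda>\<omega>. F (m + n) \<omega> - F n \<omega>) \<le> ennreal (2 * (1/2)^n)" .
  next
    fix P assume "P \<in> PP"
    from lim[OF this] show "AE \<omega> in P. (\<lambda>m. F (m + n) \<omega> - F n \<omega>) \<longlonglongrightarrow> ?f \<omega> - F n \<omega>"
      by (rule eventually_mono) (intro tendsto_intros LIMSEQ_ignore_initial_segment)
  qed simp
qed

section \<open>Classes and their representatives\<close>

abbreviation cls :: "('a \<Rightarrow> real) \<Rightarrow> ('a \<Rightarrow> real) set" where "cls \<equiv> qs_class M PP"

abbreviation Lat :: "('a \<Rightarrow> real) set set \<Rightarrow> ('a \<Rightarrow> real) set nvl" where "Lat \<equiv> space_on M PP \<Phi>"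

definition funs :: "('a \<Rightarrow> real) set set \<Rightarrow> ('a \<Rightarrow> real) set" where
  "funs S = {f \<in> borel_measurable M. cls f \<in> S}"

lemma funsD [dest]: "f \<in> funs S \<Longrightarrow> f \<in> borel_measurable M" "f \<in> funs S \<Longrightarrow> cls f \<in> S"
  by (auto simp: funs_def)

lemma cls_eq_iff:
  assumes "f \<in> borel_measurable M" "g \<in> borel_measurable M"
  shows "cls f = cls g \<longleftrightarrow> (\<forall>P\<in>PP. AE \<omega> in P. f \<omega> = g \<omega>)"
proof
  assume "cls f = cls g"
  then have "g \<in> cls f" using assms by (auto simp: qs_class_def)
  then show "\<forall>P\<in>PP. AE \<omega> in P. f \<omega> = g \<omega>" by (auto simp: qs_class_def)
next
  assume eq: "\<forall>P\<in>PP. AE \<omega> in P. f \<omega> = g \<omega>"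
  have "(AE \<omega> in P. f \<omega> = h \<omega>) \<longleftrightarrow> (AE \<omega> in P. g \<omega> = h \<omega>)" if "P \<in> PP" for P h
    using eq that by (intro eventually_cong) auto
  then show "cls f = cls g" by (auto simp: qs_class_def)
qed

lemma cls_cong: "(\<And>P. P \<in> PP \<Longrightarrow> AE \<omega> in P. f \<omega> = g \<omega>) \<Longrightarrow>
    f \<in> borel_measurable M \<Longrightarrow> g \<in> borel_measurable M \<Longrightarrow> cls f = cls g"
  by (simp add: cls_eq_iff)

lemma mem_clsD:
  assumes "g \<in> cls f" shows "g \<in> borel_measurable M" "P \<in> PP \<Longrightarrow> AE \<omega> in P. f \<omega> = g \<omega>"
  using assms by (auto simp: qs_class_def)

lemma rep_mem_cls: "f \<in> borel_measurable M \<Longrightarrow> rep (cls f) \<in> cls f"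
  unfolding rep_def by (rule someI[of _ f]) (simp add: qs_class_def)

lemma rep_cls_measurable [measurable]: "f \<in> borel_measurable M \<Longrightarrow> rep (cls f) \<in> borel_measurable M"
  using rep_mem_cls mem_clsD by blast

lemma rep_cls_AE: "f \<in> borel_measurable M \<Longrightarrow> P \<in> PP \<Longrightarrow> AE \<omega> in P. f \<omega> = rep (cls f) \<omega>"
  using rep_mem_cls mem_clsD by blast

lemma L0_cases:
  assumes "X \<in> S" "S \<subseteq> L0 M PP" obtains f where "f \<in> funs S" "X = cls f"
  using assms unfolding L0_def funs_def by blast

lemma qs_le_cls:
  assumes f: "f \<in> borel_measurable M" and g: "g \<in> borel_measurable M"
  shows "qs_le PP (cls f) (cls g) \<longleftrightarrow> (\<forall>P\<in>PP. AE \<omega> in P. f \<omega> \<le> g \<omega>)"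
proof
  show "qs_le PP (cls f) (cls g) \<Longrightarrow> \<forall>P\<in>PP. AE \<omega> in P. f \<omega> \<le> g \<omega>"
    using f g by (auto simp: qs_le_def qs_class_def)
next
  assume le: "\<forall>P\<in>PP. AE \<omega> in P. f \<omega> \<le> g \<omega>"
  show "qs_le PP (cls f) (cls g)"
    unfolding qs_le_def
  proof (intro ballI)
    fix P f' g' assume "P \<in> PP" "f' \<in> cls f" "g' \<in> cls g"
    then have "AE \<omega> in P. f \<omega> \<le> g \<omega>" "AE \<omega> in P. f \<omega> = f' \<omega>" "AE \<omega> in P. g \<omega> = g' \<omega>"
      using le by (auto dest: mem_clsD)
    then show "AE \<omega> in P. f' \<omega> \<le> g' \<omega>" by eventually_elim simp
  qed
qed

lemma orlicz_norm_cls: "f \<in> borel_measurable M \<Longrightarrow> orlicz_norm PP \<Phi> (cls f) = N f"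
  using lux_norm_cong[OF rep_cls_AE, of f] by (simp add: orlicz_norm_def lux_norm_def)

lemma space_on_simps [simp]:
  "carrier (Lat S) = S" "le (Lat S) = qs_le PP" "eq (Lat S) = (=)"
  "vzero (Lat S) = cls (\<lambda>_. 0)"
  by (simp_all add: space_on_def)

lemma vadd_cls:
  assumes [measurable]: "f \<in> borel_measurable M" "g \<in> borel_measurable M"
  shows "vadd (Lat S) (cls f) (cls g) = cls (\<lambda>\<omega>. f \<omega> + g \<omega>)"
proof -
  have "AE \<omega> in P. rep (cls f) \<omega> + rep (cls g) \<omega> = f \<omega> + g \<omega>" if "P \<in> PP" for P
    using rep_cls_AE[OF assms(1) that] rep_cls_AE[OF assms(2) that] by eventually_elim simp
  from cls_cong[OF this] show ?thesis by (simp add: space_on_def)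
qed

lemma vscale_cls:
  assumes [measurable]: "f \<in> borel_measurable M"
  shows "vscale (Lat S) a (cls f) = cls (\<lambda>\<omega>. a * f \<omega>)"
proof -
  have "AE \<omega> in P. a * rep (cls f) \<omega> = a * f \<omega>" if "P \<in> PP" for P
    using rep_cls_AE[OF assms(1) that] by eventually_elim simp
  from cls_cong[OF this] show ?thesis by (simp add: space_on_def)
qed

text \<open>If \<open>N f = \<infinity>\<close> then \<open>nrm f = 0\<close>, so \<open>nrm\<close> is meaningful on \<open>L\<^sup>\<Phi>\<close> only.\<close>

definition nrm :: "('a \<Rightarrow> real) \<Rightarrow> real" where "nrm f = enn2real (N f)"

lemma vnorm_cls: "f \<in> borel_measurable M \<Longrightarrow> vnorm (Lat S) (cls f) = nrm f"
  by (simp add: space_on_def orlicz_norm_cls nrm_def)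

section \<open>Functions of finite norm\<close>

abbreviation FL :: "('a \<Rightarrow> real) set" where "FL \<equiv> funs (LPhi M PP \<Phi>)"

lemma FL_iff: "f \<in> FL \<longleftrightarrow> f \<in> borel_measurable M \<and> N f < \<infinity>"
  by (auto simp: funs_def LPhi_def L0_def orlicz_norm_cls)

lemma LPhi_subset_L0: "LPhi M PP \<Phi> \<subseteq> L0 M PP"
  by (auto simp: LPhi_def)

lemma nrm_nonneg [simp]: "0 \<le> nrm f"
  by (simp add: nrm_def)

lemma ennreal_nrm: "f \<in> FL \<Longrightarrow> ennreal (nrm f) = N f"
  by (simp add: nrm_def FL_iff)

lemma FL_le:
  assumes "f \<in> borel_measurable M" "N f \<le> N g" "g \<in> FL"
  shows "f \<in> FL" "nrm f \<le> nrm g"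
  using assms by (auto simp: FL_iff nrm_def intro: le_less_trans intro!: enn2real_mono)

lemma FL_mono:
  assumes "f \<in> borel_measurable M" "g \<in> FL" "\<And>P. P \<in> PP \<Longrightarrow> AE \<omega> in P. \<bar>f \<omega>\<bar> \<le> \<bar>g \<omega>\<bar>"
  shows "f \<in> FL" "nrm f \<le> nrm g"
  using FL_le[OF assms(1) lux_norm_mono assms(2)] assms(3) by auto

lemma FL_bound:
  assumes "f \<in> borel_measurable M" "N f \<le> ennreal c" "0 \<le> c"
  shows "f \<in> FL" "nrm f \<le> c"
  using assms by (auto simp: FL_iff nrm_def intro: le_less_trans intro!: enn2real_leI)

lemma FL_zero: "(\<lambda>_. 0) \<in> FL"
  by (simp add: FL_iff lux_norm_zero)

lemma FL_add:
  assumes "f \<in> FL" "g \<in> FL"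
  shows "(\<lambda>\<omega>. f \<omega> + g \<omega>) \<in> FL" "nrm (\<lambda>\<omega>. f \<omega> + g \<omega>) \<le> nrm f + nrm g"
proof -
  note [measurable] = assms[THEN funsD(1)]
  have "N (\<lambda>\<omega>. f \<omega> + g \<omega>) \<le> N f + N g" by (intro lux_norm_triangle) auto
  also have "\<dots> = ennreal (nrm f + nrm g)" using assms by (simp add: ennreal_nrm)
  finally have "N (\<lambda>\<omega>. f \<omega> + g \<omega>) \<le> ennreal (nrm f + nrm g)" .
  from FL_bound[OF _ this] show "(\<lambda>\<omega>. f \<omega> + g \<omega>) \<in> FL" "nrm (\<lambda>\<omega>. f \<omega> + g \<omega>) \<le> nrm f + nrm g"
    by simp_all
qed

lemma FL_scale:
  assumes "f \<in> FL" shows "(\<lambda>\<omega>. c * f \<omega>) \<in> FL" "nrm (\<lambda>\<omega>. c * f \<omega>) = \<bar>c\<bar> * nrm f"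
  using assms by (auto simp: FL_iff nrm_def lux_norm_scale enn2real_mult ennreal_mult_less_top)

lemma FL_diff:
  assumes "f \<in> FL" "g \<in> FL"
  shows "(\<lambda>\<omega>. f \<omega> - g \<omega>) \<in> FL" "nrm (\<lambda>\<omega>. f \<omega> - g \<omega>) \<le> nrm f + nrm g"
  using FL_add[OF assms(1) FL_scale(1)[OF assms(2), of "-1"]] FL_scale(2)[OF assms(2), of "-1"] by auto

lemma FL_abs: "f \<in> FL \<Longrightarrow> (\<lambda>\<omega>. \<bar>f \<omega>\<bar>) \<in> FL" "nrm (\<lambda>\<omega>. \<bar>f \<omega>\<bar>) = nrm f"
  by (auto simp: FL_iff nrm_def)

lemma FL_max:
  assumes "f \<in> FL" "g \<in> FL" shows "(\<lambda>\<omega>. max (f \<omega>) (g \<omega>)) \<in> FL"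
proof (rule FL_mono)
  have [measurable]: "f \<in> borel_measurable M" "g \<in> borel_measurable M" using assms by auto
  show "(\<lambda>\<omega>. max (f \<omega>) (g \<omega>)) \<in> borel_measurable M" by measurable
  show "(\<lambda>\<omega>. \<bar>f \<omega>\<bar> + \<bar>g \<omega>\<bar>) \<in> FL" using assms by (intro FL_add FL_abs)
qed auto

lemma nrm_diff_commute: "nrm (\<lambda>\<omega>. f \<omega> - g \<omega>) = nrm (\<lambda>\<omega>. g \<omega> - f \<omega>)"
  by (simp add: nrm_def lux_norm_diff_commute[of f g])

lemma nrm_diff_triangle:
  assumes "f \<in> FL" "g \<in> FL" "h \<in> FL"
  shows "nrm (\<lambda>\<omega>. f \<omega> - h \<omega>) \<le> nrm (\<lambda>\<omega>. f \<omega> - g \<omega>) + nrm (\<lambda>\<omega>. g \<omega> - h \<omega>)"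
  using FL_add(2)[OF FL_diff(1)[OF assms(1,2)] FL_diff(1)[OF assms(2,3)]] by simp

lemma nrm_eq_0_iff:
  assumes "f \<in> FL" shows "nrm f = 0 \<longleftrightarrow> cls f = cls (\<lambda>_. 0)"
proof
  assume "nrm f = 0"
  then have "N f = 0" using ennreal_nrm[OF assms] by simp
  then show "cls f = cls (\<lambda>_. 0)"
    using assms lux_norm_eq_0[of f] by (intro cls_cong) auto
next
  assume "cls f = cls (\<lambda>_. 0)"
  then have "N f = N (\<lambda>_. 0)" using assms by (intro lux_norm_cong) (auto simp: cls_eq_iff)
  then show "nrm f = 0" by (simp add: nrm_def lux_norm_zero)
qed

section \<open>Vector sublattices of the robust Orlicz space\<close>

text \<open>Vector sublattices of \<open>LPhi M PP \<Phi>\<close> in terms of representatives;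
  closure under minima follows from that under maxima and negation.\<close>

definition sublat :: "('a \<Rightarrow> real) set set \<Rightarrow> bool" where
  "sublat S \<longleftrightarrow> S \<subseteq> LPhi M PP \<Phi> \<and> (\<lambda>_. 0) \<in> funs S \<and>
     (\<forall>f\<in>funs S. \<forall>g\<in>funs S. (\<lambda>\<omega>. f \<omega> + g \<omega>) \<in> funs S \<and> (\<lambda>\<omega>. max (f \<omega>) (g \<omega>)) \<in> funs S) \<and>
     (\<forall>f\<in>funs S. \<forall>c. (\<lambda>\<omega>. c * f \<omega>) \<in> funs S)"

lemma sublat_LPhi: "sublat (LPhi M PP \<Phi>)"
  unfolding sublat_def by (intro conjI ballI allI FL_zero FL_add FL_max FL_scale order_refl)

context
  fixes S :: "('a \<Rightarrow> real) set set"
  assumes S: "sublat S"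
begin

lemma sublat_subset_L0: "S \<subseteq> L0 M PP"
  using S LPhi_subset_L0 by (auto simp: sublat_def)

lemma sublat_cases: assumes "X \<in> S" obtains f where "f \<in> funs S" "X = cls f"
  using L0_cases[OF assms sublat_subset_L0] .

lemma sublat_FL [intro]: "f \<in> funs S \<Longrightarrow> f \<in> FL"
  using S by (auto simp: sublat_def funs_def)

lemma sublat_closed:
  "(\<lambda>_. 0) \<in> funs S"
  "f \<in> funs S \<Longrightarrow> g \<in> funs S \<Longrightarrow> (\<lambda>\<omega>. f \<omega> + g \<omega>) \<in> funs S"
  "f \<in> funs S \<Longrightarrow> g \<in> funs S \<Longrightarrow> (\<lambda>\<omega>. max (f \<omega>) (g \<omega>)) \<in> funs S"
  "f \<in> funs S \<Longrightarrow> (\<lambda>\<omega>. c * f \<omega>) \<in> funs S"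
  using S by (auto simp: sublat_def)

lemma sublat_uminus: "f \<in> funs S \<Longrightarrow> (\<lambda>\<omega>. - f \<omega>) \<in> funs S"
  using sublat_closed(4)[of f "-1"] by simp

lemma sublat_diff: "f \<in> funs S \<Longrightarrow> g \<in> funs S \<Longrightarrow> (\<lambda>\<omega>. f \<omega> - g \<omega>) \<in> funs S"
  using sublat_closed(2)[of f "\<lambda>\<omega>. - g \<omega>"] sublat_uminus[of g] by simp

lemma sublat_min: "f \<in> funs S \<Longrightarrow> g \<in> funs S \<Longrightarrow> (\<lambda>\<omega>. min (f \<omega>) (g \<omega>)) \<in> funs S"
  using sublat_uminus[OF sublat_closed(3)[OF sublat_uminus[of f] sublat_uminus[of g]]]
  by (simp add: minus_max_eq_min)

lemma sublat_abs: assumes "f \<in> funs S" shows "(\<lambda>\<omega>. \<bar>f \<omega>\<bar>) \<in> funs S"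
proof -
  have "(\<lambda>\<omega>. max (f \<omega>) (- f \<omega>)) = (\<lambda>\<omega>. \<bar>f \<omega>\<bar>)" by (auto simp: max_def)
  then show ?thesis using sublat_closed(3)[OF assms sublat_uminus[OF assms]] by simp
qed

lemma partial_order_space_on: "partial_order (Lat S)"
proof
  fix x y z assume "x \<in> carrier (Lat S)" "y \<in> carrier (Lat S)" "z \<in> carrier (Lat S)"
  then obtain f g h where "f \<in> funs S" "g \<in> funs S" "h \<in> funs S" and xyz: "x = cls f" "y = cls g" "z = cls h"
    by (auto elim!: sublat_cases)
  then have [measurable]: "f \<in> borel_measurable M" "g \<in> borel_measurable M" "h \<in> borel_measurable M" by auto
  assume le: "x \<sqsubseteq>\<^bsub>Lat S\<^esub> y" "y \<sqsubseteq>\<^bsub>Lat S\<^esub> z"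
  have "AE \<omega> in P. f \<omega> \<le> h \<omega>" if "P \<in> PP" for P
  proof -
    have "AE \<omega> in P. f \<omega> \<le> g \<omega>" "AE \<omega> in P. g \<omega> \<le> h \<omega>" using le that by (auto simp: xyz qs_le_cls)
    then show ?thesis by eventually_elim simp
  qed
  then show "x \<sqsubseteq>\<^bsub>Lat S\<^esub> z" by (simp add: xyz qs_le_cls)
next
  fix x y assume "x \<in> carrier (Lat S)" "y \<in> carrier (Lat S)"
  then obtain f g where "f \<in> funs S" "g \<in> funs S" and xy: "x = cls f" "y = cls g"
    by (auto elim!: sublat_cases)
  then have [measurable]: "f \<in> borel_measurable M" "g \<in> borel_measurable M" by auto
  assume le: "x \<sqsubseteq>\<^bsub>Lat S\<^esub> y" "y \<sqsubseteq>\<^bsub>Lat S\<^esub> x"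
  have "AE \<omega> in P. f \<omega> = g \<omega>" if "P \<in> PP" for P
  proof -
    have "AE \<omega> in P. f \<omega> \<le> g \<omega>" "AE \<omega> in P. g \<omega> \<le> f \<omega>" using le that by (auto simp: xy qs_le_cls)
    then show ?thesis by eventually_elim simp
  qed
  then show "x .=\<^bsub>Lat S\<^esub> y" by (simp add: xy cls_eq_iff)
next
  fix x assume "x \<in> carrier (Lat S)"
  then obtain f where "f \<in> funs S" "x = cls f" by (auto elim!: sublat_cases)
  then show "x \<sqsubseteq>\<^bsub>Lat S\<^esub> x" by (auto simp: qs_le_cls)
qed auto

lemma least_cls_max:
  assumes f: "f \<in> funs S" and g: "g \<in> funs S"
  shows "least (Lat S) (cls (\<lambda>\<omega>. max (f \<omega>) (g \<omega>))) (Upper (Lat S) {cls f, cls g})"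
proof -
  note [measurable] = funsD(1)[OF f] funsD(1)[OF g]
  have "qs_le PP (cls (\<lambda>\<omega>. max (f \<omega>) (g \<omega>))) z"
    if z: "z \<in> S" "qs_le PP (cls f) z" "qs_le PP (cls g) z" for z
  proof -
    obtain h where h: "h \<in> funs S" "z = cls h" using sublat_cases[OF z(1)] .
    note [measurable] = funsD(1)[OF h(1)]
    have "AE \<omega> in P. max (f \<omega>) (g \<omega>) \<le> h \<omega>" if "P \<in> PP" for P
    proof -
      have "AE \<omega> in P. f \<omega> \<le> h \<omega>" "AE \<omega> in P. g \<omega> \<le> h \<omega>" using z that h by (auto simp: qs_le_cls)
      then show ?thesis by eventually_elim simp
    qed
    then show ?thesis by (simp add: h(2) qs_le_cls)
  qed
  then show ?thesis
    using sublat_closed(3)[OF f g] f g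
    by (auto simp: least_def Upper_def qs_le_cls)
qed

lemma greatest_cls_min:
  assumes f: "f \<in> funs S" and g: "g \<in> funs S"
  shows "greatest (Lat S) (cls (\<lambda>\<omega>. min (f \<omega>) (g \<omega>))) (Lower (Lat S) {cls f, cls g})"
proof -
  note [measurable] = funsD(1)[OF f] funsD(1)[OF g]
  have "qs_le PP z (cls (\<lambda>\<omega>. min (f \<omega>) (g \<omega>)))"
    if z: "z \<in> S" "qs_le PP z (cls f)" "qs_le PP z (cls g)" for z
  proof -
    obtain h where h: "h \<in> funs S" "z = cls h" using sublat_cases[OF z(1)] .
    note [measurable] = funsD(1)[OF h(1)]
    have "AE \<omega> in P. h \<omega> \<le> min (f \<omega>) (g \<omega>)" if "P \<in> PP" for P
    proof -
      have "AE \<omega> in P. h \<omega> \<le> f \<omega>" "AE \<omega> in P. h \<omega> \<le> g \<omega>" using z that h by (auto simp: qs_le_cls)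
      then show ?thesis by eventually_elim simp
    qed
    then show ?thesis by (simp add: h(2) qs_le_cls)
  qed
  then show ?thesis
    using sublat_min[OF f g] f g
    by (auto simp: greatest_def Lower_def qs_le_cls)
qed

lemma lattice_space_on: "lattice (Lat S)"
proof -
  interpret partial_order "Lat S" by (rule partial_order_space_on)
  show ?thesis
  proof
    fix x y assume "x \<in> carrier (Lat S)" "y \<in> carrier (Lat S)"
    then obtain f g where "f \<in> funs S" "g \<in> funs S" "x = cls f" "y = cls g"
      by (auto elim!: sublat_cases)
    then show "\<exists>s. least (Lat S) s (Upper (Lat S) {x, y})" "\<exists>s. greatest (Lat S) s (Lower (Lat S) {x, y})"
      using least_cls_max greatest_cls_min by blast+
  qed
qed

lemma join_cls:
  assumes "f \<in> funs S" "g \<in> funs S"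
  shows "cls f \<squnion>\<^bsub>Lat S\<^esub> cls g = cls (\<lambda>\<omega>. max (f \<omega>) (g \<omega>))"
proof -
  interpret partial_order "Lat S" by (rule partial_order_space_on)
  show ?thesis
    unfolding join_def sup_def
    by (rule some_equality, rule least_cls_max[OF assms], rule least_unique[OF _ least_cls_max[OF assms]])
qed

lemma vabs_cls:
  assumes "f \<in> funs S" shows "vabs (Lat S) (cls f) = cls (\<lambda>\<omega>. \<bar>f \<omega>\<bar>)"
proof -
  have "(\<lambda>\<omega>. max (f \<omega>) (- f \<omega>)) = (\<lambda>\<omega>. \<bar>f \<omega>\<bar>)" by (auto simp: max_def)
  then show ?thesis
    using join_cls[OF assms sublat_closed(4)[OF assms, of "-1"]] assms
    by (simp add: vabs_def vscale_cls funsD)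
qed

lemma vector_lattice_space_on: "vector_lattice (Lat S)"
proof -
  show ?thesis
  proof (rule vector_lattice.intro[OF lattice_space_on], rule vector_lattice_axioms.intro)
    show "comm_group \<lparr>carrier = carrier (Lat S), mult = vadd (Lat S), one = vzero (Lat S)\<rparr>"
    proof (rule comm_groupI, simp_all)
      fix x y z assume "x \<in> S" "y \<in> S" "z \<in> S"
      then obtain f g h where *: "f \<in> funs S" "g \<in> funs S" "h \<in> funs S" and xyz: "x = cls f" "y = cls g" "z = cls h"
        by (auto elim!: sublat_cases)
      note [measurable] = *[THEN funsD(1)]
      show "vadd (Lat S) (vadd (Lat S) x y) z = vadd (Lat S) x (vadd (Lat S) y z)"
        by (simp add: xyz vadd_cls add.assoc)
    next
      fix x y assume "x \<in> S" "y \<in> S"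
      then obtain f g where *: "f \<in> funs S" "g \<in> funs S" and xy: "x = cls f" "y = cls g"
        by (auto elim!: sublat_cases)
      note [measurable] = *[THEN funsD(1)]
      show "vadd (Lat S) x y \<in> S" using sublat_closed(2)[OF *] by (simp add: xy vadd_cls funsD)
      show "vadd (Lat S) x y = vadd (Lat S) y x" by (simp add: xy vadd_cls add.commute)
    next
      fix x assume "x \<in> S"
      then obtain f where f: "f \<in> funs S" "x = cls f" by (auto elim!: sublat_cases)
      note [measurable] = funsD(1)[OF f(1)]
      show "vadd (Lat S) (cls (\<lambda>_. 0)) x = x" by (simp add: f vadd_cls)
      show "\<exists>y\<in>S. vadd (Lat S) y x = cls (\<lambda>_. 0)"
        using sublat_uminus[OF f(1)] by (intro bexI[of _ "cls (\<lambda>\<omega>. - f \<omega>)"]) (auto simp: f vadd_cls)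
    next
      show "cls (\<lambda>_. 0) \<in> S" using sublat_closed(1) by auto
    qed
  next
    fix x y z a assume "x \<in> carrier (Lat S)" "y \<in> carrier (Lat S)" "z \<in> carrier (Lat S)"
    then obtain f g h where *: "f \<in> funs S" "g \<in> funs S" "h \<in> funs S" and xyz: "x = cls f" "y = cls g" "z = cls h"
      by (auto elim!: sublat_cases)
    note [measurable] = *[THEN funsD(1)]
    assume le: "x \<sqsubseteq>\<^bsub>Lat S\<^esub> y"
    show "vadd (Lat S) x z \<sqsubseteq>\<^bsub>Lat S\<^esub> vadd (Lat S) y z"
      using le by (simp add: xyz vadd_cls qs_le_cls)
  next
    fix x y and a :: real assume "x \<in> carrier (Lat S)" "y \<in> carrier (Lat S)"
    then obtain f g where *: "f \<in> funs S" "g \<in> funs S" and xy: "x = cls f" "y = cls g"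
      by (auto elim!: sublat_cases)
    note [measurable] = *[THEN funsD(1)]
    show "vscale (Lat S) a (vadd (Lat S) x y) = vadd (Lat S) (vscale (Lat S) a x) (vscale (Lat S) a y)"
      by (simp add: xy vscale_cls vadd_cls distrib_left)
    assume "0 \<le> a" "x \<sqsubseteq>\<^bsub>Lat S\<^esub> y"
    then show "vscale (Lat S) a x \<sqsubseteq>\<^bsub>Lat S\<^esub> vscale (Lat S) a y"
      by (auto simp: xy vscale_cls qs_le_cls elim!: eventually_mono dest!: bspec intro!: mult_left_mono)
  next
    fix x and a b :: real assume "x \<in> carrier (Lat S)"
    then obtain f where f: "f \<in> funs S" "x = cls f" by (auto elim!: sublat_cases)
    note [measurable] = funsD(1)[OF f(1)]
    show "vscale (Lat S) a x \<in> carrier (Lat S)"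
      using sublat_closed(4)[OF f(1)] by (simp add: f vscale_cls funsD)
    show "vscale (Lat S) (a + b) x = vadd (Lat S) (vscale (Lat S) a x) (vscale (Lat S) b x)"
      by (simp add: f vscale_cls vadd_cls distrib_right)
    show "vscale (Lat S) a (vscale (Lat S) b x) = vscale (Lat S) (a * b) x"
      by (simp add: f vscale_cls mult.assoc)
    show "vscale (Lat S) 1 x = x" by (simp add: f vscale_cls)
  qed
qed

section \<open>The norm topology of a sublattice\<close>

lemma vdist_cls:
  assumes "f \<in> funs S" "g \<in> funs S" shows "vdist (Lat S) (cls f) (cls g) = nrm (\<lambda>\<omega>. f \<omega> - g \<omega>)"
proof -
  note [measurable] = assms[THEN funsD(1)]
  show ?thesis using assms[THEN funsD(2)] by (simp add: vdist_def vscale_cls vadd_cls vnorm_cls)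
qed

lemma Metric_space_space_on: "Metric_space S (vdist (Lat S))"
proof
  fix x y :: "('a \<Rightarrow> real) set"
  show "0 \<le> vdist (Lat S) x y" by (simp add: vdist_def space_on_def)
  show "vdist (Lat S) x y = vdist (Lat S) y x"
  proof (cases "x \<in> S \<and> y \<in> S")
    case True
    then obtain f g where "f \<in> funs S" "g \<in> funs S" "x = cls f" "y = cls g" by (auto elim!: sublat_cases)
    then show ?thesis by (simp add: vdist_cls nrm_diff_commute[of f g])
  qed (auto simp: vdist_def)
next
  fix x y assume "x \<in> S" "y \<in> S"
  then obtain f g where *: "f \<in> funs S" "g \<in> funs S" "x = cls f" "y = cls g" by (auto elim!: sublat_cases)
  note [measurable] = *(1,2)[THEN funsD(1)]
  from * show "vdist (Lat S) x y = 0 \<longleftrightarrow> x = y"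
    using nrm_eq_0_iff[OF sublat_FL[OF sublat_diff[of f g]]]
    by (simp add: vdist_cls cls_eq_iff funsD)
next
  fix x y z assume "x \<in> S" "y \<in> S" "z \<in> S"
  then obtain f g h where *: "f \<in> funs S" "g \<in> funs S" "h \<in> funs S" "x = cls f" "y = cls g" "z = cls h"
    by (auto elim!: sublat_cases)
  then show "vdist (Lat S) x z \<le> vdist (Lat S) x y + vdist (Lat S) y z"
    by (simp add: vdist_cls nrm_diff_triangle sublat_FL)
qed

lemma continuous_map_iff_bounded:
  assumes l_add: "\<And>f g. f \<in> funs S \<Longrightarrow> g \<in> funs S \<Longrightarrow> l (cls (\<lambda>\<omega>. f \<omega> + g \<omega>)) = l (cls f) + l (cls g)"
    and l_scale: "\<And>f c. f \<in> funs S \<Longrightarrow> l (cls (\<lambda>\<omega>. c * f \<omega>)) = c * l (cls f)"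
  shows "continuous_map (norm_topology (Lat S)) euclideanreal l \<longleftrightarrow>
    (\<exists>K. \<forall>f\<in>funs S. \<bar>l (cls f)\<bar> \<le> K * nrm f)"
proof -
  interpret Metric_space S "vdist (Lat S)" by (rule Metric_space_space_on)
  have top: "norm_topology (Lat S) = mtopology" by (simp add: norm_topology_def)
  have l_zero: "l (cls (\<lambda>_. 0)) = 0" using l_scale[OF sublat_closed(1), of 0] by simp
  have l_diff: "l (cls (\<lambda>\<omega>. f \<omega> - g \<omega>)) = l (cls f) - l (cls g)" if "f \<in> funs S" "g \<in> funs S" for f g
    using l_add[OF that(1) sublat_closed(4)[OF that(2), of "-1"]] l_scale[OF that(2), of "-1"] by simp
  show ?thesis
    unfolding top continuous_map_from_metric
  proof safe
    assume "\<forall>a\<in>S. \<forall>U. openin euclideanreal U \<and> l a \<in> U \<longrightarrow> (\<exists>r>0. \<forall>x. x \<in> S \<and> vdist (Lat S) a x < r \<longrightarrow> l x \<in> U)"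
    from this[rule_format, of "cls (\<lambda>_. 0)" "ball 0 1"] sublat_closed(1)
    obtain r where r: "0 < r" and ball: "\<And>x. x \<in> S \<Longrightarrow> vdist (Lat S) (cls (\<lambda>_. 0)) x < r \<Longrightarrow> l x \<in> ball 0 1"
      by (auto simp: l_zero)
    have "\<bar>l (cls f)\<bar> \<le> inverse r * nrm f" if f: "f \<in> funs S" for f
    proof (rule field_le_epsilon)
      fix e :: real assume e: "0 < e"
      \<comment> \<open>The summand \<open>e * r\<close> keeps \<open>t\<close> positive even if
        \<open>nrm f = 0\<close>, and becomes \<open>e\<close> after division by \<open>r\<close>.
        Scaling by \<open>r / t\<close> moves \<open>f\<close> strictly inside the ball of radius
        \<open>r\<close>.\<close>
      define t where "t = nrm f + e * r"
      have t: "0 < t" "nrm f < t" using e r by (auto simp: t_def add_nonneg_pos)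
      have "\<bar>l (cls (\<lambda>\<omega>. (r / t) * f \<omega>))\<bar> < 1"
      proof -
        have g: "(\<lambda>\<omega>. (r / t) * f \<omega>) \<in> funs S" using f by (rule sublat_closed)
        have "nrm (\<lambda>\<omega>. 0 - (r / t) * f \<omega>) = r / t * nrm f"
          using FL_scale(2)[OF sublat_FL[OF f], of "- (r / t)"] r t by simp
        also have "\<dots> < r" using r t by (simp add: field_simps)
        finally have "l (cls (\<lambda>\<omega>. (r / t) * f \<omega>)) \<in> ball 0 1"
          unfolding vdist_cls[OF sublat_closed(1) g, symmetric] using g by (intro ball) auto
        then show ?thesis by (simp add: dist_real_def)
      qed
      then have "r / t * \<bar>l (cls f)\<bar> < 1" unfolding l_scale[OF f] using r t by (simp add: abs_mult)
      then have "\<bar>l (cls f)\<bar> < t / r" using r t by (simp add: field_simps)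
      also have "t / r = inverse r * nrm f + e" using r by (simp add: t_def field_simps)
      finally show "\<bar>l (cls f)\<bar> \<le> inverse r * nrm f + e" by simp
    qed
    then show "\<exists>K. \<forall>f\<in>funs S. \<bar>l (cls f)\<bar> \<le> K * nrm f" by blast
  next
    fix K a U assume K: "\<forall>f\<in>funs S. \<bar>l (cls f)\<bar> \<le> K * nrm f" and a: "a \<in> S"
      and U: "openin euclideanreal U" "l a \<in> U"
    have "open U" using U(1) by simp
    then obtain e where e: "0 < e" "ball (l a) e \<subseteq> U" using U(2) by (rule openE)
    obtain f where f: "f \<in> funs S" "a = cls f" using sublat_cases[OF a] .
    show "\<exists>r>0. \<forall>x. x \<in> S \<and> vdist (Lat S) a x < r \<longrightarrow> l x \<in> U"
    \<comment> \<open>\<open>\<bar>K\<bar> + 1\<close> is a positive Lipschitz constant whatever the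
      sign of \<open>K\<close>.\<close>
    proof (intro exI[of _ "e / (\<bar>K\<bar> + 1)"] conjI allI impI)
      fix x assume x: "x \<in> S \<and> vdist (Lat S) a x < e / (\<bar>K\<bar> + 1)"
      then obtain g where g: "g \<in> funs S" "x = cls g" using sublat_cases by blast
      have "\<bar>l a - l x\<bar> \<le> K * nrm (\<lambda>\<omega>. f \<omega> - g \<omega>)"
        using K[rule_format, OF sublat_diff[OF f(1) g(1)]] f g by (simp add: l_diff)
      also have "\<dots> \<le> (\<bar>K\<bar> + 1) * nrm (\<lambda>\<omega>. f \<omega> - g \<omega>)" by (intro mult_right_mono) auto
      also have "\<dots> < (\<bar>K\<bar> + 1) * (e / (\<bar>K\<bar> + 1))"
        using x f g by (intro mult_strict_left_mono) (auto simp: vdist_cls)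
      finally have "\<bar>l a - l x\<bar> < e" by simp
      then show "l x \<in> U" using e(2) by (auto simp: dist_real_def)
    qed (use e in auto)
  qed simp
qed

text \<open>\<open>closed\<close> makes \<open>funs S\<close> closed in \<open>FL\<close> and enters
  through completeness: a Cauchy sequence has a subsequence with geometric increments, whose
  quasi-sure limit is also its norm limit and belongs to \<open>funs S\<close>.\<close>

lemma banach_lattice_space_on:
  assumes closed: "\<And>f. f \<in> FL \<Longrightarrow> (\<And>e. 0 < e \<Longrightarrow> \<exists>h\<in>funs S. nrm (\<lambda>\<omega>. f \<omega> - h \<omega>) < e) \<Longrightarrow> f \<in> funs S"
  shows "banach_lattice (Lat S)"
proof -
  interpret vector_lattice "Lat S" by (rule vector_lattice_space_on)
  show ?thesis
  proof
    fix x y and a :: real assume "x \<in> carrier (Lat S)" "y \<in> carrier (Lat S)"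
    then obtain f g where fg: "f \<in> funs S" "g \<in> funs S" and xy: "x = cls f" "y = cls g"
      by (auto elim!: sublat_cases)
    note [measurable] = fg[THEN funsD(1)]
    note FL = fg[THEN sublat_FL]
    show "0 \<le> vnorm (Lat S) x" by (simp add: xy vnorm_cls)
    show "vnorm (Lat S) x = 0 \<longleftrightarrow> x = vzero (Lat S)" using FL by (simp add: xy vnorm_cls nrm_eq_0_iff)
    show "vnorm (Lat S) (vscale (Lat S) a x) = \<bar>a\<bar> * vnorm (Lat S) x"
      using FL by (simp add: xy vnorm_cls vscale_cls FL_scale)
    show "vnorm (Lat S) (vadd (Lat S) x y) \<le> vnorm (Lat S) x + vnorm (Lat S) y"
      using FL by (simp add: xy vnorm_cls vadd_cls FL_add)
    assume "vabs (Lat S) x \<sqsubseteq>\<^bsub>Lat S\<^esub> vabs (Lat S) y"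
    then show "vnorm (Lat S) x \<le> vnorm (Lat S) y"
      using FL fg by (auto simp: xy vnorm_cls vabs_cls qs_le_cls intro!: FL_mono)
  next
    interpret Metric_space S "vdist (Lat S)" by (rule Metric_space_space_on)
    have "\<exists>x. limitin mtopology \<sigma> x sequentially" if \<sigma>: "MCauchy \<sigma>" for \<sigma>
    proof -
      let ?P = "\<lambda>k m. \<forall>i\<ge>m. \<forall>j\<ge>m. vdist (Lat S) (\<sigma> i) (\<sigma> j) < (1/2)^k"
      have ex: "\<exists>m. ?P k m" for k using \<sigma> unfolding MCauchy_def by (metis half_gt_zero_iff zero_less_one zero_less_power)
      \<comment> \<open>From \<open>r n\<close> on, distances stay below \<open>(1/2)^n\<close>;
        along this subsequence the increments have the rate that \<open>lux_norm_complete\<close>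
        asks for.\<close>
      have "\<exists>r. \<forall>n. ?P n (r n) \<and> r n < r (Suc n)"
      proof (rule dependent_nat_choice)
        show "\<exists>m. ?P 0 m" by (rule ex)
        fix m n
        obtain m' where "?P (Suc n) m'" using ex by blast
        then have "?P (Suc n) (max m' (Suc m)) \<and> m < max m' (Suc m)" by auto
        then show "\<exists>m'. ?P (Suc n) m' \<and> m < m'" by blast
      qed
      then obtain r where r: "\<And>n. ?P n (r n)" and "\<And>n. r n < r (Suc n)" by blast
      then have mono: "strict_mono r" by (simp add: strict_mono_Suc_iff)
      have "\<sigma> n \<in> S" for n using \<sigma> by (auto simp: MCauchy_def)
      then have "\<exists>f. f \<in> funs S \<and> \<sigma> (r n) = cls f" for n using sublat_cases by metis
      then obtain F where F: "\<And>n. F n \<in> funs S" "\<And>n. \<sigma> (r n) = cls (F n)" by metis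
      have inc: "N (\<lambda>\<omega>. F (Suc n) \<omega> - F n \<omega>) \<le> ennreal ((1/2)^n)" for n
      proof -
        have "r n \<le> r (Suc n)" using mono by (simp add: strict_mono_Suc_iff less_imp_le)
        then have "nrm (\<lambda>\<omega>. F (Suc n) \<omega> - F n \<omega>) < (1/2)^n"
          using r[rule_format, of n "r (Suc n)" "r n"] F by (simp add: vdist_cls)
        then show ?thesis
          using ennreal_nrm[OF sublat_FL[OF sublat_diff[OF F(1) F(1)]]] by (metis ennreal_leI less_imp_le)
      qed
      obtain f where f: "f \<in> borel_measurable M"
          "\<And>P. P \<in> PP \<Longrightarrow> AE \<omega> in P. (\<lambda>n. F n \<omega>) \<longlonglongrightarrow> f \<omega>"
          "\<And>n. N (\<lambda>\<omega>. f \<omega> - F n \<omega>) \<le> ennreal (2 * (1/2)^n)"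
        by (rule lux_norm_complete[OF funsD(1)[OF F(1)] inc]) (rule that)
      have bnd: "(\<lambda>\<omega>. f \<omega> - F n \<omega>) \<in> FL" "nrm (\<lambda>\<omega>. f \<omega> - F n \<omega>) \<le> 2 * (1/2)^n" for n
        using FL_bound[OF borel_measurable_diff[OF f(1) funsD(1)[OF F(1)]] f(3)] by simp_all
      have lim: "(\<lambda>n. 2 * (1/2)^n :: real) \<longlonglongrightarrow> 2 * 0" by (intro tendsto_intros) auto
      then have small: "\<forall>\<^sub>F n in sequentially. nrm (\<lambda>\<omega>. f \<omega> - F n \<omega>) < e" if "0 < e" for e
      proof -
        have "\<forall>\<^sub>F n in sequentially. 2 * (1/2)^n < e" using order_tendstoD(2)[OF lim, of e] that by simp
        then show ?thesis by (rule eventually_mono) (rule le_less_trans[OF bnd(2)])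
      qed
      have fFL: "f \<in> FL" using FL_add(1)[OF bnd(1)[of 0] sublat_FL[OF F(1)[of 0]]] by simp
      have fS: "f \<in> funs S"
      proof (rule closed[OF fFL])
        fix e :: real assume "0 < e"
        then show "\<exists>h\<in>funs S. nrm (\<lambda>\<omega>. f \<omega> - h \<omega>) < e"
          using eventually_happens[OF small[of e]] F(1) by auto
      qed
      have "limitin mtopology (\<sigma> \<circ> r) (cls f) sequentially"
        unfolding limitin_metric using fS F funsD(2)[OF F(1)] small
        by (auto simp: vdist_cls nrm_diff_commute[of _ f])
      then show ?thesis using MCauchy_convergent_subsequence[OF \<sigma> mono] by blast
    qed
    then show "Metric_space.mcomplete (carrier (Lat S)) (vdist (Lat S))" by (simp add: mcomplete_def)
  qed
qed

end

lemma sublat_if_vector_sublattice: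
  assumes "vector_sublattice H (Lat (LPhi M PP \<Phi>))"
  shows "sublat H"
proof -
  have sub: "H \<subseteq> LPhi M PP \<Phi>" using assms by (simp add: vector_sublattice_def)
  then have FL: "f \<in> FL" if "f \<in> funs H" for f using that by (auto simp: funs_def)
  show ?thesis
    unfolding sublat_def
  proof (intro conjI ballI allI sub)
    show "(\<lambda>_. 0) \<in> funs H" using assms by (simp add: vector_sublattice_def funs_def)
    fix f assume f: "f \<in> funs H"
    note [measurable] = funsD(1)[OF f]
    show "(\<lambda>\<omega>. c * f \<omega>) \<in> funs H" for c
    proof -
      have "vscale (Lat (LPhi M PP \<Phi>)) c (cls f) \<in> H"
        using assms funsD(2)[OF f] by (simp add: vector_sublattice_def)
      then show ?thesis by (simp add: funs_def vscale_cls)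
    qed
    fix g assume g: "g \<in> funs H"
    note [measurable] = funsD(1)[OF g]
    show "(\<lambda>\<omega>. f \<omega> + g \<omega>) \<in> funs H"
    proof -
      have "vadd (Lat (LPhi M PP \<Phi>)) (cls f) (cls g) \<in> H"
        using assms funsD(2)[OF f] funsD(2)[OF g] by (simp add: vector_sublattice_def)
      then show ?thesis by (simp add: funs_def vadd_cls)
    qed
    show "(\<lambda>\<omega>. max (f \<omega>) (g \<omega>)) \<in> funs H"
    proof -
      have "cls f \<squnion>\<^bsub>Lat (LPhi M PP \<Phi>)\<^esub> cls g \<in> H"
        using assms funsD(2)[OF f] funsD(2)[OF g] by (simp add: vector_sublattice_def)
      then show ?thesis by (simp add: funs_def join_cls[OF sublat_LPhi FL[OF f] FL[OF g]])
    qed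
  qed
qed

lemma funs_closure:
  assumes H: "sublat H"
  shows "funs (norm_topology (Lat (LPhi M PP \<Phi>)) closure_of H) =
    {f \<in> FL. \<forall>e>0. \<exists>h\<in>funs H. nrm (\<lambda>\<omega>. f \<omega> - h \<omega>) < e}"
proof -
  let ?L = "Lat (LPhi M PP \<Phi>)"
  interpret Metric_space "LPhi M PP \<Phi>" "vdist ?L" by (rule Metric_space_space_on[OF sublat_LPhi])
  have top: "norm_topology ?L = mtopology" by (simp add: norm_topology_def)
  have "(\<exists>y\<in>H. y \<in> LPhi M PP \<Phi> \<and> vdist ?L (cls f) y < e) \<longleftrightarrow> (\<exists>h\<in>funs H. nrm (\<lambda>\<omega>. f \<omega> - h \<omega>) < e)"
    if f: "f \<in> FL" for f e
  proof safe
    fix y assume "y \<in> H" "vdist ?L (cls f) y < e"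
    then show "\<exists>h\<in>funs H. nrm (\<lambda>\<omega>. f \<omega> - h \<omega>) < e"
      using f by (auto elim!: sublat_cases[OF H] simp: vdist_cls[OF sublat_LPhi] sublat_FL[OF H])
  next
    fix h assume h: "h \<in> funs H" "nrm (\<lambda>\<omega>. f \<omega> - h \<omega>) < e"
    then show "\<exists>y\<in>H. y \<in> LPhi M PP \<Phi> \<and> vdist ?L (cls f) y < e"
      using f sublat_FL[OF H h(1)] by (intro bexI[of _ "cls h"]) (auto simp: vdist_cls[OF sublat_LPhi])
  qed
  moreover have "f \<in> funs (mtopology closure_of H) \<longleftrightarrow>
      f \<in> FL \<and> (\<forall>e>0. \<exists>y\<in>H. y \<in> LPhi M PP \<Phi> \<and> vdist ?L (cls f) y < e)" for f
    by (auto simp: funs_def metric_closure_of)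
  ultimately show ?thesis unfolding top by blast
qed

section \<open>Measures as functionals\<close>

lemma caD:
  assumes "\<mu> \<in> ca M PP"
  shows "signed_measure M \<mu>" "finite_measure (abs_var M \<mu>)"
    "finite_measure (pos_var M \<mu>)" "finite_measure (neg_var M \<mu>)"
  using assms by (auto simp: ca_def emeasure_abs_var intro!: finite_measureI)

text \<open>The null set condition in \<open>ca\<close> concerns members of \<open>sets M\<close>,
  so the exceptional set is asked to be measurable.\<close>

lemma ca_AE:
  assumes \<mu>: "\<mu> \<in> ca M PP" and N: "{\<omega> \<in> space M. \<not> Q \<omega>} \<in> sets M" and Q: "\<And>P. P \<in> PP \<Longrightarrow> AE \<omega> in P. Q \<omega>"
  shows "AE \<omega> in abs_var M \<mu>. Q \<omega>"
proof -
  let ?N = "{\<omega> \<in> space M. \<not> Q \<omega>}"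
  have "emeasure P ?N = 0" if P: "P \<in> PP" for P
    using Q[OF P] N sets_eq_imp_space_eq[OF PP_sets[OF P]] PP_sets[OF P]
    by (subst (asm) AE_iff_measurable[of ?N]) auto
  then have "(SUP P\<in>PP. emeasure P ?N) = 0" using PP_nonempty by simp
  then have "emeasure (abs_var M \<mu>) ?N = 0" using \<mu> N by (auto simp: ca_def)
  then show ?thesis using N by (subst AE_iff_measurable[of ?N]) auto
qed

lemma ca_AE_eq:
  fixes f g :: "'a \<Rightarrow> real"
  assumes "\<mu> \<in> ca M PP" and [measurable]: "f \<in> borel_measurable M" "g \<in> borel_measurable M"
    and "\<And>P. P \<in> PP \<Longrightarrow> AE \<omega> in P. f \<omega> = g \<omega>"
  shows "AE \<omega> in abs_var M \<mu>. f \<omega> = g \<omega>" "AE \<omega> in pos_var M \<mu>. f \<omega> = g \<omega>" "AE \<omega> in neg_var M \<mu>. f \<omega> = g \<omega>"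
proof -
  let ?N = "{\<omega> \<in> space M. \<not> f \<omega> = g \<omega>}"
  have N: "?N \<in> sets M" by measurable
  show *: "AE \<omega> in abs_var M \<mu>. f \<omega> = g \<omega>" using assms N by (intro ca_AE)
  then have "emeasure (abs_var M \<mu>) ?N = 0" using N by (subst (asm) AE_iff_measurable[of ?N]) auto
  then have "emeasure (pos_var M \<mu>) ?N = 0" "emeasure (neg_var M \<mu>) ?N = 0"
    by (simp_all add: emeasure_abs_var)
  then show "AE \<omega> in pos_var M \<mu>. f \<omega> = g \<omega>" "AE \<omega> in neg_var M \<mu>. f \<omega> = g \<omega>"
    using N by (subst AE_iff_measurable[of ?N]; simp)+
qed

lemma integrable_var:
  fixes f :: "'a \<Rightarrow> real"
  shows "integrable (abs_var M \<mu>) f \<longleftrightarrow> integrable (pos_var M \<mu>) f \<and> integrable (neg_var M \<mu>) f"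
  by (simp add: abs_var_eq integrable_plus_measure)

lemma all_integrable_iff:
  assumes "S \<subseteq> L0 M PP"
  shows "all_integrable M \<mu> S \<longleftrightarrow> (\<forall>f\<in>funs S. integrable (abs_var M \<mu>) f)"
proof
  assume *: "all_integrable M \<mu> S"
  have "f \<in> cls f" if "f \<in> funs S" for f using that by (auto simp: qs_class_def)
  with * show "\<forall>f\<in>funs S. integrable (abs_var M \<mu>) f" by (auto simp: all_integrable_def)
next
  assume *: "\<forall>f\<in>funs S. integrable (abs_var M \<mu>) f"
  have "g \<in> funs S" if X: "X \<in> S" "g \<in> X" for X g
  proof -
    obtain f where f: "f \<in> funs S" "X = cls f" using L0_cases[OF X(1) assms] .
    then have g: "g \<in> cls f" using X(2) by simp
    then have "cls f = cls g" using f mem_clsD[OF g] by (intro cls_cong) auto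
    moreover have "g \<in> borel_measurable M" by (rule mem_clsD(1)[OF g])
    ultimately show ?thesis using f by (auto simp: funs_def)
  qed
  with * show "all_integrable M \<mu> S" by (auto simp: all_integrable_def)
qed

lemma integral_rep_cls:
  assumes "\<mu> \<in> ca M PP" "f \<in> borel_measurable M"
  shows "(\<integral>\<omega>. rep (cls f) \<omega> \<partial>abs_var M \<mu>) = (\<integral>\<omega>. f \<omega> \<partial>abs_var M \<mu>)"
    and "signed_integral M \<mu> (cls f) = (\<integral>\<omega>. f \<omega> \<partial>pos_var M \<mu>) - (\<integral>\<omega>. f \<omega> \<partial>neg_var M \<mu>)"
proof -
  note [measurable] = assms(2)
  note AE = ca_AE_eq[OF assms(1) assms(2) rep_cls_measurable[OF assms(2)] rep_cls_AE[OF assms(2)]]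
  show "(\<integral>\<omega>. rep (cls f) \<omega> \<partial>abs_var M \<mu>) = (\<integral>\<omega>. f \<omega> \<partial>abs_var M \<mu>)"
    using AE(1) by (intro integral_cong_AE) (auto elim!: eventually_mono)
  have "(\<integral>\<omega>. rep (cls f) \<omega> \<partial>pos_var M \<mu>) = (\<integral>\<omega>. f \<omega> \<partial>pos_var M \<mu>)"
    using AE(2) by (intro integral_cong_AE) (auto elim!: eventually_mono)
  moreover have "(\<integral>\<omega>. rep (cls f) \<omega> \<partial>neg_var M \<mu>) = (\<integral>\<omega>. f \<omega> \<partial>neg_var M \<mu>)"
    using AE(3) by (intro integral_cong_AE) (auto elim!: eventually_mono)
  ultimately show "signed_integral M \<mu> (cls f) = (\<integral>\<omega>. f \<omega> \<partial>pos_var M \<mu>) - (\<integral>\<omega>. f \<omega> \<partial>neg_var M \<mu>)"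
    by (simp add: signed_integral_def)
qed

lemma signed_integral_linear:
  assumes \<mu>: "\<mu> \<in> ca M PP" and f: "f \<in> borel_measurable M" "integrable (abs_var M \<mu>) f"
  shows "signed_integral M \<mu> (cls (\<lambda>\<omega>. c * f \<omega>)) = c * signed_integral M \<mu> (cls f)"
    and "g \<in> borel_measurable M \<Longrightarrow> integrable (abs_var M \<mu>) g \<Longrightarrow>
      signed_integral M \<mu> (cls (\<lambda>\<omega>. f \<omega> + g \<omega>)) = signed_integral M \<mu> (cls f) + signed_integral M \<mu> (cls g)"
  using f by (auto simp: integral_rep_cls[OF \<mu>] integrable_var right_diff_distrib)

lemma abs_signed_integral_le:
  assumes \<mu>: "\<mu> \<in> ca M PP" and f: "f \<in> borel_measurable M" "integrable (abs_var M \<mu>) f"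
  shows "\<bar>signed_integral M \<mu> (cls f)\<bar> \<le> (\<integral>\<omega>. \<bar>f \<omega>\<bar> \<partial>abs_var M \<mu>)"
proof -
  have f': "integrable (pos_var M \<mu>) f" "integrable (neg_var M \<mu>) f" using f by (auto simp: integrable_var)
  have "\<bar>signed_integral M \<mu> (cls f)\<bar> \<le> \<bar>\<integral>\<omega>. f \<omega> \<partial>pos_var M \<mu>\<bar> + \<bar>\<integral>\<omega>. f \<omega> \<partial>neg_var M \<mu>\<bar>"
    using f by (simp add: integral_rep_cls[OF \<mu>])
  also have "\<dots> \<le> (\<integral>\<omega>. \<bar>f \<omega>\<bar> \<partial>pos_var M \<mu>) + (\<integral>\<omega>. \<bar>f \<omega>\<bar> \<partial>neg_var M \<mu>)"
    by (intro add_mono integral_abs_bound)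
  also have "\<dots> = (\<integral>\<omega>. \<bar>f \<omega>\<bar> \<partial>abs_var M \<mu>)"
    unfolding abs_var_eq using f' by (intro integral_plus_measure[symmetric]) auto
  finally show ?thesis .
qed

text \<open>With \<open>f\<close> the lattice contains \<open>\<bar>f\<bar>\<close>, which has the
  same norm, so bounding the integrals of all \<open>f\<close> amounts to bounding those of all
  \<open>\<bar>f\<bar>\<close>. The second form is the one to which Fatou's lemma applies.\<close>

lemma ca_on_iff:
  assumes S: "sublat S"
  shows "\<mu> \<in> ca_on M PP \<Phi> S \<longleftrightarrow> \<mu> \<in> ca M PP \<and>
    (\<exists>K\<ge>0. \<forall>f\<in>funs S. integrable (abs_var M \<mu>) f \<and> (\<integral>\<omega>. \<bar>f \<omega>\<bar> \<partial>abs_var M \<mu>) \<le> K * nrm f)"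
proof (cases "\<mu> \<in> ca M PP \<and> (\<forall>f\<in>funs S. integrable (abs_var M \<mu>) f)")
  case True
  then have \<mu>: "\<mu> \<in> ca M PP" and int: "\<And>f. f \<in> funs S \<Longrightarrow> integrable (abs_var M \<mu>) f" by auto
  have eq: "(\<integral>\<omega>. rep (cls f) \<omega> \<partial>abs_var M \<mu>) = (\<integral>\<omega>. f \<omega> \<partial>abs_var M \<mu>)" if "f \<in> funs S" for f
    using that by (intro integral_rep_cls[OF \<mu>]) auto
  have "continuous_map (norm_topology (Lat S)) euclideanreal (\<lambda>X. \<integral>\<omega>. rep X \<omega> \<partial>abs_var M \<mu>) \<longleftrightarrow>
      (\<exists>K. \<forall>f\<in>funs S. \<bar>\<integral>\<omega>. rep (cls f) \<omega> \<partial>abs_var M \<mu>\<bar> \<le> K * nrm f)"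
    using int sublat_closed[OF S] by (intro continuous_map_iff_bounded[OF S]) (auto simp: eq)
  also have "\<dots> \<longleftrightarrow> (\<exists>K\<ge>0. \<forall>f\<in>funs S. (\<integral>\<omega>. \<bar>f \<omega>\<bar> \<partial>abs_var M \<mu>) \<le> K * nrm f)"
  proof safe
    fix K assume K: "\<forall>f\<in>funs S. \<bar>\<integral>\<omega>. rep (cls f) \<omega> \<partial>abs_var M \<mu>\<bar> \<le> K * nrm f"
    show "\<exists>K\<ge>0. \<forall>f\<in>funs S. (\<integral>\<omega>. \<bar>f \<omega>\<bar> \<partial>abs_var M \<mu>) \<le> K * nrm f"
    proof (intro exI[of _ "\<bar>K\<bar>"] conjI ballI)
      fix f assume f: "f \<in> funs S"
      have "(\<integral>\<omega>. \<bar>f \<omega>\<bar> \<partial>abs_var M \<mu>) \<le> K * nrm f"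
        using K[rule_format, OF sublat_abs[OF S f]] FL_abs(2)[of f]
        by (simp add: eq[OF sublat_abs[OF S f]])
      also have "\<dots> \<le> \<bar>K\<bar> * nrm f" by (intro mult_right_mono) auto
      finally show "(\<integral>\<omega>. \<bar>f \<omega>\<bar> \<partial>abs_var M \<mu>) \<le> \<bar>K\<bar> * nrm f" .
    qed simp
  next
    fix K :: real assume "\<forall>f\<in>funs S. (\<integral>\<omega>. \<bar>f \<omega>\<bar> \<partial>abs_var M \<mu>) \<le> K * nrm f"
    then show "\<exists>K. \<forall>f\<in>funs S. \<bar>\<integral>\<omega>. rep (cls f) \<omega> \<partial>abs_var M \<mu>\<bar> \<le> K * nrm f"
      by (intro exI[of _ K]) (auto simp: eq intro: order_trans[OF integral_abs_bound])
  qed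
  finally show ?thesis
    using True by (auto simp: ca_on_def all_integrable_iff[OF sublat_subset_L0[OF S]])
next
  case False
  then show ?thesis by (auto simp: ca_on_def all_integrable_iff[OF sublat_subset_L0[OF S]])
qed

lemma norm_dual_iff:
  assumes S: "sublat S"
  shows "l \<in> norm_dual (Lat S) \<longleftrightarrow> l \<in> extensional S \<and>
    (\<forall>f\<in>funs S. \<forall>g\<in>funs S. l (cls (\<lambda>\<omega>. f \<omega> + g \<omega>)) = l (cls f) + l (cls g)) \<and>
    (\<forall>c. \<forall>f\<in>funs S. l (cls (\<lambda>\<omega>. c * f \<omega>)) = c * l (cls f)) \<and>
    (\<exists>K\<ge>0. \<forall>f\<in>funs S. \<bar>l (cls f)\<bar> \<le> K * nrm f)"
proof -
  have add: "(\<forall>x\<in>S. \<forall>y\<in>S. l (vadd (Lat S) x y) = l x + l y) \<longleftrightarrow>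
      (\<forall>f\<in>funs S. \<forall>g\<in>funs S. l (cls (\<lambda>\<omega>. f \<omega> + g \<omega>)) = l (cls f) + l (cls g))"
  proof safe
    fix f g assume *: "\<forall>x\<in>S. \<forall>y\<in>S. l (vadd (Lat S) x y) = l x + l y" and fg: "f \<in> funs S" "g \<in> funs S"
    show "l (cls (\<lambda>\<omega>. f \<omega> + g \<omega>)) = l (cls f) + l (cls g)"
      using *[rule_format, OF funsD(2)[OF fg(1)] funsD(2)[OF fg(2)]] fg by (simp add: vadd_cls funsD)
  next
    fix x y assume "\<forall>f\<in>funs S. \<forall>g\<in>funs S. l (cls (\<lambda>\<omega>. f \<omega> + g \<omega>)) = l (cls f) + l (cls g)" "x \<in> S" "y \<in> S"
    then show "l (vadd (Lat S) x y) = l x + l y"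
      by (auto elim!: sublat_cases[OF S] simp: vadd_cls funsD)
  qed
  have scale: "(\<forall>a. \<forall>x\<in>S. l (vscale (Lat S) a x) = a * l x) \<longleftrightarrow>
      (\<forall>c. \<forall>f\<in>funs S. l (cls (\<lambda>\<omega>. c * f \<omega>)) = c * l (cls f))"
  proof safe
    fix f c assume *: "\<forall>a. \<forall>x\<in>S. l (vscale (Lat S) a x) = a * l x" and f: "f \<in> funs S"
    show "l (cls (\<lambda>\<omega>. c * f \<omega>)) = c * l (cls f)"
      using *[rule_format, OF funsD(2)[OF f]] f by (simp add: vscale_cls funsD)
  next
    fix a x assume "\<forall>c. \<forall>f\<in>funs S. l (cls (\<lambda>\<omega>. c * f \<omega>)) = c * l (cls f)" "x \<in> S"
    then show "l (vscale (Lat S) a x) = a * l x"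
      by (auto elim!: sublat_cases[OF S] simp: vscale_cls funsD)
  qed
  have K: "(\<exists>K. \<forall>f\<in>funs S. \<bar>l (cls f)\<bar> \<le> K * nrm f) \<longleftrightarrow> (\<exists>K\<ge>0. \<forall>f\<in>funs S. \<bar>l (cls f)\<bar> \<le> K * nrm f)"
  proof safe
    fix K assume "\<forall>f\<in>funs S. \<bar>l (cls f)\<bar> \<le> K * nrm f"
    then have "\<forall>f\<in>funs S. \<bar>l (cls f)\<bar> \<le> \<bar>K\<bar> * nrm f"
      by (meson abs_ge_self mult_right_mono nrm_nonneg order_trans)
    then show "\<exists>K\<ge>0. \<forall>f\<in>funs S. \<bar>l (cls f)\<bar> \<le> K * nrm f" by (intro exI[of _ "\<bar>K\<bar>"]) auto
  qed auto
  show ?thesis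
    unfolding norm_dual_def space_on_simps mem_Collect_eq add scale K[symmetric]
    using continuous_map_iff_bounded[OF S, of l] by blast
qed

lemma functional_on_mem_norm_dual:
  assumes S: "sublat S" and \<mu>: "\<mu> \<in> ca_on M PP \<Phi> S"
  shows "functional_on M S \<mu> \<in> norm_dual (Lat S)"
proof -
  obtain K where ca: "\<mu> \<in> ca M PP" and K: "0 \<le> K" and int: "\<And>f. f \<in> funs S \<Longrightarrow> integrable (abs_var M \<mu>) f"
    and le: "\<And>f. f \<in> funs S \<Longrightarrow> (\<integral>\<omega>. \<bar>f \<omega>\<bar> \<partial>abs_var M \<mu>) \<le> K * nrm f"
    using \<mu> unfolding ca_on_iff[OF S] by blast
  have "functional_on M S \<mu> (cls f) = signed_integral M \<mu> (cls f)" if "f \<in> funs S" for f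
    using that by (auto simp: functional_on_def)
  then show ?thesis
    unfolding norm_dual_iff[OF S]
    using sublat_closed[OF S] int signed_integral_linear[OF ca] K
      order_trans[OF abs_signed_integral_le[OF ca _ int] le]
    by (auto simp: functional_on_def intro!: exI[of _ K])
qed

section \<open>The closure of a sublattice\<close>

context
  fixes H C :: "('a \<Rightarrow> real) set set"
  assumes H: "sublat H" and C: "C = norm_topology (Lat (LPhi M PP \<Phi>)) closure_of H"
begin

lemma funs_C: "funs C = {f \<in> FL. \<forall>e>0. \<exists>h\<in>funs H. nrm (\<lambda>\<omega>. f \<omega> - h \<omega>) < e}"
  unfolding C by (rule funs_closure[OF H])

lemma funs_H_subset_C: "funs H \<subseteq> funs C"
  using H by (auto simp: funs_C sublat_FL[OF H] nrm_def lux_norm_zero intro!: bexI)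

lemma H_subset_C: "H \<subseteq> C"
  using funs_H_subset_C by (auto elim!: sublat_cases[OF H])

text \<open>Idempotence of the closure: the two approximations contribute \<open>e / 2\<close>
  each.\<close>

lemma funs_C_approx:
  assumes "f \<in> FL" "\<And>e. 0 < e \<Longrightarrow> \<exists>g\<in>funs C. nrm (\<lambda>\<omega>. f \<omega> - g \<omega>) < e"
  shows "f \<in> funs C"
  unfolding funs_C
proof (intro CollectI conjI allI impI assms(1))
  fix e :: real assume e: "0 < e"
  obtain g where g: "g \<in> funs C" "nrm (\<lambda>\<omega>. f \<omega> - g \<omega>) < e / 2" using assms(2)[of "e / 2"] e by auto
  obtain h where h: "h \<in> funs H" "nrm (\<lambda>\<omega>. g \<omega> - h \<omega>) < e / 2"
    using g(1) e unfolding funs_C by (auto dest!: spec[of _ "e / 2"])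
  have "nrm (\<lambda>\<omega>. f \<omega> - h \<omega>) < e"
    using nrm_diff_triangle[OF assms(1), of g h] g h sublat_FL[OF H h(1)] by (auto simp: funs_C)
  then show "\<exists>h\<in>funs H. nrm (\<lambda>\<omega>. f \<omega> - h \<omega>) < e" using h by blast
qed

lemma sublat_C: "sublat C"
proof -
  have "C \<subseteq> topspace (norm_topology (Lat (LPhi M PP \<Phi>)))" unfolding C by (rule closure_of_subset_topspace)
  also have "\<dots> = LPhi M PP \<Phi>"
    by (simp add: norm_topology_def Metric_space.topspace_mtopology[OF Metric_space_space_on[OF sublat_LPhi]])
  finally have sub: "C \<subseteq> LPhi M PP \<Phi>" .
  have C_FL: "f \<in> FL" if "f \<in> funs C" for f using that by (simp add: funs_C)
  have approx: "\<exists>h\<in>funs H. nrm (\<lambda>\<omega>. f \<omega> - h \<omega>) < e" if "f \<in> funs C" "0 < e" for f e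
    using that by (simp add: funs_C)
  \<comment> \<open>Sum and maximum are treated at once: both change by at most the sum of the
    changes of their arguments, so approximations of \<open>f\<close> and \<open>g\<close> in
    \<open>H\<close> give one of \<open>b f g\<close>.\<close>
  have two: "(\<lambda>\<omega>. b (f \<omega>) (g \<omega>)) \<in> funs C"
    if fg: "f \<in> funs C" "g \<in> funs C"
      and FL: "(\<lambda>\<omega>. b (f \<omega>) (g \<omega>)) \<in> FL" and bH: "\<And>f g. f \<in> funs H \<Longrightarrow> g \<in> funs H \<Longrightarrow> (\<lambda>\<omega>. b (f \<omega>) (g \<omega>)) \<in> funs H"
      and lip: "\<And>x y x' y'. \<bar>b x y - b x' y'\<bar> \<le> \<bar>x - x'\<bar> + \<bar>y - y'\<bar>"
    for f g and b :: "real \<Rightarrow> real \<Rightarrow> real"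
  proof (rule funs_C_approx[OF FL])
    fix e :: real assume e: "0 < e"
    obtain h where h: "h \<in> funs H" "nrm (\<lambda>\<omega>. f \<omega> - h \<omega>) < e / 2" using approx[OF fg(1), of "e / 2"] e by auto
    obtain k where k: "k \<in> funs H" "nrm (\<lambda>\<omega>. g \<omega> - k \<omega>) < e / 2" using approx[OF fg(2), of "e / 2"] e by auto
    note FLs = sublat_FL[OF H h(1)] sublat_FL[OF H k(1)] C_FL[OF fg(1)] C_FL[OF fg(2)]
    have bhk: "(\<lambda>\<omega>. b (h \<omega>) (k \<omega>)) \<in> FL" using bH h k sublat_FL[OF H] by blast
    have fh: "(\<lambda>\<omega>. \<bar>f \<omega> - h \<omega>\<bar>) \<in> FL" and gk: "(\<lambda>\<omega>. \<bar>g \<omega> - k \<omega>\<bar>) \<in> FL"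
      using FLs by (auto intro!: FL_abs(1) FL_diff(1))
    have "nrm (\<lambda>\<omega>. b (f \<omega>) (g \<omega>) - b (h \<omega>) (k \<omega>)) \<le> nrm (\<lambda>\<omega>. \<bar>f \<omega> - h \<omega>\<bar> + \<bar>g \<omega> - k \<omega>\<bar>)"
      using lip FL_diff(1)[OF FL bhk] FL_add(1)[OF fh gk]
      by (intro FL_mono(2)) (auto intro!: AE_I2 order_trans[OF lip])
    also have "\<dots> \<le> nrm (\<lambda>\<omega>. \<bar>f \<omega> - h \<omega>\<bar>) + nrm (\<lambda>\<omega>. \<bar>g \<omega> - k \<omega>\<bar>)" by (rule FL_add(2)[OF fh gk])
    also have "\<dots> = nrm (\<lambda>\<omega>. f \<omega> - h \<omega>) + nrm (\<lambda>\<omega>. g \<omega> - k \<omega>)"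
      using FLs by (simp add: FL_abs(2) FL_diff(1))
    also have "\<dots> < e" using h k by simp
    finally show "\<exists>g'\<in>funs C. nrm (\<lambda>\<omega>. b (f \<omega>) (g \<omega>) - g' \<omega>) < e"
      using subsetD[OF funs_H_subset_C bH[OF h(1) k(1)]]
      by (intro bexI[of _ "\<lambda>\<omega>. b (h \<omega>) (k \<omega>)"])
  qed
  show ?thesis
    unfolding sublat_def
  proof (intro conjI ballI allI sub)
    show "(\<lambda>_. 0) \<in> funs C" using funs_H_subset_C sublat_closed(1)[OF H] by blast
    fix f assume f: "f \<in> funs C"
    show "(\<lambda>\<omega>. c * f \<omega>) \<in> funs C" for c
    proof (rule funs_C_approx[OF FL_scale(1)[OF C_FL[OF f]]])
      fix e :: real assume e: "0 < e"
      \<comment> \<open>The denominator \<open>\<bar>c\<bar> + 1\<close> is positive also for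
        \<open>c = 0\<close>.\<close>
      obtain h where h: "h \<in> funs H" "nrm (\<lambda>\<omega>. f \<omega> - h \<omega>) < e / (\<bar>c\<bar> + 1)"
        using approx[OF f, of "e / (\<bar>c\<bar> + 1)"] e by auto
      have "nrm (\<lambda>\<omega>. c * f \<omega> - c * h \<omega>) = \<bar>c\<bar> * nrm (\<lambda>\<omega>. f \<omega> - h \<omega>)"
        using FL_scale(2)[OF FL_diff(1)[OF C_FL[OF f] sublat_FL[OF H h(1)]], of c] by (simp add: right_diff_distrib)
      also have "\<dots> \<le> (\<bar>c\<bar> + 1) * nrm (\<lambda>\<omega>. f \<omega> - h \<omega>)" by (intro mult_right_mono) auto
      also have "\<dots> < (\<bar>c\<bar> + 1) * (e / (\<bar>c\<bar> + 1))" using h by (intro mult_strict_left_mono) auto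
      finally show "\<exists>g\<in>funs C. nrm (\<lambda>\<omega>. c * f \<omega> - g \<omega>) < e"
        using subsetD[OF funs_H_subset_C sublat_closed(4)[OF H h(1), of c]]
        by (intro bexI[of _ "\<lambda>\<omega>. c * h \<omega>"]) auto
    qed
    fix g assume g: "g \<in> funs C"
    show "(\<lambda>\<omega>. f \<omega> + g \<omega>) \<in> funs C"
    proof (rule two[where b = "(+)", OF f g FL_add(1)[OF C_FL[OF f] C_FL[OF g]]])
      show "(\<lambda>\<omega>. f \<omega> + g \<omega>) \<in> funs H" if "f \<in> funs H" "g \<in> funs H" for f g
        using that by (rule sublat_closed(2)[OF H])
    qed linarith
    show "(\<lambda>\<omega>. max (f \<omega>) (g \<omega>)) \<in> funs C"
    proof (rule two[where b = max, OF f g FL_max[OF C_FL[OF f] C_FL[OF g]]])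
      show "(\<lambda>\<omega>. max (f \<omega>) (g \<omega>)) \<in> funs H" if "f \<in> funs H" "g \<in> funs H" for f g
        using that by (rule sublat_closed(3)[OF H])
      show "\<bar>max x y - max x' y'\<bar> \<le> \<bar>x - x'\<bar> + \<bar>y - y'\<bar>" for x y x' y' :: real by (auto simp: max_def)
    qed
  qed
qed

lemma banach_lattice_C: "banach_lattice (Lat C)"
  by (rule banach_lattice_space_on[OF sublat_C]) (rule funs_C_approx)

text \<open>An element of the closure is the quasi-sure limit of a fast approximating sequence in \<open>H\<close>,
  and Fatou's lemma for \<open>|\<mu>|\<close> carries the bound over.\<close>

lemma ca_on_C_eq: "ca_on M PP \<Phi> C = ca_on M PP \<Phi> H"
proof (intro equalityI subsetI)
  fix \<mu> assume "\<mu> \<in> ca_on M PP \<Phi> C"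
  then show "\<mu> \<in> ca_on M PP \<Phi> H"
    unfolding ca_on_iff[OF H] ca_on_iff[OF sublat_C] using funs_H_subset_C by blast
next
  fix \<mu> assume "\<mu> \<in> ca_on M PP \<Phi> H"
  then obtain K where ca: "\<mu> \<in> ca M PP" and K: "0 \<le> K"
    and int: "\<And>f. f \<in> funs H \<Longrightarrow> integrable (abs_var M \<mu>) f"
    and le: "\<And>f. f \<in> funs H \<Longrightarrow> (\<integral>\<omega>. \<bar>f \<omega>\<bar> \<partial>abs_var M \<mu>) \<le> K * nrm f"
    unfolding ca_on_iff[OF H] by blast
  have "integrable (abs_var M \<mu>) f \<and> (\<integral>\<omega>. \<bar>f \<omega>\<bar> \<partial>abs_var M \<mu>) \<le> K * nrm f" if f: "f \<in> funs C" for f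
  proof -
    have fFL: "f \<in> FL" using f by (simp add: funs_C)
    note [measurable] = funsD(1)[OF f]
    \<comment> \<open>With these radii two successive approximations differ by at most
      \<open>d (Suc n) + d n \<le> (1/2)^n\<close>, as \<open>lux_norm_complete\<close>
      requires.\<close>
    define d :: "nat \<Rightarrow> real" where "d n = (1/2)^n / 2" for n
    have d: "0 < d n" "d (Suc n) \<le> d n" "d n + d n = (1/2)^n" for n by (auto simp: d_def)
    have "\<exists>h. h \<in> funs H \<and> nrm (\<lambda>\<omega>. f \<omega> - h \<omega>) < d n" for n using f d(1)[of n] by (auto simp: funs_C)
    then obtain h where h: "\<And>n. h n \<in> funs H" "\<And>n. nrm (\<lambda>\<omega>. f \<omega> - h n \<omega>) < d n" by metis
    have hFL: "h n \<in> FL" for n using sublat_FL[OF H h(1)] .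
    have [measurable]: "h n \<in> borel_measurable M" for n using h(1) by auto
    have inc: "N (\<lambda>\<omega>. h (Suc n) \<omega> - h n \<omega>) \<le> ennreal ((1/2)^n)" for n
    proof -
      have "nrm (\<lambda>\<omega>. h (Suc n) \<omega> - h n \<omega>) \<le> (1/2)^n"
        using nrm_diff_triangle[OF hFL[of "Suc n"] fFL hFL[of n]] h(2)[of "Suc n"] h(2)[of n] d(2,3)[of n]
        by (simp add: nrm_diff_commute[of "h (Suc n)" f])
      then show ?thesis unfolding ennreal_nrm[OF FL_diff(1)[OF hFL hFL], symmetric] by (rule ennreal_leI)
    qed
    obtain g where g: "g \<in> borel_measurable M"
        "\<And>P. P \<in> PP \<Longrightarrow> AE \<omega> in P. (\<lambda>n. h n \<omega>) \<longlonglongrightarrow> g \<omega>"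
        "\<And>n. N (\<lambda>\<omega>. g \<omega> - h n \<omega>) \<le> ennreal (2 * (1/2)^n)"
      by (rule lux_norm_complete[OF funsD(1)[OF h(1)] inc]) (rule that)
    note [measurable] = g(1)
    have gb: "(\<lambda>\<omega>. g \<omega> - h n \<omega>) \<in> FL" "nrm (\<lambda>\<omega>. g \<omega> - h n \<omega>) \<le> 2 * (1/2)^n" for n
      using FL_bound[OF borel_measurable_diff[OF g(1) funsD(1)[OF h(1)]] g(3)] by simp_all
    have gFL: "g \<in> FL" using FL_add(1)[OF gb(1)[of 0] hFL[of 0]] by simp
    have lim0: "(\<lambda>n. 2 * (1/2)^n + (1/2)^n / 2 :: real) \<longlonglongrightarrow> 2 * 0 + 0 / 2" by (intro tendsto_intros) auto
    \<comment> \<open>\<open>f\<close> is the norm limit of \<open>h\<close> and \<open>g\<close>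
      the quasi-sure one. Since \<open>g - f\<close> has norm 0, the sequence converges quasi-surely
      to \<open>f\<close> itself.\<close>
    have "nrm (\<lambda>\<omega>. g \<omega> - f \<omega>) \<le> 2 * (1/2)^n + (1/2)^n / 2" for n
      using nrm_diff_triangle[OF gFL hFL[of n] fFL] gb(2)[of n] h(2)[of n]
      by (simp add: nrm_diff_commute[of f "h n"] d_def)
    then have "nrm (\<lambda>\<omega>. g \<omega> - f \<omega>) \<le> 0"
      using LIMSEQ_le_const[OF lim0, of "nrm (\<lambda>\<omega>. g \<omega> - f \<omega>)"] by auto
    then have "nrm (\<lambda>\<omega>. g \<omega> - f \<omega>) = 0" using nrm_nonneg[of "\<lambda>\<omega>. g \<omega> - f \<omega>"] by linarith
    then have N_zero: "N (\<lambda>\<omega>. g \<omega> - f \<omega>) = 0" using ennreal_nrm[OF FL_diff(1)[OF gFL fFL]] by simp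
    have AE_P: "AE \<omega> in P. (\<lambda>n. h n \<omega>) \<longlonglongrightarrow> f \<omega>" if P: "P \<in> PP" for P
    proof -
      have "AE \<omega> in P. g \<omega> - f \<omega> = 0" using N_zero P by (intro lux_norm_eq_0) auto
      then show ?thesis using g(2)[OF P] by eventually_elim simp
    qed
    have AE: "AE \<omega> in abs_var M \<mu>. (\<lambda>n. h n \<omega>) \<longlonglongrightarrow> f \<omega>"
    proof (rule ca_AE[OF ca _ AE_P])
      show "{\<omega> \<in> space M. \<not> (\<lambda>n. h n \<omega>) \<longlonglongrightarrow> f \<omega>} \<in> sets M" by measurable
    qed
    have lim1: "(\<lambda>n. K * (nrm f + (1/2)^n / 2)) \<longlonglongrightarrow> K * (nrm f + 0 / 2)" by (intro tendsto_intros) auto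
    have "(\<integral>\<^sup>+\<omega>. ennreal \<bar>f \<omega>\<bar> \<partial>abs_var M \<mu>) = (\<integral>\<^sup>+\<omega>. liminf (\<lambda>n. ennreal \<bar>h n \<omega>\<bar>) \<partial>abs_var M \<mu>)"
    proof (rule nn_integral_cong_AE)
      show "AE \<omega> in abs_var M \<mu>. ennreal \<bar>f \<omega>\<bar> = liminf (\<lambda>n. ennreal \<bar>h n \<omega>\<bar>)"
        using AE
      proof (rule eventually_mono)
        fix \<omega> assume "(\<lambda>n. h n \<omega>) \<longlonglongrightarrow> f \<omega>"
        then have "(\<lambda>n. ennreal \<bar>h n \<omega>\<bar>) \<longlonglongrightarrow> ennreal \<bar>f \<omega>\<bar>" by (intro tendsto_ennrealI tendsto_rabs)
        then show "ennreal \<bar>f \<omega>\<bar> = liminf (\<lambda>n. ennreal \<bar>h n \<omega>\<bar>)"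
          by (intro lim_imp_Liminf[symmetric]) auto
      qed
    qed
    also have "\<dots> \<le> liminf (\<lambda>n. \<integral>\<^sup>+\<omega>. ennreal \<bar>h n \<omega>\<bar> \<partial>abs_var M \<mu>)"
      by (intro nn_integral_liminf) measurable
    also have "\<dots> \<le> liminf (\<lambda>n. ennreal (K * (nrm f + (1/2)^n / 2)))"
    proof (intro Liminf_mono always_eventually allI)
      fix n
      have "(\<integral>\<^sup>+\<omega>. ennreal \<bar>h n \<omega>\<bar> \<partial>abs_var M \<mu>) = ennreal (\<integral>\<omega>. \<bar>h n \<omega>\<bar> \<partial>abs_var M \<mu>)"
        using int[OF h(1)] by (intro nn_integral_eq_integral) auto
      also have "(\<integral>\<omega>. \<bar>h n \<omega>\<bar> \<partial>abs_var M \<mu>) \<le> K * nrm (h n)" by (rule le[OF h(1)])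
      also have "nrm (h n) \<le> nrm f + (1/2)^n / 2"
        using FL_add(2)[OF fFL FL_diff(1)[OF hFL[of n] fFL]] h(2)[of n]
        by (simp add: nrm_diff_commute[of f "h n"] d_def)
      finally show "(\<integral>\<^sup>+\<omega>. ennreal \<bar>h n \<omega>\<bar> \<partial>abs_var M \<mu>) \<le> ennreal (K * (nrm f + (1/2)^n / 2))"
        using K by (simp add: mult_left_mono ennreal_leI)
    qed
    also have "\<dots> = ennreal (K * (nrm f + 0 / 2))"
      by (intro lim_imp_Liminf tendsto_ennrealI lim1) auto
    finally have bound: "(\<integral>\<^sup>+\<omega>. ennreal \<bar>f \<omega>\<bar> \<partial>abs_var M \<mu>) \<le> ennreal (K * nrm f)" by simp
    then have "integrable (abs_var M \<mu>) f"
      by (intro integrableI_bounded) (auto intro: le_less_trans)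
    moreover from this have "(\<integral>\<omega>. \<bar>f \<omega>\<bar> \<partial>abs_var M \<mu>) \<le> K * nrm f"
      using bound K by (subst (asm) nn_integral_eq_integral) auto
    ultimately show ?thesis by blast
  qed
  then show "\<mu> \<in> ca_on M PP \<Phi> C" unfolding ca_on_iff[OF sublat_C] using ca K by blast
qed

end

section \<open>Representation of norm continuous functionals by measures\<close>

lemma function_lattice_funs:
  assumes S: "sublat S" and one: "(\<lambda>_. 1) \<in> funs S"
  shows "function_lattice (funs S)"
  using sublat_closed[OF S] one by unfold_locales auto

context
  fixes H C :: "('a \<Rightarrow> real) set set"
  assumes H: "sublat H" and C: "C = norm_topology (Lat (LPhi M PP \<Phi>)) closure_of H"
    and one: "(\<lambda>_. 1) \<in> funs H" and gen: "generates M PP H"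
begin

section \<open>Uniqueness of the representing measure\<close>

interpretation fl: function_lattice "space M" "funs H"
  by (rule function_lattice_funs[OF H one])

text \<open>\<open>generates\<close> speaks of preimages of all Borel sets; the sets
  \<open>{f > c}\<close> determine these, and \<open>f - c\<close> is again in the lattice.\<close>

lemma sigma_sets_pos_sets: "sigma_sets (space M) fl.pos_sets = sets M"
proof
  have "fl.pos_sets \<subseteq> sets M"
    unfolding fl.pos_sets_def by (auto dest!: funsD(1))
  then show "sigma_sets (space M) fl.pos_sets \<subseteq> sets M" by (rule sets.sigma_sets_subset)
  let ?N = "sigma (space M) fl.pos_sets"
  have N: "sets ?N = sigma_sets (space M) fl.pos_sets" "space ?N = space M"
    using fl.pos_sets_subset by auto
  have "f -` B \<inter> space M \<in> sigma_sets (space M) fl.pos_sets"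
    if "f \<in> borel_measurable M" "cls f \<in> H" "B \<in> sets borel" for f B
  proof -
    have "f \<in> borel_measurable ?N"
      using that by (intro fl.borel_measurable_pos_sets[OF N(1)]) (simp add: funs_def)
    from measurable_sets[OF this that(3)] show ?thesis unfolding N .
  qed
  then have "sigma_sets (space M) {f -` B \<inter> space M | f B. f \<in> borel_measurable M \<and> cls f \<in> H \<and> B \<in> sets borel}
      \<subseteq> sigma_sets (space M) fl.pos_sets"
    by (intro sigma_sets_mono) auto
  then show "sets M \<subseteq> sigma_sets (space M) fl.pos_sets" using gen by (simp add: generates_def)
qed

text \<open>Adding the negative part of each measure to the positive part of the other gives two
  finite positive measures with equal integrals over the lattice. Their equality yields that of the
  differences by the Jordan decomposition.\<close>

lemma ca_eq_if_signed_integral_eq: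
  assumes \<mu>: "\<mu> \<in> ca M PP" "\<And>f. f \<in> funs H \<Longrightarrow> integrable (abs_var M \<mu>) f"
    and \<nu>: "\<nu> \<in> ca M PP" "\<And>f. f \<in> funs H \<Longrightarrow> integrable (abs_var M \<nu>) f"
    and eq: "\<And>f. f \<in> funs H \<Longrightarrow> signed_integral M \<mu> (cls f) = signed_integral M \<nu> (cls f)"
  shows "\<mu> = \<nu>"
proof
  fix A
  let ?K = "plus_measure (pos_var M \<mu>) (neg_var M \<nu>)" and ?N = "plus_measure (pos_var M \<nu>) (neg_var M \<mu>)"
  have "?K = ?N"
  proof (rule fl.measure_eq_if_integral_eq)
    show "sets ?K = sigma_sets (space M) fl.pos_sets" "sets ?N = sigma_sets (space M) fl.pos_sets"
      by (simp_all add: sigma_sets_pos_sets)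
    show "finite_measure ?K" "finite_measure ?N"
      using caD(3,4)[OF \<mu>(1)] caD(3,4)[OF \<nu>(1)]
      by (auto intro!: finite_measureI simp: emeasure_plus_measure dest!: finite_measure.emeasure_finite)
    fix f assume f: "f \<in> funs H"
    have "integrable (pos_var M \<mu>) f" "integrable (neg_var M \<mu>) f" "integrable (pos_var M \<nu>) f" "integrable (neg_var M \<nu>) f"
      using \<mu>(2)[OF f] \<nu>(2)[OF f] by (auto simp: integrable_var)
    then show "(\<integral>x. f x \<partial>?K) = (\<integral>x. f x \<partial>?N)"
      using eq[OF f] integral_rep_cls(2)[OF \<mu>(1) funsD(1)[OF f]] integral_rep_cls(2)[OF \<nu>(1) funsD(1)[OF f]]
      by (simp add: integral_plus_measure)
  qed
  show "\<mu> A = \<nu> A"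
  proof (cases "A \<in> sets M")
    case True
    have "emeasure ?K A = emeasure ?N A" by (simp add: \<open>?K = ?N\<close>)
    then have "measure (pos_var M \<mu>) A + measure (neg_var M \<nu>) A = measure (pos_var M \<nu>) A + measure (neg_var M \<mu>) A"
      using caD(3,4)[OF \<mu>(1)] caD(3,4)[OF \<nu>(1)]
      by (simp add: emeasure_plus_measure finite_measure.emeasure_eq_measure ennreal_plus[symmetric] del: ennreal_plus)
    moreover have "\<mu> A = measure (pos_var M \<mu>) A - measure (neg_var M \<mu>) A"
      using \<mu>(1) True by (intro jordan_decomposition) (auto simp: ca_def)
    moreover have "\<nu> A = measure (pos_var M \<nu>) A - measure (neg_var M \<nu>) A"
      using \<nu>(1) True by (intro jordan_decomposition) (auto simp: ca_def)
    ultimately show ?thesis by simp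
  next
    case False
    then show ?thesis using caD(1)[OF \<mu>(1)] caD(1)[OF \<nu>(1)] by (auto simp: signed_measure_def)
  qed
qed

section \<open>Representation under \<sigma>-order continuity of the norm\<close>

context
  assumes soc: "sigma_order_continuous (Lat H) (vnorm (Lat H))"
begin

text \<open>A representative of a lower bound in \<open>H\<close> lies below all \<open>F n\<close>
  outside of a single \<open>P\<close>-null set, since there are countably many \<open>n\<close>,
  and hence below their limit 0.\<close>

lemma nrm_tendsto_0:
  assumes F: "\<And>n. F n \<in> funs H"
    and dec: "\<And>\<omega> n. \<omega> \<in> space M \<Longrightarrow> F (Suc n) \<omega> \<le> F n \<omega>"
    and lim: "\<And>\<omega>. \<omega> \<in> space M \<Longrightarrow> (\<lambda>n. F n \<omega>) \<longlonglongrightarrow> 0"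
  shows "(\<lambda>n. nrm (F n)) \<longlonglongrightarrow> 0"
proof -
  have space: "space P = space M" if "P \<in> PP" for P using sets_eq_imp_space_eq[OF PP_sets[OF that]] .
  have meas: "F n \<in> borel_measurable M" for n using F by auto
  have nonneg: "0 \<le> F n \<omega>" if "\<omega> \<in> space M" for n \<omega>
    using decseq_ge[OF decseq_SucI[of "\<lambda>n. F n \<omega>"] lim[OF that], of n] dec[OF that] by simp
  let ?y = "\<lambda>n. cls (F n)"
  have zero: "cls (\<lambda>_. 0) \<in> H" by (rule funsD(2)[OF sublat_closed(1)[OF H]])
  have le0: "qs_le PP (cls (\<lambda>_. 0)) (?y n)" for n
    using nonneg meas by (auto simp: qs_le_cls space intro!: AE_I2)
  have "qs_le PP z (cls (\<lambda>_. 0))" if z: "z \<in> H" "\<And>n. qs_le PP z (?y n)" for z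
  proof -
    obtain g where g: "g \<in> funs H" "z = cls g" using sublat_cases[OF H z(1)] .
    note [measurable] = funsD(1)[OF g(1)]
    have "AE \<omega> in P. g \<omega> \<le> 0" if P: "P \<in> PP" for P
    proof -
      have "\<forall>n. AE \<omega> in P. g \<omega> \<le> F n \<omega>" using z(2) P meas by (auto simp: g(2) qs_le_cls)
      then have "AE \<omega> in P. \<forall>n. g \<omega> \<le> F n \<omega>" by (simp add: AE_all_countable)
      then show ?thesis
        using AE_space
      proof eventually_elim
        case (elim \<omega>)
        then show ?case using lim[of \<omega>] space[OF P] by (auto intro: LIMSEQ_le_const)
      qed
    qed
    then show ?thesis by (simp add: g(2) qs_le_cls)
  qed
  then have "greatest (Lat H) (vzero (Lat H)) (Lower (Lat H) (range ?y))"
    using zero le0 funsD(2)[OF F] by (auto simp: greatest_def Lower_def)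
  \<comment> \<open>The functions are nonnegative, so the sequence of classes serves as its own
    dominating sequence.\<close>
  moreover have "vabs (Lat H) (?y n) = ?y n" for n
    unfolding vabs_cls[OF H F] using nonneg meas by (intro cls_cong AE_I2) (auto simp: space)
  moreover have "qs_le PP (?y n) (?y n)" "qs_le PP (?y (Suc n)) (?y n)" for n
    using dec meas by (auto simp: qs_le_cls space intro!: AE_I2)
  ultimately have "(\<lambda>n. \<bar>vnorm (Lat H) (?y n)\<bar>) \<longlonglongrightarrow> 0"
    using soc funsD(2)[OF F] le0 unfolding sigma_order_continuous_def by (elim conjE allE[of _ ?y]) auto
  then show ?thesis using meas by (simp add: vnorm_cls)
qed

text \<open>Along a decreasing null sequence \<open>I\<close> is squeezed between 0 and a multiple
  of the norm, so Daniell continuity is inherited from \<open>nrm_tendsto_0\<close>.\<close>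

lemma daniell_if_bounded:
  assumes add: "\<And>f g. f \<in> funs H \<Longrightarrow> g \<in> funs H \<Longrightarrow> I (\<lambda>\<omega>. f \<omega> + g \<omega>) = I f + I g"
    and scale: "\<And>f c. f \<in> funs H \<Longrightarrow> I (\<lambda>\<omega>. c * f \<omega>) = c * I f"
    and nonneg: "\<And>f. f \<in> funs H \<Longrightarrow> (\<And>\<omega>. \<omega> \<in> space M \<Longrightarrow> 0 \<le> f \<omega>) \<Longrightarrow> 0 \<le> I f"
    and bound: "\<And>f. f \<in> funs H \<Longrightarrow> (\<And>\<omega>. \<omega> \<in> space M \<Longrightarrow> 0 \<le> f \<omega>) \<Longrightarrow> I f \<le> K * nrm f"
  shows "daniell (space M) (funs H) I"
proof unfold_locales
  fix F :: "nat \<Rightarrow> 'a \<Rightarrow> real"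
  assume F: "\<And>n. F n \<in> funs H" and dec: "\<And>\<omega> n. \<omega> \<in> space M \<Longrightarrow> F (Suc n) \<omega> \<le> F n \<omega>"
    and lim: "\<And>\<omega>. \<omega> \<in> space M \<Longrightarrow> (\<lambda>n. F n \<omega>) \<longlonglongrightarrow> 0"
  have F0: "0 \<le> F n \<omega>" if "\<omega> \<in> space M" for n \<omega>
    using decseq_ge[OF decseq_SucI[of "\<lambda>n. F n \<omega>"] lim[OF that], of n] dec[OF that] by simp
  have lim': "(\<lambda>n. K * nrm (F n)) \<longlonglongrightarrow> 0"
    using tendsto_mult[OF tendsto_const[of K] nrm_tendsto_0[OF F dec lim]] by simp
  show "(\<lambda>n. I (F n)) \<longlonglongrightarrow> 0"
    using F F0 nonneg bound by (intro tendsto_sandwich[OF _ _ tendsto_const lim'] always_eventually allI) auto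
qed (use add scale nonneg in auto)

text \<open>The measure is found and estimated on \<open>H\<close>, and \<open>ca_on_C_eq\<close>
  transfers it to \<open>C\<close>. Its functional and \<open>l\<close> agree on \<open>H\<close>;
  both are bounded by the norm, so they agree on the closure.\<close>

lemma norm_dual_representation:
  assumes l: "l \<in> norm_dual (Lat C)"
  obtains \<mu> where "\<mu> \<in> ca_on M PP \<Phi> C" "functional_on M C \<mu> = l"
proof -
  note HC = H C
  note funs_H_C = subsetD[OF funs_H_subset_C[OF HC]]
  note sub_C = sublat_C[OF HC]
  obtain K where l_ext: "l \<in> extensional C"
    and l_add: "\<And>f g. f \<in> funs C \<Longrightarrow> g \<in> funs C \<Longrightarrow> l (cls (\<lambda>\<omega>. f \<omega> + g \<omega>)) = l (cls f) + l (cls g)"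
    and l_scale: "\<And>f c. f \<in> funs C \<Longrightarrow> l (cls (\<lambda>\<omega>. c * f \<omega>)) = c * l (cls f)"
    and K: "0 \<le> K" "\<And>f. f \<in> funs C \<Longrightarrow> \<bar>l (cls f)\<bar> \<le> K * nrm f"
    using l unfolding norm_dual_iff[OF sub_C] by blast
  define J where "J f = l (cls f)" for f
  have J_add: "J (\<lambda>\<omega>. f \<omega> + g \<omega>) = J f + J g" if "f \<in> funs H" "g \<in> funs H" for f g
    unfolding J_def using that by (intro l_add funs_H_C)
  have J_scale: "J (\<lambda>\<omega>. c * f \<omega>) = c * J f" if "f \<in> funs H" for f c
    unfolding J_def using that by (intro l_scale funs_H_C)
  have J_bound: "\<bar>J f\<bar> \<le> K * nrm f" if "f \<in> funs H" for f
    unfolding J_def using that by (intro K funs_H_C)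
  have J_le: "J g \<le> K * nrm f"
    if fg: "f \<in> funs H" "g \<in> funs H" "\<And>\<omega>. \<omega> \<in> space M \<Longrightarrow> 0 \<le> g \<omega> \<and> g \<omega> \<le> f \<omega>" for f g
  proof -
    have "nrm g \<le> nrm f"
    proof (rule FL_mono(2)[OF funsD(1)[OF fg(2)] sublat_FL[OF H fg(1)]])
      fix P assume "P \<in> PP"
      then have "space P = space M" using PP_sets sets_eq_imp_space_eq by blast
      then show "AE \<omega> in P. \<bar>g \<omega>\<bar> \<le> \<bar>f \<omega>\<bar>" using fg(3) by (intro AE_I2) force
    qed
    then show ?thesis using J_bound[OF fg(2)] mult_left_mono[OF _ K(1), of "nrm g" "nrm f"] by linarith
  qed
  obtain I where I_add: "\<And>f g. f \<in> funs H \<Longrightarrow> g \<in> funs H \<Longrightarrow> I (\<lambda>\<omega>. f \<omega> + g \<omega>) = I f + I g"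
    and I_scale: "\<And>f c. f \<in> funs H \<Longrightarrow> I (\<lambda>\<omega>. c * f \<omega>) = c * I f"
    and I_nonneg: "\<And>f. f \<in> funs H \<Longrightarrow> (\<And>\<omega>. \<omega> \<in> space M \<Longrightarrow> 0 \<le> f \<omega>) \<Longrightarrow> 0 \<le> I f"
    and J_le_I: "\<And>f. f \<in> funs H \<Longrightarrow> (\<And>\<omega>. \<omega> \<in> space M \<Longrightarrow> 0 \<le> f \<omega>) \<Longrightarrow> J f \<le> I f"
    and I_bound: "\<And>f. f \<in> funs H \<Longrightarrow> (\<And>\<omega>. \<omega> \<in> space M \<Longrightarrow> 0 \<le> f \<omega>) \<Longrightarrow> I f \<le> K * nrm f"
  proof (rule fl.order_bounded_le_positive[OF J_add J_scale J_le], assumption+)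
    fix I :: "('a \<Rightarrow> real) \<Rightarrow> real"
    assume I: "\<And>f g. f \<in> funs H \<Longrightarrow> g \<in> funs H \<Longrightarrow> I (\<lambda>\<omega>. f \<omega> + g \<omega>) = I f + I g"
      "\<And>f c. f \<in> funs H \<Longrightarrow> I (\<lambda>\<omega>. c * f \<omega>) = c * I f"
      "\<And>f. f \<in> funs H \<Longrightarrow> (\<And>\<omega>. \<omega> \<in> space M \<Longrightarrow> 0 \<le> f \<omega>) \<Longrightarrow> 0 \<le> I f"
      "\<And>f. f \<in> funs H \<Longrightarrow> (\<And>\<omega>. \<omega> \<in> space M \<Longrightarrow> 0 \<le> f \<omega>) \<Longrightarrow> J f \<le> I f"
      "\<And>f. f \<in> funs H \<Longrightarrow> (\<And>\<omega>. \<omega> \<in> space M \<Longrightarrow> 0 \<le> f \<omega>) \<Longrightarrow> I f \<le> K * nrm f"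
    show thesis by (rule that[OF I])
  qed
  \<comment> \<open>This is the functional to be subtracted. It is positive because
    \<open>J \<le> I\<close> on nonnegative functions, and the bounds \<open>K\<close> for both
    \<open>I\<close> and \<open>\<bar>J\<bar>\<close> add up to \<open>2 * K\<close>.\<close>
  define I' where "I' f = I f - J f" for f
  have I'_bound: "I' f \<le> (2 * K) * nrm f" if "f \<in> funs H" "\<And>\<omega>. \<omega> \<in> space M \<Longrightarrow> 0 \<le> f \<omega>" for f
    using I_bound[OF that] J_bound[OF that(1)] by (auto simp: I'_def)
  interpret p: daniell "space M" "funs H" I
    by (rule daniell_if_bounded[OF I_add I_scale I_nonneg I_bound])
  interpret n: daniell "space M" "funs H" I'
    by (rule daniell_if_bounded[OF _ _ _ I'_bound])
      (use J_le_I in \<open>auto simp: I'_def I_add I_scale J_add J_scale right_diff_distrib\<close>)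
  define P N where "P = p.daniell_measure" and "N = n.daniell_measure"
  have sets: "sets P = sets M" "sets N = sets M"
    by (simp_all add: P_def N_def sigma_sets_pos_sets)
  have space: "space P = space M" "space N = space M" by (simp_all add: P_def N_def)
  have fin: "finite_measure P" "finite_measure N"
    unfolding P_def N_def by (rule p.finite_measure_daniell n.finite_measure_daniell)+
  have int: "integrable P f" "integrable N f" "(\<integral>\<omega>. f \<omega> \<partial>P) = I f" "(\<integral>\<omega>. f \<omega> \<partial>N) = I' f" if "f \<in> funs H" for f
    unfolding P_def N_def using that by (simp_all add: p.daniell_stone n.daniell_stone)
  define \<mu> where "\<mu> = (\<lambda>A. measure P A - measure N A)"
  have sm: "signed_measure M \<mu>" and pos_le: "\<And>A. emeasure (pos_var M \<mu>) A \<le> emeasure P A"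
    and neg_le: "\<And>A. emeasure (neg_var M \<mu>) A \<le> emeasure N A"
    unfolding \<mu>_def using signed_measure_diff[OF sets fin] by auto
  have abs_le: "emeasure (abs_var M \<mu>) A \<le> emeasure P A + emeasure N A" for A
    unfolding emeasure_abs_var by (intro add_mono pos_le neg_le)
  have null: "emeasure P A = 0 \<and> emeasure N A = 0" if A: "A \<in> sets M" "(SUP Q\<in>PP. emeasure Q A) = 0" for A
  proof -
    have "AE \<omega> in Q. indicator A \<omega> = (0::real)" if Q: "Q \<in> PP" for Q
    proof -
      have "emeasure Q A = 0" using A(2) Q by (metis SUP_upper le_zero_eq)
      then have "AE \<omega> in Q. \<omega> \<notin> A" using A(1) PP_sets[OF Q] by (intro AE_not_in) (auto simp: null_sets_def)
      then show ?thesis by eventually_elim simp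
    qed
    moreover have meas: "indicator A \<in> borel_measurable M" using A by simp
    ultimately have cls: "cls (indicator A) = cls (\<lambda>_. 0)" by (intro cls_cong) auto
    \<comment> \<open>As a representative of the zero class the indicator is a member of norm 0, so
      both positive functionals vanish on it; their values there are the measures of
      \<open>A\<close>.\<close>
    then have ind: "indicator A \<in> funs H" using sublat_closed(1)[OF H] meas by (auto simp: funs_def)
    have nrm: "nrm (indicator A) = 0" using nrm_eq_0_iff[OF sublat_FL[OF H ind]] cls by simp
    have "I (indicator A) = 0" "I' (indicator A) = 0"
      using I_bound[OF ind] I'_bound[OF ind] p.I_nonneg[OF ind] n.I_nonneg[OF ind] nrm by auto
    then have "measure P A = 0" "measure N A = 0"
      using int(3,4)[OF ind] A(1) sets.Int_space_eq2[of A M] by (simp_all add: space)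
    then show ?thesis using fin by (simp add: finite_measure.emeasure_eq_measure)
  qed
  have "emeasure (abs_var M \<mu>) (space M) \<le> emeasure P (space M) + emeasure N (space M)" by (rule abs_le)
  also have "\<dots> < \<infinity>"
    using finite_measure.emeasure_finite[OF fin(1)] finite_measure.emeasure_finite[OF fin(2)] by (auto simp: less_top)
  finally have ca: "\<mu> \<in> ca M PP"
    using sm null abs_le by (auto simp: ca_def) (metis add.right_neutral le_zero_eq)
  \<comment> \<open>The constant is \<open>K\<close> from \<open>I\<close> plus \<open>2 * K\<close>
    from \<open>I'\<close>, since \<open>|\<mu>|\<close> is dominated by the sum of the two Daniell
    measures.\<close>
  have abs_int: "integrable (abs_var M \<mu>) f \<and> (\<integral>\<omega>. \<bar>f \<omega>\<bar> \<partial>abs_var M \<mu>) \<le> (3 * K) * nrm f" if f: "f \<in> funs H" for f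
  proof -
    note [measurable] = funsD(1)[OF f]
    note af = sublat_abs[OF H f]
    have [measurable]: "f \<in> borel_measurable P" by (simp add: measurable_cong_sets[OF sets(1)])
    have "(\<integral>\<^sup>+\<omega>. ennreal \<bar>f \<omega>\<bar> \<partial>abs_var M \<mu>) \<le> (\<integral>\<^sup>+\<omega>. ennreal \<bar>f \<omega>\<bar> \<partial>plus_measure P N)"
      by (intro nn_integral_mono_measure) (auto simp: sets le_measure emeasure_plus_measure abs_le)
    also have "\<dots> = (\<integral>\<^sup>+\<omega>. ennreal \<bar>f \<omega>\<bar> \<partial>P) + (\<integral>\<^sup>+\<omega>. ennreal \<bar>f \<omega>\<bar> \<partial>N)"
      using sets by (intro nn_integral_plus_measure) auto
    also have "\<dots> = ennreal (I (\<lambda>\<omega>. \<bar>f \<omega>\<bar>)) + ennreal (I' (\<lambda>\<omega>. \<bar>f \<omega>\<bar>))"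
      using int[OF af] by (simp add: nn_integral_eq_integral)
    also have "\<dots> = ennreal (I (\<lambda>\<omega>. \<bar>f \<omega>\<bar>) + I' (\<lambda>\<omega>. \<bar>f \<omega>\<bar>))"
      using p.I_nonneg[OF af] n.I_nonneg[OF af] by simp
    also have "\<dots> \<le> ennreal ((3 * K) * nrm f)"
      using I_bound[OF af] I'_bound[OF af] FL_abs(2)[of f] by (intro ennreal_leI) auto
    finally have bound: "(\<integral>\<^sup>+\<omega>. ennreal \<bar>f \<omega>\<bar> \<partial>abs_var M \<mu>) \<le> ennreal ((3 * K) * nrm f)" .
    then have "integrable (abs_var M \<mu>) f"
      by (intro integrableI_bounded) (auto intro: le_less_trans)
    moreover from this have "(\<integral>\<omega>. \<bar>f \<omega>\<bar> \<partial>abs_var M \<mu>) \<le> (3 * K) * nrm f"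
      using bound K by (subst (asm) nn_integral_eq_integral) auto
    ultimately show ?thesis by blast
  qed
  have "\<mu> \<in> ca_on M PP \<Phi> H" unfolding ca_on_iff[OF H] using ca abs_int K by (auto intro!: exI[of _ "3 * K"])
  then have \<mu>_C: "\<mu> \<in> ca_on M PP \<Phi> C" by (simp add: ca_on_C_eq[OF HC])
  \<comment> \<open>\<open>P\<close> and \<open>N\<close> need not be the Jordan parts of
    \<open>\<mu>\<close>; the equality of the two differences is rearranged into one of sums, over
    which integrals can be split.\<close>
  have pn: "plus_measure (pos_var M \<mu>) N = plus_measure (neg_var M \<mu>) P"
  proof (rule measure_eqI)
    fix A assume "A \<in> sets (plus_measure (pos_var M \<mu>) N)"
    then have A: "A \<in> sets M" by simp
    have "\<mu> A = measure (pos_var M \<mu>) A - measure (neg_var M \<mu>) A"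
      using ca A by (intro jordan_decomposition) (auto simp: ca_def)
    then have "measure (pos_var M \<mu>) A + measure N A = measure (neg_var M \<mu>) A + measure P A"
      by (simp add: \<mu>_def)
    then show "emeasure (plus_measure (pos_var M \<mu>) N) A = emeasure (plus_measure (neg_var M \<mu>) P) A"
      using caD(3,4)[OF ca] fin
      by (simp add: emeasure_plus_measure sets finite_measure.emeasure_eq_measure ennreal_plus[symmetric] del: ennreal_plus)
  qed simp
  have on_H: "signed_integral M \<mu> (cls f) = l (cls f)" if f: "f \<in> funs H" for f
  proof -
    have int_var: "integrable (pos_var M \<mu>) f" "integrable (neg_var M \<mu>) f"
      using abs_int[OF f] by (auto simp: integrable_var)
    have "(\<integral>\<omega>. f \<omega> \<partial>pos_var M \<mu>) + (\<integral>\<omega>. f \<omega> \<partial>N) = (\<integral>\<omega>. f \<omega> \<partial>plus_measure (pos_var M \<mu>) N)"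
      using int_var int[OF f] by (intro integral_plus_measure[symmetric]) (auto simp: sets)
    also have "\<dots> = (\<integral>\<omega>. f \<omega> \<partial>neg_var M \<mu>) + (\<integral>\<omega>. f \<omega> \<partial>P)"
      unfolding pn using int_var int[OF f] by (intro integral_plus_measure) (auto simp: sets)
    finally show ?thesis
      using int[OF f] by (simp add: integral_rep_cls(2)[OF ca funsD(1)[OF f]] I'_def J_def)
  qed
  let ?m = "functional_on M C \<mu>"
  obtain K' where m_add: "\<And>f g. f \<in> funs C \<Longrightarrow> g \<in> funs C \<Longrightarrow> ?m (cls (\<lambda>\<omega>. f \<omega> + g \<omega>)) = ?m (cls f) + ?m (cls g)"
    and m_scale: "\<And>f c. f \<in> funs C \<Longrightarrow> ?m (cls (\<lambda>\<omega>. c * f \<omega>)) = c * ?m (cls f)"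
    and K': "0 \<le> K'" "\<And>f. f \<in> funs C \<Longrightarrow> \<bar>?m (cls f)\<bar> \<le> K' * nrm f"
    using functional_on_mem_norm_dual[OF sub_C \<mu>_C] unfolding norm_dual_iff[OF sub_C] by blast
  have "?m X = l X" for X
  proof (cases "X \<in> C")
    case True
    then obtain f where f: "f \<in> funs C" "X = cls f" using sublat_cases[OF sub_C] by blast
    have "\<bar>?m (cls f) - l (cls f)\<bar> \<le> 0 + e" if e: "0 < e" for e
    proof -
      \<comment> \<open>\<open>K\<close> and \<open>K'\<close> are the bounds of the two functionals
        to be compared; the summand 1 makes the denominator positive.\<close>
      obtain h where h: "h \<in> funs H" "nrm (\<lambda>\<omega>. f \<omega> - h \<omega>) < e / (K + K' + 1)"
        using f(1) e K(1) K'(1) unfolding funs_C[OF HC] by (auto dest!: spec[of _ "e / (K + K' + 1)"])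
      \<comment> \<open>The difference \<open>f - h\<close> is written with the factor -1 so that
        the additivity and homogeneity rules match it literally.\<close>
      let ?d = "\<lambda>\<omega>. f \<omega> + (-1) * h \<omega>"
      have hC: "h \<in> funs C" "(\<lambda>\<omega>. (-1) * h \<omega>) \<in> funs C" "?d \<in> funs C"
        using funs_H_C[OF h(1)] f(1) sublat_closed[OF sub_C] by blast+
      have "?m (cls h) = l (cls h)" using on_H[OF h(1)] hC(1) by (auto simp: functional_on_def)
      then have "?m (cls f) - l (cls f) = ?m (cls ?d) - l (cls ?d)"
        using f(1) hC by (simp only: m_add l_add m_scale l_scale)
      then have "\<bar>?m (cls f) - l (cls f)\<bar> \<le> (K' + K) * nrm ?d"
        using K(2)[OF hC(3)] K'(2)[OF hC(3)] by (simp only: distrib_right)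
      also have "\<dots> \<le> (K + K' + 1) * nrm ?d" by (intro mult_right_mono) auto
      also have "\<dots> \<le> (K + K' + 1) * (e / (K + K' + 1))"
        using h(2) K(1) K'(1) by (intro mult_left_mono) auto
      also have "\<dots> = e" using K(1) K'(1) by simp
      finally show ?thesis by simp
    qed
    then have "\<bar>?m (cls f) - l (cls f)\<bar> \<le> 0" by (rule field_le_epsilon)
    then show ?thesis by (simp add: f(2))
  next
    case False
    then show ?thesis using l_ext by (simp add: functional_on_def extensional_def)
  qed
  then have "?m = l" by (rule ext)
  with \<mu>_C that show thesis by blast
qed

text \<open>This is the identification of \<open>C^*\<close> with
  \<open>ca_on M PP \<Phi> C\<close>. For injectivity the functionals need to be compared on
  \<open>H\<close> only, since \<open>H\<close> generates the \<sigma>-algebra.\<close>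

lemma bij_betw_functional_on:
  "bij_betw (functional_on M C) (ca_on M PP \<Phi> C) (norm_dual (Lat C))"
proof (rule bij_betwI')
  note HC = H C
  fix \<mu> \<nu> assume \<mu>: "\<mu> \<in> ca_on M PP \<Phi> C" and \<nu>: "\<nu> \<in> ca_on M PP \<Phi> C"
  have "\<mu> = \<nu>" if eq: "functional_on M C \<mu> = functional_on M C \<nu>"
  proof (rule ca_eq_if_signed_integral_eq)
    show "\<mu> \<in> ca M PP" "\<nu> \<in> ca M PP" using \<mu> \<nu> by (auto simp: ca_on_def)
    fix f assume f: "f \<in> funs H"
    then show "integrable (abs_var M \<mu>) f" "integrable (abs_var M \<nu>) f"
      using \<mu> \<nu> unfolding ca_on_C_eq[OF HC] ca_on_iff[OF H] by blast+
    have "cls f \<in> C" using H_subset_C[OF HC] f by auto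
    then show "signed_integral M \<mu> (cls f) = signed_integral M \<nu> (cls f)"
      using fun_cong[OF eq, of "cls f"] by (simp add: functional_on_def)
  qed
  then show "functional_on M C \<mu> = functional_on M C \<nu> \<longleftrightarrow> \<mu> = \<nu>" by blast
next
  fix \<mu> assume "\<mu> \<in> ca_on M PP \<Phi> C"
  then show "functional_on M C \<mu> \<in> norm_dual (Lat C)" by (rule functional_on_mem_norm_dual[OF sublat_C[OF H C]])
next
  fix l assume "l \<in> norm_dual (Lat C)"
  then show "\<exists>\<mu>\<in>ca_on M PP \<Phi> C. l = functional_on M C \<mu>" using norm_dual_representation by metis
qed

text \<open>The functional is bounded by a multiple of the norm and so inherits convergence along
  order null sequences from it. On order intervals it is bounded because
  \<open>f \<le> h \<le> g\<close> implies
  \<open>\<bar>h\<bar> \<le> \<bar>f\<bar> + \<bar>g\<bar>\<close>.\<close>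

lemma ca_on_subset_ca_sigma: "ca_on M PP \<Phi> H \<subseteq> ca_sigma M PP \<Phi> H"
proof
  fix \<mu> assume \<mu>: "\<mu> \<in> ca_on M PP \<Phi> H"
  then obtain K where ca: "\<mu> \<in> ca M PP" and K: "0 \<le> K"
    and int: "\<And>f. f \<in> funs H \<Longrightarrow> integrable (abs_var M \<mu>) f"
    and le: "\<And>f. f \<in> funs H \<Longrightarrow> (\<integral>\<omega>. \<bar>f \<omega>\<bar> \<partial>abs_var M \<mu>) \<le> K * nrm f"
    unfolding ca_on_iff[OF H] by blast
  have bound: "\<bar>signed_integral M \<mu> (cls f)\<bar> \<le> K * nrm f" if "f \<in> funs H" for f
    using abs_signed_integral_le[OF ca funsD(1)[OF that] int[OF that]] le[OF that] by linarith
  have "sigma_order_continuous (Lat H) (signed_integral M \<mu>)"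
    unfolding sigma_order_continuous_def
  proof (intro conjI ballI allI impI)
    fix x y assume "x \<in> carrier (Lat H)" "y \<in> carrier (Lat H)"
    then obtain f g where fg: "f \<in> funs H" "g \<in> funs H" "x = cls f" "y = cls g"
      by (auto elim!: sublat_cases[OF H])
    note [measurable] = fg(1,2)[THEN funsD(1)]
    show "bounded (signed_integral M \<mu> ` \<lbrace>x..y\<rbrace>\<^bsub>Lat H\<^esub>)"
      unfolding bounded_iff
    proof (intro exI ballI, safe)
      fix z assume z: "z \<in> \<lbrace>x..y\<rbrace>\<^bsub>Lat H\<^esub>"
      then obtain h where h: "h \<in> funs H" "z = cls h"
        by (auto simp: at_least_at_most_def elim!: sublat_cases[OF H])
      note [measurable] = funsD(1)[OF h(1)]
      let ?s = "\<lambda>\<omega>. \<bar>f \<omega>\<bar> + \<bar>g \<omega>\<bar>"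
      have "nrm h \<le> nrm ?s"
      proof (rule FL_mono(2))
        show "?s \<in> FL" using fg(1,2) by (intro FL_add(1) FL_abs(1) sublat_FL[OF H])
        fix P assume P: "P \<in> PP"
        have "AE \<omega> in P. f \<omega> \<le> h \<omega>" "AE \<omega> in P. h \<omega> \<le> g \<omega>"
          using z P by (auto simp: at_least_at_most_def fg h qs_le_cls)
        then show "AE \<omega> in P. \<bar>h \<omega>\<bar> \<le> \<bar>\<bar>f \<omega>\<bar> + \<bar>g \<omega>\<bar>\<bar>" by eventually_elim auto
      qed simp
      then have "K * nrm h \<le> K * nrm ?s" using K by (rule mult_left_mono)
      then show "norm (signed_integral M \<mu> z) \<le> K * nrm ?s" using bound[OF h(1)] by (simp add: h(2))
    qed
  next
    fix x y :: "nat \<Rightarrow> ('a \<Rightarrow> real) set"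
    assume *: "(\<forall>n. x n \<in> carrier (Lat H)) \<and> (\<forall>n. y n \<in> carrier (Lat H) \<and> vzero (Lat H) \<sqsubseteq>\<^bsub>Lat H\<^esub> y n) \<and>
      (\<forall>n. vabs (Lat H) (x n) \<sqsubseteq>\<^bsub>Lat H\<^esub> y n) \<and> (\<forall>n. y (Suc n) \<sqsubseteq>\<^bsub>Lat H\<^esub> y n) \<and>
      greatest (Lat H) (vzero (Lat H)) (Lower (Lat H) (range y))"
    have "(\<lambda>n. \<bar>vnorm (Lat H) (x n)\<bar>) \<longlonglongrightarrow> 0"
      using soc * unfolding sigma_order_continuous_def by blast
    from tendsto_mult[OF tendsto_const[of K] this]
    have lim: "(\<lambda>n. K * \<bar>vnorm (Lat H) (x n)\<bar>) \<longlonglongrightarrow> 0" by simp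
    have "\<bar>signed_integral M \<mu> (x n)\<bar> \<le> K * \<bar>vnorm (Lat H) (x n)\<bar>" for n
    proof -
      have "x n \<in> H" using * by simp
      then obtain f where "f \<in> funs H" "x n = cls f" by (rule sublat_cases[OF H])
      then show ?thesis using bound[of f] by (simp add: vnorm_cls funsD)
    qed
    then show "(\<lambda>n. \<bar>signed_integral M \<mu> (x n)\<bar>) \<longlonglongrightarrow> 0"
      by (intro tendsto_sandwich[OF _ _ tendsto_const lim] always_eventually allI) auto
  qed
  then show "\<mu> \<in> ca_sigma M PP \<Phi> H"
    using ca int by (simp add: ca_sigma_def all_integrable_iff[OF sublat_subset_L0[OF H]])
qed

text \<open>A measure in \<open>ca_sigma M PP \<Phi> H\<close> acts on \<open>H\<close> only, so the
  intersection with the dual of \<open>C\<close> is formed through restrictions to \<open>H\<close>.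
  If it acts there like \<open>l\<close>, it has the same integrals over \<open>H\<close> as the
  measure that represents \<open>l\<close> on \<open>C\<close>, and uniqueness identifies the
  two.\<close>

lemma ca_on_eq_ca_sigma_Int_dual:
  "ca_on M PP \<Phi> H = {\<mu> \<in> ca_sigma M PP \<Phi> H.
     functional_on M H \<mu> \<in> (\<lambda>l. restrict l H) ` norm_dual (Lat C)}"
proof (intro equalityI subsetI CollectI conjI)
  note HC = H C
  fix \<mu> assume \<mu>: "\<mu> \<in> ca_on M PP \<Phi> H"
  then show "\<mu> \<in> ca_sigma M PP \<Phi> H" using ca_on_subset_ca_sigma by blast
  have "functional_on M H \<mu> = restrict (functional_on M C \<mu>) H"
    using H_subset_C[OF HC] by (auto simp: functional_on_def restrict_def fun_eq_iff)
  moreover have "functional_on M C \<mu> \<in> norm_dual (Lat C)"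
    using \<mu> by (intro functional_on_mem_norm_dual[OF sublat_C[OF HC]]) (simp add: ca_on_C_eq[OF HC])
  ultimately show "functional_on M H \<mu> \<in> (\<lambda>l. restrict l H) ` norm_dual (Lat C)" by blast
next
  note HC = H C
  fix \<mu> assume "\<mu> \<in> {\<mu> \<in> ca_sigma M PP \<Phi> H. functional_on M H \<mu> \<in> (\<lambda>l. restrict l H) ` norm_dual (Lat C)}"
  then obtain l where \<mu>: "\<mu> \<in> ca_sigma M PP \<Phi> H" and l: "l \<in> norm_dual (Lat C)" "functional_on M H \<mu> = restrict l H"
    by auto
  obtain \<nu> where \<nu>: "\<nu> \<in> ca_on M PP \<Phi> C" "functional_on M C \<nu> = l" using norm_dual_representation[OF l(1)] .
  have "\<mu> = \<nu>"
  proof (rule ca_eq_if_signed_integral_eq)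
    show "\<mu> \<in> ca M PP" "\<nu> \<in> ca M PP" using \<mu> \<nu> by (auto simp: ca_on_def ca_sigma_def)
    fix f assume f: "f \<in> funs H"
    show "integrable (abs_var M \<mu>) f"
      using \<mu> f by (simp add: ca_sigma_def all_integrable_iff[OF sublat_subset_L0[OF H]])
    show "integrable (abs_var M \<nu>) f"
      using \<nu>(1) f unfolding ca_on_C_eq[OF HC] ca_on_iff[OF H] by blast
    have "cls f \<in> H" "cls f \<in> C" using H_subset_C[OF HC] f by auto
    then show "signed_integral M \<mu> (cls f) = signed_integral M \<nu> (cls f)"
      using fun_cong[OF l(2), of "cls f"] \<nu>(2) by (auto simp: functional_on_def)
  qed
  then show "\<mu> \<in> ca_on M PP \<Phi> H" using \<nu>(1) by (simp add: ca_on_C_eq[OF HC])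
qed

end

end

end

theorem proposition4p5:
  fixes M :: "'a measure" and PP :: "'a measure set"
    and \<Phi> :: "'a measure \<Rightarrow> real \<Rightarrow> ennreal"
    and H C :: "('a \<Rightarrow> real) set set"
  assumes "PP \<noteq> {}"
    and "\<And>P. P \<in> PP \<Longrightarrow> prob_space P \<and> sets P = sets M"
    and "\<And>P. P \<in> PP \<Longrightarrow> orlicz_function (\<Phi> P)"
    and "Linf M PP \<subseteq> LPhi M PP \<Phi>"
    and "vector_sublattice H (space_on M PP \<Phi> (LPhi M PP \<Phi>))"
    and "qs_class M PP (indicator (space M)) \<in> H"
    and "generates M PP H"
    and "C = norm_topology (space_on M PP \<Phi> (LPhi M PP \<Phi>)) closure_of H"
  shows "banach_lattice (space_on M PP \<Phi> C) \<and>
    ca_on M PP \<Phi> C = ca_on M PP \<Phi> H \<and>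
    (H \<subseteq> Linf M PP \<and>
     sigma_order_continuous (space_on M PP \<Phi> H) (vnorm (space_on M PP \<Phi> H)) \<longrightarrow>
       bij_betw (functional_on M C) (ca_on M PP \<Phi> C) (norm_dual (space_on M PP \<Phi> C)) \<and>
       ca_on M PP \<Phi> C = ca_on M PP \<Phi> H \<and>
       ca_on M PP \<Phi> H =
         {\<mu> \<in> ca_sigma M PP \<Phi> H.
            functional_on M H \<mu> \<in> (\<lambda>l. restrict l H) ` norm_dual (space_on M PP \<Phi> C)})"
proof -
  interpret robust_orlicz M PP \<Phi>
    by (rule robust_orlicz.intro) (use assms(1-3) in auto)
  have H: "sublat H" using assms(5) by (rule sublat_if_vector_sublattice)
  \<comment> \<open>The function lattice is asked to contain the constant 1 on the whole type,
    whereas the hypothesis is about the indicator of \<open>space M\<close>; the two differ only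
    outside of \<open>space M\<close>.\<close>
  have "cls (\<lambda>_. 1) = cls (indicator (space M))"
  proof (rule cls_cong)
    fix P assume "P \<in> PP"
    then have "space P = space M" using PP_sets sets_eq_imp_space_eq by blast
    then show "AE \<omega> in P. 1 = indicator (space M) \<omega>" by (intro AE_I2) simp
  qed auto
  then have one: "(\<lambda>_. 1) \<in> funs H" using assms(6) by (simp add: funs_def)
  show ?thesis
    using banach_lattice_C[OF H assms(8)] ca_on_C_eq[OF H assms(8)]
      bij_betw_functional_on[OF H assms(8) one assms(7)]
      ca_on_eq_ca_sigma_Int_dual[OF H assms(8) one assms(7)]
    by blast
qed

end
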